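(* Let $D\subset\mathbb{R}^d$ be a compact parallelepiped, let $g_1,g_2:D\to\mathbb{R}$ be functions and let $$G=\{(x,y):x\in D,\ g_1(x)\le y\le g_2(x)\}\subset\mathbb{R}^{d+1}$$ (assumed measurable). Assume that there exist a linear (affine) function $H$ on $\mathbb{R}^d$, a number $\delta>0$ and a parameter $L>1$ such that $$\delta\le(-1)^i\bigl(g_i(x)-H(x)\bigr)\le L\delta\quad\text{for all }x\in D,\ i=1,2.$$ Let $S=\{(x,y):x\in D,\ H(x)-\delta\le y\le H(x)+\delta\}$, so that $S\subset G$. Then for each $r\in\mathbb{N}$, $0<p\le\infty$ and $f\in L^p(G)$, $$E_{r-1}(f;\mathcal{E}\cup\{e_{d+1}\})_{L^p(G)}\le C(p,d,r,L)\Bigl[\omega^r(f,S;\mathcal{E})_p+\omega^r(f,G;e_{d+1})_p\Bigr],$$ where $\mathcal{E}\subset\mathbb{S}^d$ is the set of edge directions of the parallelepiped $S$ that are the lifts of the edge directions of $D$, i.e. the unit vectors in the directions $(v,\nabla H\cdot v)$ with $v$ an edge direction of $D$, and $C(p,d,r,L)$ depends only on $p,d,r,L$.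
   Context: $\mathbb{S}^d$ is the unit sphere of $\mathbb{R}^{d+1}$, $e_{d+1}=(0,\dots,0,1)$. For $\mathcal{E}'\subset\mathbb{S}^d$ with $\mathrm{span}(\mathcal{E}')=\mathbb{R}^{d+1}$, $\Pi^{d+1}_{r-1}(\mathcal{E}')$ is the (finite-dimensional) set of all algebraic polynomials $Q$ on $\mathbb{R}^{d+1}$ such that for every $x\in\mathbb{R}^{d+1}$ and $e\in\mathcal{E}'$ the function $t\mapsto Q(x+te)$ is a polynomial of degree $<r$ in $t$, and $E_{r-1}(f;\mathcal{E}')_{L^p(G)}=\inf\{\|f-Q\|_{L^p(G)}:Q\in\Pi^{d+1}_{r-1}(\mathcal{E}')\}$. $\triangle^r_\xi f(\eta)=\sum_{j=0}^r(-1)^{r+j}\binom rjf(\eta+j\xi)$. For a set $G$ and $\mathcal{E}'\subset\mathbb{S}^d$, $\omega^r(f,G;\mathcal{E}')_p=\sup_{e\in\mathcal{E}'}\sup_{0<u\le\mathrm{diam}(G)}\|\triangle^r_{ue}f\|_{L^p(\{\xi\in G:[\xi,\xi+rue]\subset G\})}$, and $\omega^r(f,G;e)_p=\omega^r(f,G;\{e\})_p$. *)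

theory Defs
  imports "HOL-Analysis.Analysis" "HOL-Probability.Essential_Supremum"
begin

text \<open>The \<open>L\<^sup>p\<close> (quasi-)norm on \<open>G\<close> with respect to Lebesgue measure, for \<open>0 < p \<le> \<infinity>\<close>.\<close>

definition Lp_norm :: "ennreal \<Rightarrow> 'a::euclidean_space set \<Rightarrow> ('a \<Rightarrow> real) \<Rightarrow> ennreal" where
  "Lp_norm p G f =
     (if p = \<infinity> then esssup (lebesgue_on G) (\<lambda>x. ennreal \<bar>f x\<bar>)
      else (let I = \<integral>\<^sup>+ x. ennreal (\<bar>f x\<bar> powr enn2real p) \<partial>lebesgue_on G
            in if I = \<infinity> then \<infinity> else ennreal (enn2real I powr (1 / enn2real p))))"

definition in_Lp :: "ennreal \<Rightarrow> 'a::euclidean_space set \<Rightarrow> ('a \<Rightarrow> real) \<Rightarrow> bool" where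
  "in_Lp p G f \<longleftrightarrow> f \<in> borel_measurable (lebesgue_on G) \<and> Lp_norm p G f < \<infinity>"

text \<open>\<open>directional_polys r E\<close> is the space \<open>\<Pi>\<^bsub>r-1\<^esub>(E)\<close>, indexed by the strict degree bound \<open>r\<close>; it is
  the intended one for \<open>r \<ge> 1\<close> only, since \<^term>\<open>degree 0 = 0\<close>.\<close>

definition directional_polys :: "nat \<Rightarrow> 'a::euclidean_space set \<Rightarrow> ('a \<Rightarrow> real) set" where
  "directional_polys r E =
     {Q. real_polynomial_function Q \<and>
         (\<forall>x. \<forall>e\<in>E. \<exists>q :: real poly. degree q < r \<and> (\<forall>t. Q (x + t *\<^sub>R e) = poly q t))}"

text \<open>The error \<open>E\<^bsub>r-1\<^esub>(f; E)\<close> in \<open>L\<^sup>p(G)\<close>, with the same indexing by \<open>r\<close>.\<close>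

definition best_approx ::
  "nat \<Rightarrow> ('a::euclidean_space \<Rightarrow> real) \<Rightarrow> 'a set \<Rightarrow> ennreal \<Rightarrow> 'a set \<Rightarrow> ennreal" where
  "best_approx r f E p G = (INF Q\<in>directional_polys r E. Lp_norm p G (\<lambda>x. f x - Q x))"

definition fin_diff :: "nat \<Rightarrow> 'a::real_vector \<Rightarrow> ('a \<Rightarrow> real) \<Rightarrow> 'a \<Rightarrow> real" where
  "fin_diff r \<xi> f \<eta> = (\<Sum>j\<le>r. (- 1) ^ (r + j) * real (r choose j) * f (\<eta> + real j *\<^sub>R \<xi>))"

text \<open>The \<open>r\<close>-th directional modulus of smoothness; meaningful for bounded \<open>G\<close>, because
  \<^const>\<open>diameter\<close> is unspecified on unbounded sets.\<close>

definition dir_modulus ::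
  "nat \<Rightarrow> ('a::euclidean_space \<Rightarrow> real) \<Rightarrow> 'a set \<Rightarrow> 'a set \<Rightarrow> ennreal \<Rightarrow> ennreal" where
  "dir_modulus r f G E p =
     (SUP e\<in>E. SUP u\<in>{0<..diameter G}.
        Lp_norm p {\<xi>\<in>G. closed_segment \<xi> (\<xi> + (real r * u) *\<^sub>R e) \<subseteq> G} (fin_diff r (u *\<^sub>R e) f))"

text \<open>The parallelepiped with vertex \<open>a\<close> and edge vectors \<open>v i\<close> (nondegenerate when these are linearly
  independent), and its edge directions. One unit vector is taken per class of parallel edges; replacing
  one by its negative changes neither \<^const>\<open>directional_polys\<close> nor \<^const>\<open>dir_modulus\<close>.\<close>

definition parallelepiped :: "'a::real_vector \<Rightarrow> ('i::finite \<Rightarrow> 'a) \<Rightarrow> 'a set" where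
  "parallelepiped a v = {a + (\<Sum>i\<in>UNIV. t i *\<^sub>R v i) | t. \<forall>i. 0 \<le> t i \<and> t i \<le> 1}"

definition edge_directions :: "('i::finite \<Rightarrow> 'a::real_normed_vector) \<Rightarrow> 'a set" where
  "edge_directions v = range (\<lambda>i. sgn (v i))"

text \<open>The unit vector in the direction \<open>(e, \<nabla>H \<bullet> e)\<close>, where \<open>h\<close> is the gradient of the affine
  function \<open>H\<close>.\<close>

definition lift_direction :: "'a::euclidean_space \<Rightarrow> 'a \<Rightarrow> 'a \<times> real" where
  "lift_direction h e = sgn (e, h \<bullet> e)"

definition region_between :: "'a set \<Rightarrow> ('a \<Rightarrow> real) \<Rightarrow> ('a \<Rightarrow> real) \<Rightarrow> ('a \<times> real) set" where
  "region_between D g1 g2 = {(x, y). x \<in> D \<and> g1 x \<le> y \<and> y \<le> g2 x}"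

end

theory Submission
  imports Defs
begin

text \<open>
  Only translations of Lebesgue measure and one application of Fubini's theorem are used, so that every constant
  is the same for all parallelepipeds and the case \<open>p < 1\<close> needs no separate treatment.

  Let \<open>e i\<close> be half the edge vectors of \<open>S\<close>, and allow a separate degree bound \<open>\<rho> i\<close> in each direction. On a small
  box inside \<open>S\<close>, Whitney's inequality is proved by induction on \<open>\<Sum>i. \<rho> i\<close>. If all \<open>\<rho> i = 1\<close>, some value of \<open>f\<close> is a
  good constant approximation, since \<open>f x - f y\<close> telescopes into differences along the edges. If \<open>\<rho> i \<ge> 2\<close>, the
  first differences of \<open>f\<close> with step \<open>h * e i\<close> are close to polynomials \<open>P h\<close> by the induction hypothesis. These
  form an approximate cocycle, and by a contraction argument in the spirit of Hyers' stability theorem they are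
  close to the differences of a single polynomial \<open>q\<close>; so \<open>f - q\<close> has small first differences along \<open>e i\<close>, and the
  induction hypothesis with \<open>\<rho> i = 1\<close> applies to it.

  If \<open>F\<close> has a small \<open>r\<close>-th difference with step \<open>\<xi>\<close>, then \<open>F x\<close> is controlled by the values of \<open>F\<close> at
  \<open>x + \<xi>, \<dots>, x + r \<xi>\<close>. A bounded number of such steps carries the estimate of \<open>f - Q\<close> from the small box to \<open>S\<close>,
  one edge direction at a time, and then vertically from \<open>S\<close> to \<open>G\<close>.
\<close>


section \<open>Bounds on quasi-norms\<close>

text \<open>For p < 1 the function f need not be locally integrable, so neither its mean values nor
  polynomial projections given by integrals are available. This is why constants are sought among
  the values of f, and why Fubini is applied only to nonnegative functions of f x - f y. Uniformity
  in the parallelepiped comes from coordinates: in a dual basis every parallelepiped is a box, and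
  the only fact about measure that enters a constant is the ratio between a box and its homothetic
  copy. The small box is forced by the differences: their nodes leave the set unless the box and the
  steps are both small, and Kemperman's identity adds further shifts. The vertical direction comes
  last because g1 and g2 are arbitrary functions: beyond S, only vertical segments are known to stay
  in G. \<open>Lp_le\<close> uses real bounds and functions measurable on the whole space, so that
  translates and differences can be formed freely while the sets on which they are bounded are
  tracked separately.\<close>

definition Lp_le :: "ennreal \<Rightarrow> 'a::euclidean_space set \<Rightarrow> ('a \<Rightarrow> real) \<Rightarrow> real \<Rightarrow> bool" where
  "Lp_le p A f b \<longleftrightarrow> A \<in> sets lebesgue \<and> f \<in> borel_measurable lebesgue \<and> 0 \<le> b \<and>
     (if p = \<infinity> then AE x in lebesgue. x \<in> A \<longrightarrow> \<bar>f x\<bar> \<le> b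
      else (\<integral>\<^sup>+x. ennreal (\<bar>f x\<bar> powr enn2real p) * indicator A x \<partial>lebesgue) \<le> ennreal (b powr enn2real p))"

text \<open>For \<open>p = \<infinity>\<close> we have \<open>enn2real p = 0\<close> and \<open>1 / enn2real p = 0\<close>, so this constant is \<open>2\<close>, and powers with
  exponent \<open>1 / enn2real p\<close> are \<open>1\<close> below.\<close>

definition Lp_triangle :: "ennreal \<Rightarrow> real" where
  "Lp_triangle p = 2 powr (1 + 1 / enn2real p)"

primrec Lp_sum_const :: "ennreal \<Rightarrow> nat \<Rightarrow> real" where
  "Lp_sum_const p 0 = 0"
| "Lp_sum_const p (Suc n) = Lp_triangle p * (Lp_sum_const p n + 1)"

text \<open>The quasi-norm on \<open>A\<close> of the constant function 1, provided that
  \<open>A\<close> has finite positive measure; hence the value 1 for p = infinity.\<close>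

definition Lp_vol :: "ennreal \<Rightarrow> 'a::euclidean_space set \<Rightarrow> real" where
  "Lp_vol p A = (if p = \<infinity> then 1 else measure lebesgue A powr (1 / enn2real p))"

lemma Lp_triangle_ge_1: "1 \<le> Lp_triangle p"
  unfolding Lp_triangle_def by (rule ge_one_powr_ge_zero) auto

lemma Lp_sum_const_nonneg: "0 \<le> Lp_sum_const p n"
  using Lp_triangle_ge_1[of p] by (induction n) auto

lemma Lp_leD:
  assumes "Lp_le p A f b"
  shows "A \<in> sets lebesgue" "f \<in> borel_measurable lebesgue" "0 \<le> b"
  using assms by (auto simp: Lp_le_def)

section \<open>Translations of Lebesgue measure\<close>

lemma lebesgue_measurable_shift: "(\<lambda>x::'a::euclidean_space. x + w) \<in> lebesgue \<rightarrow>\<^sub>M lebesgue"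
  using lebesgue_affine_measurable[of "\<lambda>_::'a. 1" w]
  by (simp add: euclidean_representation add.commute)

lemma borel_measurable_shift:
  fixes f :: "'a::euclidean_space \<Rightarrow> 'b::topological_space"
  assumes "f \<in> borel_measurable lebesgue"
  shows "(\<lambda>x. f (x + w)) \<in> borel_measurable lebesgue"
  by (rule measurable_compose[OF lebesgue_measurable_shift assms])

lemma borel_measurable_fin_diff:
  fixes f :: "'a::euclidean_space \<Rightarrow> real"
  assumes "f \<in> borel_measurable lebesgue"
  shows "fin_diff r \<xi> f \<in> borel_measurable lebesgue"
  unfolding fin_diff_def[abs_def]
  by (intro borel_measurable_sum borel_measurable_times borel_measurable_const borel_measurable_shift assms)

lemma lebesgue_distr_shift: "distr lebesgue lebesgue (\<lambda>x. x + w) = (lebesgue :: 'a::euclidean_space measure)"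
  using lebesgue_affine_euclidean[of "\<lambda>_::'a. 1" w]
  by (simp add: euclidean_representation add.commute density_1)

lemma nn_integral_lebesgue_shift:
  fixes F :: "'a::euclidean_space \<Rightarrow> ennreal"
  assumes "F \<in> borel_measurable lebesgue"
  shows "(\<integral>\<^sup>+x. F (x + w) \<partial>lebesgue) = (\<integral>\<^sup>+x. F x \<partial>lebesgue)"
proof -
  have "F \<in> borel_measurable (distr lebesgue lebesgue (\<lambda>x. x + w))"
    using assms by simp
  from nn_integral_distr[OF lebesgue_measurable_shift this]
  show ?thesis unfolding lebesgue_distr_shift ..
qed

lemma AE_lebesgue_shift:
  fixes w :: "'a::euclidean_space"
  assumes "AE x in lebesgue. P x"
  shows "AE x in lebesgue. P (x + w)"
proof -
  have "AE x in distr lebesgue lebesgue (\<lambda>x. x + w). P x"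
    unfolding lebesgue_distr_shift by (rule assms)
  then show ?thesis by (rule AE_distrD[OF lebesgue_measurable_shift])
qed

lemma lebesgue_sets_shift:
  fixes A :: "'a::euclidean_space set"
  assumes "A \<in> sets lebesgue"
  shows "{x. x + w \<in> A} \<in> sets lebesgue"
  using measurable_sets[OF lebesgue_measurable_shift assms, of w] by (simp add: vimage_def)

context
  fixes p :: ennreal
  assumes p_pos: "0 < p"
begin

lemma enn2real_p_pos: "p \<noteq> \<infinity> \<Longrightarrow> 0 < enn2real p"
  using p_pos by (simp add: enn2real_positive_iff less_top)

lemma Lp_le_mono:
  assumes "Lp_le p A f b" "g \<in> borel_measurable lebesgue" "A' \<in> sets lebesgue"
    "A' \<subseteq> A" "b \<le> b'" "\<And>x. x \<in> A' \<Longrightarrow> \<bar>g x\<bar> \<le> \<bar>f x\<bar>"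
  shows "Lp_le p A' g b'"
proof (cases "p = \<infinity>")
  case True
  have "AE x in lebesgue. x \<in> A \<longrightarrow> \<bar>f x\<bar> \<le> b"
    using assms(1) True by (simp add: Lp_le_def)
  then have "AE x in lebesgue. x \<in> A' \<longrightarrow> \<bar>g x\<bar> \<le> b'"
    by eventually_elim (use assms(4-6) in force)
  then show ?thesis using True assms(1-3,5) by (auto simp: Lp_le_def)
next
  case False
  have "(\<integral>\<^sup>+x. ennreal (\<bar>g x\<bar> powr enn2real p) * indicator A' x \<partial>lebesgue)
      \<le> (\<integral>\<^sup>+x. ennreal (\<bar>f x\<bar> powr enn2real p) * indicator A x \<partial>lebesgue)"
    using assms(4,6) enn2real_p_pos[OF False]
    by (intro nn_integral_mono) (auto simp: indicator_def intro!: ennreal_leI powr_mono2)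
  also have "\<dots> \<le> ennreal (b powr enn2real p)"
    using assms(1) False by (simp add: Lp_le_def)
  also have "\<dots> \<le> ennreal (b' powr enn2real p)"
    using assms(1,5) enn2real_p_pos[OF False] by (auto intro!: ennreal_leI powr_mono2 simp: Lp_le_def)
  finally show ?thesis using False assms(1-3,5) by (auto simp: Lp_le_def)
qed

lemma Lp_le_subset:
  assumes "Lp_le p A f b" "A' \<in> sets lebesgue" "A' \<subseteq> A"
  shows "Lp_le p A' f b"
  using Lp_le_mono[OF assms(1) Lp_leD(2)[OF assms(1)] assms(2,3) order_refl] by simp

lemma Lp_le_weaken: "Lp_le p A f b \<Longrightarrow> b \<le> b' \<Longrightarrow> Lp_le p A f b'"
  using Lp_le_mono[of A f b f A b'] Lp_leD[of p A f b] by simp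

text \<open>For finite p only |f + g| <= 2 max(|f|, |g|) is used, which serves every exponent q > 0.
  It costs the factor 2^q, and a^q + b^q <= 2 (a + b)^q costs another 2; the q-th root of their
  product is \<open>Lp_triangle p\<close>.\<close>

lemma Lp_le_add:
  assumes "Lp_le p A f a" "Lp_le p A g b"
  shows "Lp_le p A (\<lambda>x. f x + g x) (Lp_triangle p * (a + b))"
proof (cases "p = \<infinity>")
  case True
  have "AE x in lebesgue. x \<in> A \<longrightarrow> \<bar>f x\<bar> \<le> a" "AE x in lebesgue. x \<in> A \<longrightarrow> \<bar>g x\<bar> \<le> b"
    using assms True by (simp_all add: Lp_le_def)
  then have "AE x in lebesgue. x \<in> A \<longrightarrow> \<bar>f x + g x\<bar> \<le> 1 * (a + b)"
    by eventually_elim auto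
  moreover have "1 * (a + b) \<le> Lp_triangle p * (a + b)"
    using Lp_triangle_ge_1 Lp_leD(3)[OF assms(1)] Lp_leD(3)[OF assms(2)] by (intro mult_right_mono) auto
  ultimately have "AE x in lebesgue. x \<in> A \<longrightarrow> \<bar>f x + g x\<bar> \<le> Lp_triangle p * (a + b)"
    by (auto elim!: eventually_mono)
  then show ?thesis using True assms Lp_triangle_ge_1[of p] by (auto simp: Lp_le_def)
next
  case False
  define q where "q = enn2real p"
  have q: "0 < q" unfolding q_def by (rule enn2real_p_pos[OF False])
  have [measurable]: "f \<in> borel_measurable lebesgue" "g \<in> borel_measurable lebesgue" "A \<in> sets lebesgue"
    and ab: "0 \<le> a" "0 \<le> b"
    using assms by (auto dest: Lp_leD)
  have pw: "\<bar>f x + g x\<bar> powr q \<le> 2 powr q * (\<bar>f x\<bar> powr q + \<bar>g x\<bar> powr q)" for x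
  proof -
    have "\<bar>f x + g x\<bar> powr q \<le> (2 * max \<bar>f x\<bar> \<bar>g x\<bar>) powr q"
      using q by (intro powr_mono2) auto
    also have "\<dots> = 2 powr q * max \<bar>f x\<bar> \<bar>g x\<bar> powr q" by (simp add: powr_mult)
    also have "\<dots> \<le> 2 powr q * (\<bar>f x\<bar> powr q + \<bar>g x\<bar> powr q)"
      by (intro mult_left_mono) (auto simp: max_def)
    finally show ?thesis .
  qed
  have "(\<integral>\<^sup>+x. ennreal (\<bar>f x + g x\<bar> powr q) * indicator A x \<partial>lebesgue)
      \<le> (\<integral>\<^sup>+x. ennreal (2 powr q) * (ennreal (\<bar>f x\<bar> powr q) * indicator A x
            + ennreal (\<bar>g x\<bar> powr q) * indicator A x) \<partial>lebesgue)"
  proof (intro nn_integral_mono)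
    fix x
    have "ennreal (\<bar>f x + g x\<bar> powr q) \<le> ennreal (2 powr q) * (ennreal (\<bar>f x\<bar> powr q) + ennreal (\<bar>g x\<bar> powr q))"
      using pw[of x] by (metis ennreal_leI ennreal_mult' ennreal_plus powr_ge_zero)
    then show "ennreal (\<bar>f x + g x\<bar> powr q) * indicator A x
       \<le> ennreal (2 powr q) * (ennreal (\<bar>f x\<bar> powr q) * indicator A x + ennreal (\<bar>g x\<bar> powr q) * indicator A x)"
      by (auto simp: indicator_def)
  qed
  also have "\<dots> = ennreal (2 powr q) * ((\<integral>\<^sup>+x. ennreal (\<bar>f x\<bar> powr q) * indicator A x \<partial>lebesgue)
        + (\<integral>\<^sup>+x. ennreal (\<bar>g x\<bar> powr q) * indicator A x \<partial>lebesgue))"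
    by (subst nn_integral_cmult) (auto simp: nn_integral_add)
  also have "\<dots> \<le> ennreal (2 powr q) * (ennreal (a powr q) + ennreal (b powr q))"
    using assms False by (intro mult_left_mono add_mono) (auto simp: Lp_le_def q_def)
  also have "\<dots> = ennreal (2 powr q * (a powr q + b powr q))"
    by (simp add: ennreal_mult' ennreal_plus)
  also have "\<dots> \<le> ennreal ((Lp_triangle p * (a + b)) powr q)"
  proof (rule ennreal_leI)
    have "a powr q + b powr q \<le> 2 * (a + b) powr q"
      using ab q powr_mono2[of q a "a + b"] powr_mono2[of q b "a + b"] by auto
    then have "2 powr q * (a powr q + b powr q) \<le> 2 powr q * (2 * (a + b) powr q)"
      by (intro mult_left_mono) auto
    also have "\<dots> = (Lp_triangle p * (a + b)) powr q"
    proof -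
      have "(1 + 1 / q) * q = q + 1" using q by (simp add: field_simps)
      then have "Lp_triangle p powr q = 2 powr q * 2"
        unfolding Lp_triangle_def q_def[symmetric] powr_powr by (simp only: powr_add) simp
      then show ?thesis using ab Lp_triangle_ge_1[of p] by (simp add: powr_mult)
    qed
    finally show "2 powr q * (a powr q + b powr q) \<le> (Lp_triangle p * (a + b)) powr q" .
  qed
  finally show ?thesis using False ab Lp_triangle_ge_1[of p]
    by (auto simp: Lp_le_def q_def)
qed

lemma Lp_le_cmult:
  assumes "Lp_le p A f b"
  shows "Lp_le p A (\<lambda>x. c * f x) (\<bar>c\<bar> * b)"
proof (cases "p = \<infinity>")
  case True
  have "AE x in lebesgue. x \<in> A \<longrightarrow> \<bar>f x\<bar> \<le> b"
    using assms True by (simp add: Lp_le_def)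
  then have "AE x in lebesgue. x \<in> A \<longrightarrow> \<bar>c * f x\<bar> \<le> \<bar>c\<bar> * b"
    by eventually_elim (auto simp: abs_mult intro: mult_left_mono)
  then show ?thesis using True assms by (auto simp: Lp_le_def)
next
  case False
  have [measurable]: "f \<in> borel_measurable lebesgue" "A \<in> sets lebesgue" and b: "0 \<le> b"
    using assms by (auto dest: Lp_leD)
  define q where "q = enn2real p"
  have "(\<integral>\<^sup>+x. ennreal (\<bar>c * f x\<bar> powr q) * indicator A x \<partial>lebesgue)
     = (\<integral>\<^sup>+x. ennreal (\<bar>c\<bar> powr q) * (ennreal (\<bar>f x\<bar> powr q) * indicator A x) \<partial>lebesgue)"
    by (intro nn_integral_cong) (simp add: abs_mult powr_mult ennreal_mult' mult.assoc)
  also have "\<dots> = ennreal (\<bar>c\<bar> powr q) * (\<integral>\<^sup>+x. ennreal (\<bar>f x\<bar> powr q) * indicator A x \<partial>lebesgue)"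
    by (rule nn_integral_cmult) measurable
  also have "\<dots> \<le> ennreal (\<bar>c\<bar> powr q) * ennreal (b powr q)"
    using assms False by (intro mult_left_mono) (auto simp: Lp_le_def q_def)
  also have "\<dots> = ennreal ((\<bar>c\<bar> * b) powr q)"
    using b by (simp add: powr_mult ennreal_mult')
  finally show ?thesis using False b by (auto simp: Lp_le_def q_def)
qed

lemma Lp_le_diff:
  assumes "Lp_le p A f a" "Lp_le p A g b"
  shows "Lp_le p A (\<lambda>x. f x - g x) (Lp_triangle p * (a + b))"
  using Lp_le_add[OF assms(1) Lp_le_cmult[OF assms(2), of "-1"]] by simp

lemma Lp_le_zero:
  assumes "A \<in> sets lebesgue"
  shows "Lp_le p A (\<lambda>x. 0) 0"
  using assms enn2real_p_pos by (auto simp: Lp_le_def)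

lemma Lp_le_sum:
  assumes "finite I" "A \<in> sets lebesgue" "\<And>i. i \<in> I \<Longrightarrow> Lp_le p A (f i) b"
  shows "Lp_le p A (\<lambda>x. \<Sum>i\<in>I. f i x) (Lp_sum_const p (card I) * b)"
  using assms(1,3)
proof (induction I)
  case empty
  then show ?case using Lp_le_zero[OF assms(2)] by simp
next
  case (insert i I)
  have "Lp_le p A (\<lambda>x. (\<Sum>i\<in>I. f i x) + f i x) (Lp_triangle p * (Lp_sum_const p (card I) * b + b))"
    by (intro Lp_le_add insert) (auto intro: insert)
  then show ?case using insert by (simp add: algebra_simps)
qed

text \<open>The quasi-triangle inequality for f times the indicators of \<open>A\<close> and
  \<open>B\<close>; on the overlap the sum is 2 f, which still dominates f.\<close>

lemma Lp_le_Un: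
  assumes "Lp_le p A f a" "Lp_le p B f b"
  shows "Lp_le p (A \<union> B) f (Lp_triangle p * (a + b))"
proof -
  have [measurable]: "f \<in> borel_measurable lebesgue" "A \<in> sets lebesgue" "B \<in> sets lebesgue"
    using assms by (auto dest: Lp_leD)
  have restr: "Lp_le p (A \<union> B) (\<lambda>x. f x * indicator C x) c" if "Lp_le p C f c" "C = A \<or> C = B" for C c
  proof (cases "p = \<infinity>")
    case True
    have "AE x in lebesgue. x \<in> C \<longrightarrow> \<bar>f x\<bar> \<le> c"
      using that True by (simp add: Lp_le_def)
    then have "AE x in lebesgue. x \<in> A \<union> B \<longrightarrow> \<bar>f x * indicator C x\<bar> \<le> c"
      by eventually_elim (use Lp_leD(3)[OF that(1)] in \<open>auto simp: indicator_def\<close>)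
    then show ?thesis using True that by (auto simp: Lp_le_def)
  next
    case False
    have "(\<integral>\<^sup>+x. ennreal (\<bar>f x * indicator C x\<bar> powr enn2real p) * indicator (A \<union> B) x \<partial>lebesgue)
       = (\<integral>\<^sup>+x. ennreal (\<bar>f x\<bar> powr enn2real p) * indicator C x \<partial>lebesgue)"
      using that(2) enn2real_p_pos[OF False] by (intro nn_integral_cong) (auto simp: indicator_def)
    then show ?thesis using False that by (auto simp: Lp_le_def)
  qed
  have "Lp_le p (A \<union> B) (\<lambda>x. f x * indicator A x + f x * indicator B x) (Lp_triangle p * (a + b))"
    by (intro Lp_le_add restr assms) auto
  then show ?thesis
    by (rule Lp_le_mono) (auto simp: indicator_def)
qed

lemma Lp_le_shift:
  assumes "Lp_le p B f b" "A \<in> sets lebesgue" "\<And>x. x \<in> A \<Longrightarrow> x + w \<in> B"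
  shows "Lp_le p A (\<lambda>x. f (x + w)) b"
proof -
  have [measurable]: "f \<in> borel_measurable lebesgue" "B \<in> sets lebesgue"
    using assms by (auto dest: Lp_leD)
  have "Lp_le p {x. x + w \<in> B} (\<lambda>x. f (x + w)) b"
  proof (cases "p = \<infinity>")
    case True
    have "AE x in lebesgue. x \<in> B \<longrightarrow> \<bar>f x\<bar> \<le> b"
      using assms(1) True by (simp add: Lp_le_def)
    from AE_lebesgue_shift[OF this, of w] show ?thesis
      using True assms(1) by (auto simp: Lp_le_def borel_measurable_shift lebesgue_sets_shift)
  next
    case False
    have "(\<integral>\<^sup>+x. ennreal (\<bar>f (x + w)\<bar> powr enn2real p) * indicator {x. x + w \<in> B} x \<partial>lebesgue)
       = (\<integral>\<^sup>+x. ennreal (\<bar>f (x + w)\<bar> powr enn2real p) * indicator B (x + w) \<partial>lebesgue)"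
      by (intro nn_integral_cong) (auto simp: indicator_def)
    also have "\<dots> = (\<integral>\<^sup>+x. ennreal (\<bar>f x\<bar> powr enn2real p) * indicator B x \<partial>lebesgue)"
      by (rule nn_integral_lebesgue_shift[where F="\<lambda>x. ennreal (\<bar>f x\<bar> powr enn2real p) * indicator B x"]) measurable
    finally show ?thesis
      using False assms(1) by (auto simp: Lp_le_def borel_measurable_shift lebesgue_sets_shift)
  qed
  then show ?thesis
    by (rule Lp_le_subset) (use assms in auto)
qed

lemma Lp_le_AE_cong:
  assumes "Lp_le p A f b" "g \<in> borel_measurable lebesgue" "AE x in lebesgue. f x = g x"
  shows "Lp_le p A g b"
proof (cases "p = \<infinity>")
  case True
  have "AE x in lebesgue. x \<in> A \<longrightarrow> \<bar>f x\<bar> \<le> b"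
    using assms(1) True by (simp add: Lp_le_def)
  with assms(3) have "AE x in lebesgue. x \<in> A \<longrightarrow> \<bar>g x\<bar> \<le> b"
    by eventually_elim auto
  then show ?thesis using True assms by (auto simp: Lp_le_def)
next
  case False
  have "(\<integral>\<^sup>+x. ennreal (\<bar>g x\<bar> powr enn2real p) * indicator A x \<partial>lebesgue)
      = (\<integral>\<^sup>+x. ennreal (\<bar>f x\<bar> powr enn2real p) * indicator A x \<partial>lebesgue)"
    using assms(3) by (intro nn_integral_cong_AE) (auto elim!: eventually_mono)
  then show ?thesis using False assms by (auto simp: Lp_le_def)
qed

lemma Lp_vol_nonneg: "0 \<le> Lp_vol p A"
  by (simp add: Lp_vol_def)

lemma Lp_vol_pos: "0 < measure lebesgue A \<Longrightarrow> 0 < Lp_vol p A"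
  by (simp add: Lp_vol_def)

lemma Lp_le_constI:
  assumes "A \<in> lmeasurable" "\<bar>M\<bar> * Lp_vol p A \<le> b"
  shows "Lp_le p A (\<lambda>_. M) b"
proof (cases "p = \<infinity>")
  case True
  then show ?thesis using assms by (auto simp: Lp_le_def Lp_vol_def fmeasurableD)
next
  case False
  have q: "0 < enn2real p" by (rule enn2real_p_pos[OF False])
  have [measurable]: "A \<in> sets lebesgue" using assms(1) by (rule fmeasurableD)
  have "(\<integral>\<^sup>+x. ennreal (\<bar>M\<bar> powr enn2real p) * indicator A x \<partial>lebesgue)
     = ennreal (\<bar>M\<bar> powr enn2real p) * emeasure lebesgue A"
    by (simp add: nn_integral_cmult)
  also have "\<dots> = ennreal (\<bar>M\<bar> powr enn2real p * measure lebesgue A)"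
    using assms(1) by (simp add: emeasure_eq_measure2 ennreal_mult')
  also have "\<bar>M\<bar> powr enn2real p * measure lebesgue A = (\<bar>M\<bar> * Lp_vol p A) powr enn2real p"
    using False q by (simp add: Lp_vol_def powr_mult powr_powr)
  also have "ennreal \<dots> \<le> ennreal (b powr enn2real p)"
    using assms(2) q Lp_vol_nonneg[of A] by (intro ennreal_leI powr_mono2) auto
  finally show ?thesis using False assms Lp_vol_nonneg[of A]
    by (auto simp: Lp_le_def intro: order_trans[OF mult_nonneg_nonneg[OF abs_ge_zero]])
qed

lemma Lp_le_constD:
  assumes "A \<in> lmeasurable" "0 < measure lebesgue A" "Lp_le p A (\<lambda>_. M) b"
  shows "\<bar>M\<bar> * Lp_vol p A \<le> b"
proof (cases "p = \<infinity>")
  case True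
  show ?thesis
  proof (rule ccontr)
    assume *: "\<not> ?thesis"
    have "AE x in lebesgue. x \<in> A \<longrightarrow> \<bar>M\<bar> \<le> b"
      using assms(3) True by (simp add: Lp_le_def)
    then have "AE x in lebesgue. x \<notin> A"
      by eventually_elim (use * True in \<open>auto simp: Lp_vol_def\<close>)
    then have "A \<in> null_sets lebesgue"
      using assms(1) by (subst AE_iff_null_sets) (auto intro: fmeasurableD)
    then show False using assms(2) by (auto simp: null_sets_def measure_def)
  qed
next
  case False
  have q: "0 < enn2real p" by (rule enn2real_p_pos[OF False])
  have [measurable]: "A \<in> sets lebesgue" using assms(1) by (rule fmeasurableD)
  have "ennreal ((\<bar>M\<bar> * Lp_vol p A) powr enn2real p) = ennreal (\<bar>M\<bar> powr enn2real p * measure lebesgue A)"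
    using False q by (simp add: Lp_vol_def powr_mult powr_powr)
  also have "\<dots> = ennreal (\<bar>M\<bar> powr enn2real p) * emeasure lebesgue A"
    using assms(1) by (simp add: emeasure_eq_measure2 ennreal_mult')
  also have "\<dots> = (\<integral>\<^sup>+x. ennreal (\<bar>M\<bar> powr enn2real p) * indicator A x \<partial>lebesgue)"
    by (simp add: nn_integral_cmult)
  also have "\<dots> \<le> ennreal (b powr enn2real p)"
    using assms(3) False by (simp add: Lp_le_def)
  finally have "(\<bar>M\<bar> * Lp_vol p A) powr enn2real p \<le> b powr enn2real p"
    by (simp add: ennreal_le_iff)
  then show ?thesis
    using q Lp_leD(3)[OF assms(3)] Lp_vol_nonneg[of A] powr_less_mono2[of "enn2real p" b "\<bar>M\<bar> * Lp_vol p A"]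
    by (meson linorder_not_less)
qed

lemma Lp_le_bounded:
  assumes "A \<in> lmeasurable" "f \<in> borel_measurable lebesgue" "\<And>x. x \<in> A \<Longrightarrow> \<bar>f x\<bar> \<le> M"
  shows "Lp_le p A f (\<bar>M\<bar> * Lp_vol p A)"
  by (rule Lp_le_mono[OF Lp_le_constI[OF assms(1) order_refl, of M] assms(2)])
    (use assms in \<open>auto intro: fmeasurableD order_trans[OF _ abs_ge_self]\<close>)

section \<open>Comparison with \<open>Lp_norm\<close>\<close>

lemma Lp_norm_leI:
  assumes "Lp_le p A f b"
  shows "Lp_norm p A f \<le> ennreal b"
proof (cases "p = \<infinity>")
  case True
  have [measurable]: "A \<in> sets lebesgue" "f \<in> borel_measurable lebesgue" using assms by (auto dest: Lp_leD)
  have "AE x in lebesgue_on A. \<bar>f x\<bar> \<le> b"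
    using assms True by (simp add: Lp_le_def AE_restrict_space_iff)
  then have "AE x in lebesgue_on A. ennreal \<bar>f x\<bar> \<le> ennreal b"
    by eventually_elim (rule ennreal_leI)
  moreover have "(\<lambda>x. ennreal \<bar>f x\<bar>) \<in> borel_measurable (lebesgue_on A)"
    by (rule measurable_restrict_space1) measurable
  ultimately have "esssup (lebesgue_on A) (\<lambda>x. ennreal \<bar>f x\<bar>) \<le> ennreal b"
    by (rule esssup_I[rotated])
  then show ?thesis using True by (simp add: Lp_norm_def)
next
  case False
  have q: "0 < enn2real p" by (rule enn2real_p_pos[OF False])
  have A: "A \<in> sets lebesgue" and b: "0 \<le> b" using assms by (auto dest: Lp_leD)
  define I where "I = (\<integral>\<^sup>+ x. ennreal (\<bar>f x\<bar> powr enn2real p) \<partial>lebesgue_on A)"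
  have I: "I \<le> ennreal (b powr enn2real p)"
    using assms False A by (simp add: Lp_le_def I_def nn_integral_restrict_space)
  then have "I \<noteq> \<infinity>" by (auto simp: top_unique)
  have "enn2real I \<le> b powr enn2real p" using I by (simp add: enn2real_leI)
  then have "enn2real I powr (1 / enn2real p) \<le> (b powr enn2real p) powr (1 / enn2real p)"
    using q by (intro powr_mono2) auto
  also have "\<dots> = b" using q b by (simp add: powr_powr)
  finally show ?thesis
    using False \<open>I \<noteq> \<infinity>\<close> by (simp add: Lp_norm_def I_def[symmetric] Let_def ennreal_leI)
qed

lemma Lp_norm_leD:
  assumes "Lp_norm p A f \<le> ennreal b" "0 \<le> b" "A \<in> sets lebesgue" "f \<in> borel_measurable lebesgue"
  shows "Lp_le p A f b"
proof (cases "p = \<infinity>")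
  case True
  have "AE x in lebesgue_on A. ennreal \<bar>f x\<bar> \<le> Lp_norm p A f"
    using True by (simp add: Lp_norm_def esssup_AE)
  then have "AE x in lebesgue_on A. ennreal \<bar>f x\<bar> \<le> ennreal b"
    by eventually_elim (rule order_trans[OF _ assms(1)])
  then have "AE x in lebesgue_on A. \<bar>f x\<bar> \<le> b"
    using assms(2) by (simp add: ennreal_le_iff)
  then show ?thesis using True assms by (simp add: Lp_le_def AE_restrict_space_iff)
next
  case False
  have q: "0 < enn2real p" by (rule enn2real_p_pos[OF False])
  define I where "I = (\<integral>\<^sup>+ x. ennreal (\<bar>f x\<bar> powr enn2real p) \<partial>lebesgue_on A)"
  have N: "Lp_norm p A f = (if I = \<infinity> then \<infinity> else ennreal (enn2real I powr (1 / enn2real p)))"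
    using False by (simp add: Lp_norm_def I_def Let_def)
  have I: "I \<noteq> \<infinity>"
    using assms(1) N by (auto simp: top_unique)
  then have "enn2real I powr (1 / enn2real p) \<le> b"
    using assms(1,2) N by (simp add: ennreal_le_iff)
  then have "(enn2real I powr (1 / enn2real p)) powr enn2real p \<le> b powr enn2real p"
    using q by (intro powr_mono2) auto
  then have "enn2real I \<le> b powr enn2real p" using q by (simp add: powr_powr)
  then have "I \<le> ennreal (b powr enn2real p)"
    using I by (metis ennreal_enn2real ennreal_leI infinity_ennreal_def less_top)
  then show ?thesis
    using False assms by (simp add: Lp_le_def I_def nn_integral_restrict_space)
qed

end

section \<open>Constant approximation by averaging over shifts\<close>

lemma nn_integral_pairs_le_shifts:
  fixes g :: "'a::euclidean_space \<Rightarrow> real" and \<theta> :: "real \<Rightarrow> ennreal"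
  assumes [measurable]: "g \<in> borel_measurable borel" "\<theta> \<in> borel_measurable borel" "A \<in> sets borel" "W \<in> sets borel"
    and W: "\<And>x y. x \<in> A \<Longrightarrow> y \<in> A \<Longrightarrow> y - x \<in> W"
  shows "(\<integral>\<^sup>+y. (\<integral>\<^sup>+x. \<theta> (g x - g y) * indicator A x \<partial>lborel) * indicator A y \<partial>lborel)
    \<le> (\<integral>\<^sup>+w. (\<integral>\<^sup>+x. \<theta> (g x - g (x + w)) * indicator A x \<partial>lborel) * indicator W w \<partial>lborel)"
proof -
  have "(\<integral>\<^sup>+y. (\<integral>\<^sup>+x. \<theta> (g x - g y) * indicator A x \<partial>lborel) * indicator A y \<partial>lborel)
     = (\<integral>\<^sup>+y. (\<integral>\<^sup>+x. \<theta> (g x - g y) * indicator A x * indicator A y \<partial>lborel) \<partial>lborel)"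
    by (intro nn_integral_cong) (simp add: nn_integral_multc)
  also have "\<dots> = (\<integral>\<^sup>+x. (\<integral>\<^sup>+y. \<theta> (g x - g y) * indicator A x * indicator A y \<partial>lborel) \<partial>lborel)"
    by (rule lborel_pair.Fubini') measurable
  \<comment> \<open>Substitute y = x + w for fixed x. Then w is a difference of two points of
    \<open>A\<close>, hence in \<open>W\<close> whatever x is, and the integrals can be exchanged
    again. Keeping \<theta> general covers powers for finite p and the indicator of large values for
    p = infinity.\<close>
  also have "\<dots> = (\<integral>\<^sup>+x. (\<integral>\<^sup>+w. \<theta> (g x - g (x + w)) * indicator A x * indicator A (x + w) \<partial>lborel) \<partial>lborel)"
  proof (rule nn_integral_cong)
    fix x :: 'a
    \<comment> \<open>The shift lemma speaks of \<open>lebesgue\<close> and Fubini of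
      \<open>lborel\<close>; on Borel functions the two integrals agree.\<close>
    have "(\<lambda>y. \<theta> (g x - g y) * indicator A x * indicator A y) \<in> borel_measurable lborel"
      by measurable
    then have "(\<lambda>y. \<theta> (g x - g y) * indicator A x * indicator A y) \<in> borel_measurable lebesgue"
      by (rule measurable_completion)
    from nn_integral_lebesgue_shift[OF this, of x]
    show "(\<integral>\<^sup>+y. \<theta> (g x - g y) * indicator A x * indicator A y \<partial>lborel)
      = (\<integral>\<^sup>+w. \<theta> (g x - g (x + w)) * indicator A x * indicator A (x + w) \<partial>lborel)"
      by (simp add: nn_integral_completion add.commute)
  qed
  also have "\<dots> \<le> (\<integral>\<^sup>+x. (\<integral>\<^sup>+w. \<theta> (g x - g (x + w)) * indicator A x * indicator W w \<partial>lborel) \<partial>lborel)"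
  proof (intro nn_integral_mono)
    fix x w
    have "indicator A x * indicator A (x + w) \<le> (indicator A x * indicator W w :: ennreal)"
      using W[of x "x + w"] by (auto simp: indicator_def)
    then show "\<theta> (g x - g (x + w)) * indicator A x * indicator A (x + w)
       \<le> \<theta> (g x - g (x + w)) * indicator A x * indicator W w"
      by (simp add: mult.assoc mult_left_mono)
  qed
  also have "\<dots> = (\<integral>\<^sup>+w. (\<integral>\<^sup>+x. \<theta> (g x - g (x + w)) * indicator A x * indicator W w \<partial>lborel) \<partial>lborel)"
    by (rule lborel_pair.Fubini'[symmetric]) measurable
  also have "\<dots> = (\<integral>\<^sup>+w. (\<integral>\<^sup>+x. \<theta> (g x - g (x + w)) * indicator A x \<partial>lborel) * indicator W w \<partial>lborel)"
    by (intro nn_integral_cong) (simp add: nn_integral_multc)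
  finally show ?thesis .
qed

text \<open>If F exceeded c everywhere on \<open>A\<close>, then F = c + (F - c) there, and
  cancelling the finite quantity c times the measure of \<open>A\<close> would force F - c to vanish
  almost everywhere on a set of positive measure.\<close>

lemma exists_le_average:
  fixes F :: "'a::euclidean_space \<Rightarrow> ennreal"
  assumes [measurable]: "F \<in> borel_measurable borel" "A \<in> sets borel"
    and A: "0 < emeasure lborel A" and c: "c \<noteq> \<infinity>" "emeasure lborel A \<noteq> \<infinity>"
    and le: "(\<integral>\<^sup>+y. F y * indicator A y \<partial>lborel) \<le> c * emeasure lborel A"
  obtains y where "y \<in> A" "F y \<le> c"
proof -
  have "\<exists>y\<in>A. F y \<le> c"
  proof (rule ccontr)
    assume *: "\<not> ?thesis"
    have "(\<integral>\<^sup>+y. c * indicator A y \<partial>lborel) = c * emeasure lborel A"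
      by (simp add: nn_integral_cmult)
    moreover have "(\<integral>\<^sup>+y. F y * indicator A y \<partial>lborel) = (\<integral>\<^sup>+y. c * indicator A y \<partial>lborel) +
         (\<integral>\<^sup>+y. (F y - c) * indicator A y \<partial>lborel)"
    proof (subst nn_integral_add[symmetric])
      show "(\<integral>\<^sup>+y. F y * indicator A y \<partial>lborel) =
          (\<integral>\<^sup>+y. c * indicator A y + (F y - c) * indicator A y \<partial>lborel)"
        using * by (intro nn_integral_cong) (auto simp: indicator_def add_diff_inverse_ennreal)
    qed measurable
    ultimately have "c * emeasure lborel A + (\<integral>\<^sup>+y. (F y - c) * indicator A y \<partial>lborel)
        \<le> c * emeasure lborel A + 0"
      using le by simp
    moreover have "c * emeasure lborel A \<noteq> \<infinity>"
      using c by (simp add: ennreal_mult_eq_top_iff)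
    ultimately have "(\<integral>\<^sup>+y. (F y - c) * indicator A y \<partial>lborel) = 0"
      by (simp only: ennreal_add_left_cancel_le le_zero_eq) simp
    then have "AE y in lborel. (F y - c) * indicator A y = 0"
      by (subst (asm) nn_integral_0_iff_AE) measurable
    then have "AE y in lborel. y \<notin> A"
      by eventually_elim (use * in \<open>auto simp: indicator_def diff_eq_0_iff_ennreal split: if_splits\<close>)
    then have "A \<in> null_sets lborel" by (subst AE_iff_null_sets) auto
    then show False using A by auto
  qed
  then show ?thesis using that by blast
qed

text \<open>Some value of \<open>f\<close> on \<open>A\<close> is a good constant approximation, because the mean over \<open>y \<in> A\<close> of
  the distance between \<open>f\<close> and the constant \<open>f y\<close> is a mean over shifts by Fubini.\<close>

lemma Lp_le_minus_const_if_shifts: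
  fixes f :: "'a::euclidean_space \<Rightarrow> real"
  assumes p: "0 < p" and f: "f \<in> borel_measurable lebesgue"
    and AW[measurable]: "A \<in> sets borel" "W \<in> sets borel"
    and A: "emeasure lborel A \<noteq> \<infinity>" "0 < emeasure lborel A"
    and m: "emeasure lborel W \<le> ennreal m * emeasure lborel A" "0 < m"
    and W: "\<And>x y. x \<in> A \<Longrightarrow> y \<in> A \<Longrightarrow> y - x \<in> W"
    and shift: "\<And>w. w \<in> W \<Longrightarrow> Lp_le p A (\<lambda>x. f (x + w) - f x) b"
  obtains c where "Lp_le p A (\<lambda>x. f x - c) (m powr (1 / enn2real p) * b)"
proof -
  \<comment> \<open>Fubini needs Borel functions, so f is replaced by a Borel version g. Differences
    with a fixed shift w still agree almost everywhere, since a translate of the exceptional null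
    set is null.\<close>
  obtain g where g[measurable]: "g \<in> borel_measurable borel" and fg: "AE x in lborel. f x = g x"
    using completion_ex_borel_measurable_real[OF f] by auto
  have fg': "AE x in lebesgue. f x = g x" using fg by (rule AE_completion)
  have Ane: "A \<noteq> {}" using A by auto
  then have "0 \<in> W" using W by (metis cancel_comm_monoid_add_class.diff_cancel ex_in_conv)
  then have b: "0 \<le> b" using shift Lp_leD(3) by blast
  have gleb: "g \<in> borel_measurable lebesgue" using g by (simp add: measurable_completion)
  have Aleb: "A \<in> sets lebesgue" using AW(1) by simp
  have gshift: "Lp_le p A (\<lambda>x. g x - g (x + w)) b" if "w \<in> W" for w
  proof -
    have "Lp_le p A (\<lambda>x. f x - f (x + w)) b"
      using Lp_le_cmult[OF p shift[OF that], of "-1"] by simp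
    moreover have "(\<lambda>x. g x - g (x + w)) \<in> borel_measurable lebesgue"
      using gleb borel_measurable_shift[OF gleb, of w] by (rule borel_measurable_diff)
    moreover have "AE x in lebesgue. f x - f (x + w) = g x - g (x + w)"
      using fg' AE_lebesgue_shift[OF fg', of w] by eventually_elim simp
    ultimately show ?thesis by (rule Lp_le_AE_cong[OF p])
  qed
  obtain y where y: "y \<in> A" "Lp_le p A (\<lambda>x. g x - g y) (m powr (1 / enn2real p) * b)"
  proof (cases "p = \<infinity>")
    case True
    \<comment> \<open>With this \<theta> the inner integral is the measure of the points of
      \<open>A\<close> at which the difference exceeds b. It is zero for each shift, so the mean
      over y is zero too, and for some y the exceptional set is null.\<close>
    define \<theta> :: "real \<Rightarrow> ennreal" where "\<theta> = indicator {t. b < \<bar>t\<bar>}"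
    have [measurable]: "\<theta> \<in> borel_measurable borel" unfolding \<theta>_def by measurable
    have "(\<integral>\<^sup>+x. \<theta> (g x - g (x + w)) * indicator A x \<partial>lborel) = 0" if "w \<in> W" for w
    proof -
      have "AE x in lborel. x \<in> A \<longrightarrow> \<bar>g x - g (x + w)\<bar> \<le> b"
        using gshift[OF that] True by (simp add: Lp_le_def AE_completion_iff)
      then have "AE x in lborel. \<theta> (g x - g (x + w)) * indicator A x = 0"
        by eventually_elim (auto simp: \<theta>_def indicator_def)
      then show ?thesis by (subst nn_integral_0_iff_AE) measurable
    qed
    then have "(\<integral>\<^sup>+w. (\<integral>\<^sup>+x. \<theta> (g x - g (x + w)) * indicator A x \<partial>lborel) * indicator W w \<partial>lborel)
       = (\<integral>\<^sup>+w. 0 \<partial>(lborel :: 'a measure))"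
      by (intro nn_integral_cong) (auto simp: indicator_def)
    then have "(\<integral>\<^sup>+y. (\<integral>\<^sup>+x. \<theta> (g x - g y) * indicator A x \<partial>lborel) * indicator A y \<partial>lborel)
       \<le> 0 * emeasure lborel A"
      using nn_integral_pairs_le_shifts[of g \<theta> A W, OF _ _ _ _ W] by simp
    moreover have "(\<lambda>y. \<integral>\<^sup>+x. \<theta> (g x - g y) * indicator A x \<partial>lborel) \<in> borel_measurable borel"
      by measurable
    ultimately obtain y where y: "y \<in> A" "(\<integral>\<^sup>+x. \<theta> (g x - g y) * indicator A x \<partial>lborel) \<le> 0"
      using exists_le_average[of "\<lambda>y. \<integral>\<^sup>+x. \<theta> (g x - g y) * indicator A x \<partial>lborel" A 0] A by auto
    then have "AE x in lborel. \<theta> (g x - g y) * indicator A x = 0"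
      by (subst nn_integral_0_iff_AE[symmetric]) auto
    then have "AE x in lborel. x \<in> A \<longrightarrow> \<bar>g x - g y\<bar> \<le> b"
      by eventually_elim (auto simp: \<theta>_def indicator_def split: if_splits)
    then have "AE x in lebesgue. x \<in> A \<longrightarrow> \<bar>g x - g y\<bar> \<le> b" by (rule AE_completion)
    then have "Lp_le p A (\<lambda>x. g x - g y) (m powr (1 / enn2real p) * b)"
      using True b Aleb gleb m(2) by (simp add: Lp_le_def)
    with y(1) show ?thesis by (rule that)
  next
    case False
    define q where "q = enn2real p"
    have q: "0 < q" unfolding q_def by (rule enn2real_p_pos[OF p False])
    define \<theta> :: "real \<Rightarrow> ennreal" where "\<theta> = (\<lambda>t. ennreal (\<bar>t\<bar> powr q))"
    have \<theta>[measurable]: "\<theta> \<in> borel_measurable borel" unfolding \<theta>_def by measurable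
    have *: "(\<integral>\<^sup>+x. \<theta> (g x - g (x + w)) * indicator A x \<partial>lborel) \<le> ennreal (b powr q)" if "w \<in> W" for w
      using gshift[OF that] False by (simp add: Lp_le_def \<theta>_def q_def nn_integral_completion)
    have "(\<integral>\<^sup>+w. (\<integral>\<^sup>+x. \<theta> (g x - g (x + w)) * indicator A x \<partial>lborel) * indicator W w \<partial>lborel)
       \<le> (\<integral>\<^sup>+w. ennreal (b powr q) * indicator W w \<partial>lborel)"
      using * by (intro nn_integral_mono) (auto simp: indicator_def)
    also have "\<dots> = ennreal (b powr q) * emeasure lborel W"
      by (simp add: nn_integral_cmult)
    \<comment> \<open>m bounds the ratio of the measures of \<open>W\<close> and \<open>A\<close>;
      it turns the integral over shifts into a mean over \<open>A\<close>, and its p-th root is the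
      loss in the conclusion.\<close>
    also have "\<dots> \<le> ennreal (b powr q) * (ennreal m * emeasure lborel A)"
      by (intro mult_left_mono m) auto
    also have "\<dots> = ennreal (m * b powr q) * emeasure lborel A"
      using m(2) by (simp add: ennreal_mult' mult_ac)
    finally have ub: "(\<integral>\<^sup>+w. (\<integral>\<^sup>+x. \<theta> (g x - g (x + w)) * indicator A x \<partial>lborel) * indicator W w \<partial>lborel)
       \<le> ennreal (m * b powr q) * emeasure lborel A" .
    have le: "(\<integral>\<^sup>+y. (\<integral>\<^sup>+x. \<theta> (g x - g y) * indicator A x \<partial>lborel) * indicator A y \<partial>lborel)
       \<le> ennreal (m * b powr q) * emeasure lborel A"
      by (rule order_trans[OF nn_integral_pairs_le_shifts[OF g \<theta> AW W] ub])
    have meas: "(\<lambda>y. \<integral>\<^sup>+x. \<theta> (g x - g y) * indicator A x \<partial>lborel) \<in> borel_measurable borel"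
      by measurable
    have nt: "ennreal (m * b powr q) \<noteq> \<infinity>" by simp
    obtain y where y: "y \<in> A" "(\<integral>\<^sup>+x. \<theta> (g x - g y) * indicator A x \<partial>lborel) \<le> ennreal (m * b powr q)"
      by (rule exists_le_average[OF meas AW(1) A(2) nt A(1) le])
    moreover have "m * b powr q = (m powr (1 / q) * b) powr q"
      using m(2) b q by (simp add: powr_mult powr_powr)
    ultimately have "Lp_le p A (\<lambda>x. g x - g y) (m powr (1 / enn2real p) * b)"
      using False b Aleb gleb by (simp add: Lp_le_def \<theta>_def q_def nn_integral_completion)
    with y(1) show ?thesis by (rule that)
  qed
  have "AE x in lebesgue. g x - g y = f x - g y"
    using fg' by eventually_elim simp
  then have "Lp_le p A (\<lambda>x. f x - g y) (m powr (1 / enn2real p) * b)"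
    by (rule Lp_le_AE_cong[OF p y(2), rotated]) (use f in measurable)
  then show ?thesis by (rule that)
qed

section \<open>Finite differences and Newton interpolation\<close>

lemma fin_diff_0: "fin_diff 0 \<xi> f x = f x"
  by (simp add: fin_diff_def)

lemma fin_diff_1: "fin_diff (Suc 0) \<xi> f x = f (x + \<xi>) - f x"
  by (simp add: fin_diff_def)

lemma fin_diff_Suc: "fin_diff (Suc k) \<xi> f x = fin_diff k \<xi> f (x + \<xi>) - fin_diff k \<xi> f x"
proof -
  have shift: "x + \<xi> + real j *\<^sub>R \<xi> = x + real (Suc j) *\<^sub>R \<xi>" for j
    by (simp add: algebra_simps)
  define a where "a j = (-1) ^ (k + j) * f (x + real j *\<^sub>R \<xi>)" for j
  have "fin_diff (Suc k) \<xi> f x = (\<Sum>j\<le>Suc k. - (real (Suc k choose j) * a j))"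
    unfolding fin_diff_def a_def by (intro sum.cong) (auto simp: algebra_simps)
  also have "\<dots> = - a 0 - (\<Sum>j\<le>k. real (Suc k choose Suc j) * a (Suc j))"
    by (subst sum.atMost_Suc_shift) (simp add: sum_negf)
  also have "\<dots> = - (a 0 + (\<Sum>j\<le>k. real (k choose Suc j) * a (Suc j))) - (\<Sum>j\<le>k. real (k choose j) * a (Suc j))"
    by (simp add: sum.distrib algebra_simps)
  also have "a 0 + (\<Sum>j\<le>k. real (k choose Suc j) * a (Suc j)) = (\<Sum>j\<le>Suc k. real (k choose j) * a j)"
    by (subst sum.atMost_Suc_shift) simp
  also have "\<dots> = fin_diff k \<xi> f x"
    unfolding fin_diff_def a_def by (simp add: algebra_simps)
  finally have 1: "fin_diff (Suc k) \<xi> f x = - fin_diff k \<xi> f x - (\<Sum>j\<le>k. real (k choose j) * a (Suc j))" .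
  have "fin_diff k \<xi> f (x + \<xi>) = (\<Sum>j\<le>k. - (real (k choose j) * a (Suc j)))"
    unfolding fin_diff_def a_def shift by (intro sum.cong) auto
  with 1 show ?thesis by (simp add: sum_negf)
qed

lemma fin_diff_add_shift: "fin_diff k \<xi> (\<lambda>y. f (y + w)) x = fin_diff k \<xi> f (x + w)"
  by (simp add: fin_diff_def algebra_simps)

lemma fin_diff_diff: "fin_diff k \<xi> (\<lambda>y. f y - g y) x = fin_diff k \<xi> f x - fin_diff k \<xi> g x"
  by (simp add: fin_diff_def algebra_simps sum_subtractf)

text \<open>Both differences have the same r + 1 nodes in opposite order. This turns bounds for
  positive steps, the only ones in the modulus, into bounds for negative steps.\<close>

lemma fin_diff_uminus_direction:
  "fin_diff r (- \<xi>) f x = (-1) ^ r * fin_diff r \<xi> f (x - real r *\<^sub>R \<xi>)"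
proof -
  have "fin_diff r (- \<xi>) f x = (\<Sum>j\<le>r. (-1) ^ (r + (r - j)) * real (r choose (r - j)) * f (x - real (r - j) *\<^sub>R \<xi>))"
    unfolding fin_diff_def
    by (rule sum.reindex_bij_witness[of _ "\<lambda>j. r - j" "\<lambda>j. r - j"]) auto
  also have "\<dots> = (\<Sum>j\<le>r. (-1) ^ r * ((-1) ^ (r + j) * real (r choose j) * f (x - real r *\<^sub>R \<xi> + real j *\<^sub>R \<xi>)))"
  proof (intro sum.cong refl)
    fix j assume "j \<in> {..r}"
    then have j: "j \<le> r" by simp
    have s: "(-1::real) ^ (r + (r - j)) = (-1) ^ r * (-1) ^ (r + j)"
      using j by (simp add: power_add[symmetric] uminus_power_if)
    have v: "x - real (r - j) *\<^sub>R \<xi> = x - real r *\<^sub>R \<xi> + real j *\<^sub>R \<xi>"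
      using j by (simp add: of_nat_diff algebra_simps)
    show "(-1) ^ (r + (r - j)) * real (r choose (r - j)) * f (x - real (r - j) *\<^sub>R \<xi>) =
      (-1) ^ r * ((-1) ^ (r + j) * real (r choose j) * f (x - real r *\<^sub>R \<xi> + real j *\<^sub>R \<xi>))"
      unfolding s v binomial_symmetric[OF j, symmetric] by simp
  qed
  also have "\<dots> = (-1) ^ r * fin_diff r \<xi> f (x - real r *\<^sub>R \<xi>)"
    by (simp add: fin_diff_def sum_distrib_left)
  finally show ?thesis .
qed

lemma abs_fin_diff_le:
  assumes "\<And>j. j \<le> k \<Longrightarrow> \<bar>f (x + real j *\<^sub>R \<xi>)\<bar> \<le> B"
  shows "\<bar>fin_diff k \<xi> f x\<bar> \<le> 2 ^ k * B"
proof -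
  have "\<bar>fin_diff k \<xi> f x\<bar> \<le> (\<Sum>j\<le>k. real (k choose j) * B)"
    unfolding fin_diff_def
    by (rule order_trans[OF sum_abs], rule sum_mono) (use assms in \<open>auto simp: abs_mult intro: mult_left_mono\<close>)
  also have "\<dots> = real (\<Sum>j\<le>k. k choose j) * B" by (simp add: sum_distrib_right)
  also have "\<dots> = 2 ^ k * B" by (simp only: choose_row_sum) simp
  finally show ?thesis .
qed

text \<open>The shift by \<xi> is the identity plus the first difference; its n-th power is expanded
  by Pascal's rule.\<close>

lemma binomial_fin_diff_expansion:
  "f (x + real n *\<^sub>R \<xi>) = (\<Sum>k\<le>n. real (n choose k) * fin_diff k \<xi> f x)"
proof (induction n arbitrary: x)
  case 0
  then show ?case by (simp add: fin_diff_0)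
next
  case (Suc n)
  have "f (x + real (Suc n) *\<^sub>R \<xi>) = f ((x + \<xi>) + real n *\<^sub>R \<xi>)" by (simp add: algebra_simps)
  also have "\<dots> = (\<Sum>k\<le>n. real (n choose k) * (fin_diff (Suc k) \<xi> f x + fin_diff k \<xi> f x))"
    unfolding Suc by (simp add: fin_diff_Suc)
  also have "\<dots> = (\<Sum>k\<le>n. real (n choose k) * fin_diff (Suc k) \<xi> f x) + (\<Sum>k\<le>Suc n. real (n choose k) * fin_diff k \<xi> f x)"
    by (simp add: sum.distrib algebra_simps)
  also have "\<dots> = (\<Sum>k\<le>Suc n. real (Suc n choose k) * fin_diff k \<xi> f x)"
    by (simp only: sum.atMost_Suc_shift binomial_Suc_Suc of_nat_add distrib_right sum.distrib binomial_n_0)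
  finally show ?case .
qed

section \<open>Kemperman's identity\<close>

lemma sum_Pow_alternating_eq_0:
  fixes G :: "'a set \<Rightarrow> real"
  assumes "finite A" "k \<in> A" "\<And>J. J \<subseteq> A - {k} \<Longrightarrow> G (insert k J) = G J"
  shows "(\<Sum>J\<in>Pow A. (-1) ^ card J * G J) = 0"
proof -
  \<comment> \<open>Pair J with \<open>insert k J\<close>: equal values of G, opposite
    signs.\<close>
  let ?P = "Pow (A - {k})"
  have fin: "finite ?P" using assms(1) by simp
  have A: "A = insert k (A - {k})" using assms(2) by blast
  have "(\<Sum>J\<in>Pow A. (-1) ^ card J * G J) = (\<Sum>J\<in>?P. (-1) ^ card J * G J) + (\<Sum>J\<in>insert k ` ?P. (-1) ^ card J * G J)"
    by (subst A, subst Pow_insert, rule sum.union_disjoint) (use fin in auto)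
  also have "(\<Sum>J\<in>insert k ` ?P. (-1) ^ card J * G J) = (\<Sum>J\<in>?P. (-1) ^ card (insert k J) * G (insert k J))"
    by (subst sum.reindex) (auto simp: inj_on_def)
  also have "\<dots> = (\<Sum>J\<in>?P. - ((-1) ^ card J * G J))"
  proof (intro sum.cong refl)
    fix J assume J: "J \<in> ?P"
    then have "finite J" "k \<notin> J" using assms(1) by (auto intro: finite_subset)
    then show "(-1) ^ card (insert k J) * G (insert k J) = - ((-1) ^ card J * G J)"
      using assms(3)[of J] J by simp
  qed
  finally show ?thesis by (simp add: sum_negf)
qed

lemma sum_Pow_card:
  fixes F :: "nat \<Rightarrow> real"
  assumes "finite A"
  shows "(\<Sum>J\<in>Pow A. F (card J)) = (\<Sum>j\<le>card A. real (card A choose j) * F j)"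
proof -
  have "(\<Sum>J\<in>Pow A. F (card J)) = (\<Sum>j\<le>card A. \<Sum>J\<in>{J\<in>Pow A. card J = j}. F (card J))"
    by (rule sum.group[symmetric]) (use assms in \<open>auto intro: card_mono\<close>)
  also have "\<dots> = (\<Sum>j\<le>card A. real (card A choose j) * F j)"
    by (intro sum.cong) (use n_subsets[OF assms] in auto)
  finally show ?thesis .
qed

text \<open>Kemperman's identity. Expanding the differences on the left, the terms with \<open>k \<ge> 1\<close> steps for \<open>J\<close> and for
  \<open>J \<union> {k}\<close> have the same argument and opposite signs.\<close>

lemma fin_diff_alternating_Pow:
  fixes g :: "'a::real_vector \<Rightarrow> real" and h :: "nat \<Rightarrow> 'a"
  shows "(\<Sum>J\<in>Pow {1..r}. (-1) ^ card J * fin_diff r (- (\<Sum>j\<in>J. (1 / real j) *\<^sub>R h j)) g (x + sum h J))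
    = (-1) ^ r * (\<Sum>J\<in>Pow {1..r}. (-1) ^ card J * g (x + sum h J))"
proof -
  define G where "G k J = g (x + (\<Sum>j\<in>J. (1 - real k / real j) *\<^sub>R h j))" for k J
  have G: "x + sum h J + real k *\<^sub>R (- (\<Sum>j\<in>J. (1 / real j) *\<^sub>R h j)) = x + (\<Sum>j\<in>J. (1 - real k / real j) *\<^sub>R h j)" for k J
    by (simp add: scaleR_sum_right sum_subtractf algebra_simps)
  have "(\<Sum>J\<in>Pow {1..r}. (-1) ^ card J * fin_diff r (- (\<Sum>j\<in>J. (1 / real j) *\<^sub>R h j)) g (x + sum h J))
    = (\<Sum>J\<in>Pow {1..r}. \<Sum>k\<le>r. (-1) ^ (r + k) * real (r choose k) * ((-1) ^ card J * G k J))"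
    unfolding fin_diff_def G by (simp add: G_def sum_distrib_left mult_ac)
  also have "\<dots> = (\<Sum>k\<le>r. (-1) ^ (r + k) * real (r choose k) * (\<Sum>J\<in>Pow {1..r}. (-1) ^ card J * G k J))"
    by (subst sum.swap) (simp add: sum_distrib_left)
  also have "\<dots> = (\<Sum>k\<in>{0}. (-1) ^ (r + k) * real (r choose k) * (\<Sum>J\<in>Pow {1..r}. (-1) ^ card J * G k J))"
  proof (rule sum.mono_neutral_right, goal_cases)
    case 3
    have "(\<Sum>J\<in>Pow {1..r}. (-1) ^ card J * G k J) = 0" if k: "k \<in> {..r} - {0}" for k
    proof (rule sum_Pow_alternating_eq_0[of _ k])
      fix J assume J: "J \<subseteq> {1..r} - {k}"
      then have "finite J" by (auto intro: finite_subset)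
      \<comment> \<open>The new summand has the coefficient 1 - k/k = 0.\<close>
      then show "G k (insert k J) = G k J" using J k unfolding G_def by (subst sum.insert) auto
    qed (use k in auto)
    then show ?case by simp
  qed auto
  also have "\<dots> = (-1) ^ r * (\<Sum>J\<in>Pow {1..r}. (-1) ^ card J * g (x + sum h J))"
    by (simp add: G_def)
  finally show ?thesis .
qed

text \<open>Kemperman's identity for n steps u and one step w: splitting its right side by whether J
  contains \<open>Suc n\<close> leaves the mixed difference, up to sign. So the n-th differences of
  a first difference of g are controlled by pure differences of order n + 1, for arbitrary parallel
  u and w.\<close>

lemma fin_diff_of_difference:
  fixes g :: "'a::real_vector \<Rightarrow> real" and u w :: 'a and n :: nat
  defines "h \<equiv> \<lambda>j. if j = Suc n then w else u"
  shows "fin_diff n u (\<lambda>y. g (y + w) - g y) x =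
    (\<Sum>J\<in>Pow {1..Suc n}. (-1) ^ card J * fin_diff (Suc n) (- (\<Sum>j\<in>J. (1 / real j) *\<^sub>R h j)) g (x + sum h J))"
proof -
  have S: "{1..Suc n} = insert (Suc n) {1..n}" by auto
  have "(\<Sum>J\<in>Pow {1..Suc n}. (-1) ^ card J * g (x + sum h J))
    = (\<Sum>J\<in>Pow {1..n}. (-1) ^ card J * g (x + sum h J)) + (\<Sum>J\<in>insert (Suc n) ` Pow {1..n}. (-1) ^ card J * g (x + sum h J))"
    by (subst S, subst Pow_insert, rule sum.union_disjoint) auto
  also have "(\<Sum>J\<in>insert (Suc n) ` Pow {1..n}. (-1) ^ card J * g (x + sum h J))
    = (\<Sum>J\<in>Pow {1..n}. (-1) ^ card (insert (Suc n) J) * g (x + sum h (insert (Suc n) J)))"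
    by (subst sum.reindex, rule inj_onI, subst (asm) insert_ident) auto
  also have "(\<Sum>J\<in>Pow {1..n}. (-1) ^ card J * g (x + sum h J)) + \<dots>
    = (\<Sum>J\<in>Pow {1..n}. (-1) ^ card J * (g (x + real (card J) *\<^sub>R u) - g (x + real (card J) *\<^sub>R u + w)))"
  proof (subst sum.distrib[symmetric], intro sum.cong refl)
    fix J assume "J \<in> Pow {1..n}"
    then have J: "finite J" "Suc n \<notin> J" by (auto intro: finite_subset)
    have "sum h J = (\<Sum>j\<in>J. u)" using J by (intro sum.cong) (auto simp: h_def)
    then have sJ: "sum h J = real (card J) *\<^sub>R u" by (simp add: sum_constant_scaleR)
    have "sum h (insert (Suc n) J) = w + real (card J) *\<^sub>R u"
      using J sJ by (simp add: h_def)
    then show "(-1) ^ card J * g (x + sum h J) + (-1) ^ card (insert (Suc n) J) * g (x + sum h (insert (Suc n) J))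
      = (-1) ^ card J * (g (x + real (card J) *\<^sub>R u) - g (x + real (card J) *\<^sub>R u + w))"
      using J sJ by (simp add: algebra_simps)
  qed
  also have "\<dots> = (\<Sum>j\<le>n. real (n choose j) * ((-1) ^ j * (g (x + real j *\<^sub>R u) - g (x + real j *\<^sub>R u + w))))"
    using sum_Pow_card[of "{1..n}" "\<lambda>j. (-1) ^ j * (g (x + real j *\<^sub>R u) - g (x + real j *\<^sub>R u + w))"] by simp
  also have "(-1) ^ Suc n * \<dots> = fin_diff n u (\<lambda>y. g (y + w) - g y) x"
    unfolding fin_diff_def sum_distrib_left by (intro sum.cong) (auto simp: power_add algebra_simps)
  finally show ?thesis
    using fin_diff_alternating_Pow[of "Suc n" h g x] by simp
qed

section \<open>Newton's forward formula\<close>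

definition gbinomial_poly :: "nat \<Rightarrow> real poly" where
  "gbinomial_poly k = smult (1 / fact k) (\<Prod>i<k. [:- real i, 1:])"

lemma poly_gbinomial_poly: "poly (gbinomial_poly k) t = t gchoose k"
  by (simp add: gbinomial_poly_def gbinomial_prod_rev poly_prod atLeast0LessThan)

lemma degree_gbinomial_poly: "degree (gbinomial_poly k) \<le> k"
  using order_trans[OF degree_smult_le[of "1 / fact k"] degree_prod_sum_le[of "{..<k}" "\<lambda>i. [:- real i, 1:]"]]
  by (simp add: gbinomial_poly_def o_def)

text \<open>Both sides have degree below m and agree at 0, ..., m - 1, where the formula is
  \<open>binomial_fin_diff_expansion\<close>: the terms with k > n have coefficient zero.\<close>

lemma newton_forward_poly:
  fixes q :: "real poly"
  assumes "degree q < m"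
  shows "poly q t = (\<Sum>k<m. (t gchoose k) * fin_diff k 1 (poly q) 0)"
proof -
  define Q where "Q = (\<Sum>k<m. smult (fin_diff k 1 (poly q) 0) (gbinomial_poly k))"
  have "degree Q \<le> m - 1"
    unfolding Q_def by (rule degree_sum_le) (auto intro: order_trans[OF degree_smult_le] order_trans[OF degree_gbinomial_poly])
  moreover have "poly q (real n) = poly Q (real n)" if "n < m" for n
  proof -
    have "poly q (real n) = (\<Sum>k\<le>n. real (n choose k) * fin_diff k 1 (poly q) 0)"
      using binomial_fin_diff_expansion[of "poly q" 0 n 1] by simp
    also have "\<dots> = (\<Sum>k<m. real (n choose k) * fin_diff k 1 (poly q) 0)"
      by (rule sum.mono_neutral_left) (use that in \<open>auto simp: not_le\<close>)
    also have "\<dots> = poly Q (real n)"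
      by (simp add: Q_def poly_sum poly_gbinomial_poly binomial_gbinomial mult.commute)
    finally show ?thesis .
  qed
  ultimately have "q = Q"
    by (intro poly_eqI_degree[of "real ` {..<m}"]) (use assms in \<open>auto simp: card_image inj_on_def\<close>)
  then have "poly q t = poly Q t" by simp
  then show ?thesis by (simp add: Q_def poly_sum poly_gbinomial_poly mult.commute)
qed

text \<open>Compare Newton's formula with m and with m + 1 terms at t = m: they differ by the m-th
  difference, with coefficient 1.\<close>

lemma fin_diff_poly_eq_0:
  fixes q :: "real poly"
  assumes "degree q < m"
  shows "fin_diff m 1 (poly q) 0 = 0"
proof -
  have "poly q (real m) = (\<Sum>k<Suc m. (real m gchoose k) * fin_diff k 1 (poly q) 0)"
    using assms by (intro newton_forward_poly) simp
  also have "\<dots> = poly q (real m) + fin_diff m 1 (poly q) 0"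
    using newton_forward_poly[OF assms, of "real m"] by (simp add: binomial_gbinomial[symmetric])
  finally show ?thesis by simp
qed

text \<open>The bound is strict to match \<open>directional_polys\<close>. No polynomial has degree
  below 0, so \<open>poly_fun 0 g\<close> fails even for g = 0; hence the recurring positivity of
  degree bounds.\<close>

definition poly_fun :: "nat \<Rightarrow> (real \<Rightarrow> real) \<Rightarrow> bool" where
  "poly_fun m g \<longleftrightarrow> (\<exists>q. degree q < m \<and> (\<forall>t. g t = poly q t))"

lemma poly_fun_const: "0 < m \<Longrightarrow> poly_fun m (\<lambda>t. c)"
  unfolding poly_fun_def by (rule exI[of _ "[:c:]"]) simp

lemma poly_fun_add:
  assumes "poly_fun m f" "poly_fun m g" shows "poly_fun m (\<lambda>t. f t + g t)"
proof -
  obtain a b where "degree a < m" "\<And>t. f t = poly a t" "degree b < m" "\<And>t. g t = poly b t"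
    using assms unfolding poly_fun_def by blast
  then show ?thesis unfolding poly_fun_def
    by (intro exI[of _ "a + b"]) (auto intro: degree_add_less)
qed

lemma poly_fun_cmult:
  assumes "poly_fun m f" shows "poly_fun m (\<lambda>t. c * f t)"
proof -
  obtain a where "degree a < m" "\<And>t. f t = poly a t"
    using assms unfolding poly_fun_def by blast
  then show ?thesis unfolding poly_fun_def
    by (intro exI[of _ "smult c a"]) (auto intro: le_less_trans[OF degree_smult_le])
qed

lemma poly_fun_sum:
  assumes "0 < m" "\<And>i. i \<in> I \<Longrightarrow> poly_fun m (f i)"
  shows "poly_fun m (\<lambda>t. \<Sum>i\<in>I. f i t)"
  using assms(2)
proof (induction I rule: infinite_finite_induct)
  case (insert i I)
  then show ?case by (simp add: poly_fun_add)
qed (use assms(1) in \<open>simp_all add: poly_fun_const\<close>)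

lemma poly_fun_affine:
  assumes "poly_fun m f" shows "poly_fun m (\<lambda>t. f (a + b * t))"
proof -
  obtain q where "degree q < m" "\<And>t. f t = poly q t"
    using assms unfolding poly_fun_def by blast
  moreover have "degree (pcompose q [:a, b:]) \<le> degree q"
    using degree_pcompose_le[of q "[:a, b:]"] by (auto split: if_splits)
  ultimately show ?thesis unfolding poly_fun_def
    by (intro exI[of _ "pcompose q [:a, b:]"]) (auto simp: poly_pcompose algebra_simps)
qed

lemma poly_fun_gbinomial: "poly_fun (Suc k) (\<lambda>t. t gchoose k)"
  unfolding poly_fun_def
  by (rule exI[of _ "gbinomial_poly k"]) (simp add: poly_gbinomial_poly degree_gbinomial_poly less_Suc_eq_le)

lemma poly_fun_mono: "poly_fun m f \<Longrightarrow> m \<le> n \<Longrightarrow> poly_fun n f"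
  unfolding poly_fun_def by (meson less_le_trans)

lemma poly_fun_pos: "poly_fun m f \<Longrightarrow> 0 < m"
  unfolding poly_fun_def by auto

lemma newton_forward:
  fixes f :: "'a::real_vector \<Rightarrow> real"
  assumes "poly_fun m (\<lambda>t. f (x + t *\<^sub>R e))"
  shows "f (x + t *\<^sub>R \<eta> *\<^sub>R e) = (\<Sum>k<m. (t gchoose k) * fin_diff k (\<eta> *\<^sub>R e) f x)"
proof -
  obtain q where q: "degree q < m" "\<And>t. f (x + (0 + \<eta> * t) *\<^sub>R e) = poly q t"
    using poly_fun_affine[OF assms, of 0 \<eta>] unfolding poly_fun_def by blast
  have "fin_diff k (\<eta> *\<^sub>R e) f x = fin_diff k 1 (poly q) 0" for k
    unfolding fin_diff_def q(2)[symmetric] by (simp add: mult.commute)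
  then show ?thesis
    using newton_forward_poly[OF q(1), of t] q(2)[of t] by (simp add: mult.commute)
qed

lemma fin_diff_poly_fun_eq_0:
  fixes f :: "'a::real_vector \<Rightarrow> real"
  assumes "poly_fun m (\<lambda>t. f (x + t *\<^sub>R e))"
  shows "fin_diff m (\<eta> *\<^sub>R e) f x = 0"
proof -
  obtain q where q: "degree q < m" "\<And>t. f (x + (0 + \<eta> * t) *\<^sub>R e) = poly q t"
    using poly_fun_affine[OF assms, of 0 \<eta>] unfolding poly_fun_def by blast
  have "fin_diff m (\<eta> *\<^sub>R e) f x = fin_diff m 1 (poly q) 0"
    unfolding fin_diff_def q(2)[symmetric] by (simp add: mult.commute)
  then show ?thesis using fin_diff_poly_eq_0[OF q(1)] by simp
qed

text \<open>(T + m)^k bounds \<open>t gchoose k\<close> for |t| <= T, and 2^k is the sum of the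
  absolute coefficients of a k-th difference.\<close>

definition newton_const :: "nat \<Rightarrow> real \<Rightarrow> real" where
  "newton_const m T = (\<Sum>k<m. (2 * (T + real m)) ^ k)"

lemma abs_gbinomial_le:
  assumes "\<bar>t\<bar> \<le> T" "k \<le> m"
  shows "\<bar>t gchoose k\<bar> \<le> (T + real m) ^ k"
proof -
  have "\<bar>t gchoose k\<bar> = (\<Prod>i<k. \<bar>t - real i\<bar>) / fact k"
    by (simp add: gbinomial_prod_rev abs_prod atLeast0LessThan)
  also have "\<dots> \<le> (\<Prod>i<k. \<bar>t - real i\<bar>)"
    using mult_left_mono[OF fact_ge_1[of k, where 'a=real] prod_nonneg[of "{..<k}" "\<lambda>i. \<bar>t - real i\<bar>"]]
    by (simp add: divide_le_eq)
  also have "\<dots> \<le> (\<Prod>i<k. T + real m)"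
    by (rule prod_mono) (use assms in auto)
  finally show ?thesis by simp
qed

lemma newton_bound:
  fixes f :: "'a::real_vector \<Rightarrow> real"
  assumes poly: "poly_fun m (\<lambda>t. f (x + t *\<^sub>R e))"
    and B: "\<And>j. j < m \<Longrightarrow> \<bar>f (x + real j *\<^sub>R \<eta> *\<^sub>R e)\<bar> \<le> B" and t: "\<bar>t\<bar> \<le> T"
  shows "\<bar>f (x + t *\<^sub>R \<eta> *\<^sub>R e)\<bar> \<le> newton_const m T * B"
proof -
  have "\<bar>f (x + t *\<^sub>R \<eta> *\<^sub>R e)\<bar> \<le> (\<Sum>k<m. \<bar>(t gchoose k) * fin_diff k (\<eta> *\<^sub>R e) f x\<bar>)"
    unfolding newton_forward[OF poly] by (rule sum_abs)
  also have "\<dots> \<le> (\<Sum>k<m. (T + real m) ^ k * (2 ^ k * B))"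
    unfolding abs_mult
    by (intro sum_mono mult_mono abs_gbinomial_le abs_fin_diff_le t B) (use t in auto)
  also have "\<dots> = newton_const m T * B"
    unfolding newton_const_def sum_distrib_right
    by (intro sum.cong refl) (simp only: power_mult_distrib mult_ac)
  finally show ?thesis .
qed

lemma newton_const_ge_1: "0 < m \<Longrightarrow> 0 \<le> T \<Longrightarrow> 1 \<le> newton_const m T"
  unfolding newton_const_def
  by (rule order_trans[OF _ member_le_sum[of 0]]) auto

section \<open>Boxes and coordinatewise polynomials\<close>

text \<open>The last condition makes the independent family \<open>e\<close> spanning. Describing
  parallelepipeds by the coordinates \<phi> replaces a linear change of variables, so no
  determinants appear.\<close>

definition dual_basis :: "('i::finite \<Rightarrow> 'a::euclidean_space) \<Rightarrow> ('i \<Rightarrow> 'a \<Rightarrow> real) \<Rightarrow> bool" where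
  "dual_basis e \<phi> \<longleftrightarrow> (\<forall>i. linear (\<phi> i)) \<and> (\<forall>i j. \<phi> i (e j) = (if i = j then 1 else 0)) \<and>
     (\<forall>x. (\<Sum>i\<in>UNIV. \<phi> i x *\<^sub>R e i) = x)"

definition pbox :: "('i \<Rightarrow> 'a::euclidean_space \<Rightarrow> real) \<Rightarrow> ('i \<Rightarrow> real) \<Rightarrow> 'a set" where
  "pbox \<phi> s = {x. \<forall>i. \<bar>\<phi> i x\<bar> \<le> s i}"

abbreviation cube :: "('i \<Rightarrow> 'a::euclidean_space \<Rightarrow> real) \<Rightarrow> real \<Rightarrow> 'a set" where
  "cube \<phi> s \<equiv> pbox \<phi> (\<lambda>_. s)"

lemma dual_basis_linear: "dual_basis e \<phi> \<Longrightarrow> linear (\<phi> i)"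
  by (simp add: dual_basis_def)

lemma dual_basis_sum: "dual_basis e \<phi> \<Longrightarrow> (\<Sum>i\<in>UNIV. \<phi> i x *\<^sub>R e i) = x"
  by (simp add: dual_basis_def)

lemma dual_basis_simps:
  assumes "dual_basis e \<phi>"
  shows "\<phi> i (x + y) = \<phi> i x + \<phi> i y" "\<phi> i (x - y) = \<phi> i x - \<phi> i y"
    "\<phi> i (t *\<^sub>R x) = t * \<phi> i x" "\<phi> i (- x) = - \<phi> i x" "\<phi> i 0 = 0"
    "\<phi> i (\<Sum>j\<in>J. F j) = (\<Sum>j\<in>J. \<phi> i (F j))"
  using dual_basis_linear[OF assms, of i]
  by (simp_all add: linear_add linear_diff linear_scale linear_neg linear_0 linear_sum)

lemma dual_basis_apply: "dual_basis e \<phi> \<Longrightarrow> \<phi> i (e j) = (if i = j then 1 else 0)"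
  by (simp add: dual_basis_def)

lemma dual_basis_combination:
  fixes J :: "'i::finite set"
  assumes "dual_basis e \<phi>"
  shows "\<phi> i (\<Sum>j\<in>J. t j *\<^sub>R e j) = (if i \<in> J then t i else 0)"
proof -
  have "\<phi> i (\<Sum>j\<in>J. t j *\<^sub>R e j) = (\<Sum>j\<in>J. if i = j then t j else 0)"
    unfolding dual_basis_simps[OF assms] dual_basis_apply[OF assms] by (intro sum.cong) auto
  then show ?thesis by simp
qed

lemma cube_shift:
  assumes "dual_basis e \<phi>" "x \<in> cube \<phi> s" "s + \<bar>h\<bar> \<le> t"
  shows "x + h *\<^sub>R e i \<in> cube \<phi> t"
proof -
  have "\<bar>\<phi> j (x + h *\<^sub>R e i)\<bar> \<le> t" for j
  proof -
    have "\<bar>\<phi> j x\<bar> \<le> s" using assms(2) by (simp add: pbox_def)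
    then show ?thesis
      using assms(3) unfolding dual_basis_simps[OF assms(1)] dual_basis_apply[OF assms(1)] by auto
  qed
  then show ?thesis by (simp add: pbox_def)
qed

text \<open>Results about \<open>cube \<phi> 1\<close> for all bases thereby apply to smaller cubes
  of a given basis, without transforming f.\<close>

lemma dual_basis_scale:
  assumes "dual_basis e \<phi>" "0 < \<mu>"
  shows "dual_basis (\<lambda>i. \<mu> *\<^sub>R e i) (\<lambda>i x. \<phi> i x / \<mu>)"
proof -
  have "linear (\<lambda>x. (1 / \<mu>) *\<^sub>R \<phi> i x)" for i
    using dual_basis_linear[OF assms(1), of i] by (rule linear_compose_scale_right)
  then show ?thesis
    using assms by (auto simp: dual_basis_def dual_basis_simps)
qed

lemma pbox_scale: "0 < \<mu> \<Longrightarrow> pbox (\<lambda>i x. \<phi> i x / \<mu>) s = pbox \<phi> (\<lambda>i. \<mu> * s i)"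
  unfolding pbox_def by (simp add: abs_divide divide_le_eq mult.commute)

lemma pbox_mono: "(\<And>i. s i \<le> s' i) \<Longrightarrow> pbox \<phi> s \<subseteq> pbox \<phi> s'"
  unfolding pbox_def by (auto intro: order_trans)

lemma dual_basis_continuous: "dual_basis e \<phi> \<Longrightarrow> continuous_on UNIV (\<phi> i)"
  by (intro linear_continuous_on linear_conv_bounded_linear[THEN iffD1] dual_basis_linear)

lemma closed_pbox:
  assumes "dual_basis e \<phi>"
  shows "closed (pbox \<phi> s)"
  unfolding pbox_def
  by (intro closed_Collect_all closed_Collect_le continuous_intros dual_basis_continuous[OF assms])

lemma bounded_pbox:
  fixes e :: "'i::finite \<Rightarrow> 'a::euclidean_space"
  assumes "dual_basis e \<phi>"
  shows "bounded (pbox \<phi> s)"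
proof -
  have "norm x \<le> (\<Sum>i\<in>UNIV. s i * norm (e i))" if "x \<in> pbox \<phi> s" for x
  proof -
    have "norm (\<Sum>i\<in>UNIV. \<phi> i x *\<^sub>R e i) \<le> (\<Sum>i\<in>UNIV. s i * norm (e i))"
      by (rule order_trans[OF norm_sum], rule sum_mono) (use that in \<open>auto simp: pbox_def intro: mult_right_mono\<close>)
    then show ?thesis by (simp add: dual_basis_sum[OF assms])
  qed
  then show ?thesis by (auto simp: bounded_iff)
qed

lemma borel_pbox: "dual_basis e \<phi> \<Longrightarrow> pbox \<phi> s \<in> sets borel"
  by (intro borel_closed closed_pbox)

lemma lmeasurable_pbox: "dual_basis e \<phi> \<Longrightarrow> pbox \<phi> s \<in> lmeasurable"
  by (intro lmeasurable_compact) (simp add: compact_eq_bounded_closed bounded_pbox closed_pbox)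

lemma sets_lebesgue_pbox: "dual_basis e \<phi> \<Longrightarrow> pbox \<phi> s \<in> sets lebesgue"
  by (rule fmeasurableD[OF lmeasurable_pbox])

lemma measure_pbox_pos:
  fixes e :: "'i::finite \<Rightarrow> 'a::euclidean_space"
  assumes "dual_basis e \<phi>" "\<And>i. 0 < s i"
  shows "0 < measure lebesgue (pbox \<phi> s)"
proof -
  let ?U = "{x. \<forall>i. \<bar>\<phi> i x\<bar> < s i}"
  have "?U = (\<Inter>i. {x. \<bar>\<phi> i x\<bar> < s i})" by auto
  also have "open \<dots>"
    by (intro open_INT finite ballI open_Collect_less continuous_intros dual_basis_continuous[OF assms(1)])
  finally have "open ?U" .
  moreover have "0 \<in> ?U" using assms(2) by (simp add: dual_basis_simps[OF assms(1)])
  ultimately have "\<not> negligible ?U" by (intro open_not_negligible) auto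
  moreover have "?U \<subseteq> pbox \<phi> s" by (auto simp: pbox_def less_imp_le)
  ultimately have "\<not> negligible (pbox \<phi> s)" using negligible_subset by blast
  then show ?thesis
    using negligible_iff_measure0[OF lmeasurable_pbox[OF assms(1)]] by (simp add: measure_nonneg less_le)
qed

text \<open>The ratio does not depend on the basis, which is what makes the constants
  uniform.\<close>

lemma measure_pbox_scale:
  fixes e :: "'i::finite \<Rightarrow> 'a::euclidean_space"
  assumes "dual_basis e \<phi>" "0 < \<mu>"
  shows "measure lebesgue (pbox \<phi> (\<lambda>i. \<mu> * s i)) = \<mu> ^ DIM('a) * measure lebesgue (pbox \<phi> s)"
proof -
  have "pbox \<phi> (\<lambda>i. \<mu> * s i) = (\<lambda>x. \<mu> *\<^sub>R x + 0) ` pbox \<phi> s"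
  proof (intro equalityI subsetI)
    fix x assume x: "x \<in> pbox \<phi> (\<lambda>i. \<mu> * s i)"
    then have "(1 / \<mu>) *\<^sub>R x \<in> pbox \<phi> s"
      using assms(2) by (auto simp: pbox_def dual_basis_simps[OF assms(1)] abs_mult divide_le_eq mult.commute)
    then show "x \<in> (\<lambda>x. \<mu> *\<^sub>R x + 0) ` pbox \<phi> s"
      using assms(2) by (intro image_eqI[of _ _ "(1 / \<mu>) *\<^sub>R x"]) auto
  next
    fix x assume "x \<in> (\<lambda>x. \<mu> *\<^sub>R x + 0) ` pbox \<phi> s"
    then show "x \<in> pbox \<phi> (\<lambda>i. \<mu> * s i)"
      using assms(2) by (auto simp: pbox_def dual_basis_simps[OF assms(1)] abs_mult)
  qed
  then show ?thesis using measure_lebesgue_affine[of \<mu> 0 "pbox \<phi> s"] assms(2) by simp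
qed

lemma Lp_vol_pbox_scale:
  fixes e :: "'i::finite \<Rightarrow> 'a::euclidean_space"
  assumes "dual_basis e \<phi>" "0 < \<mu>"
  shows "Lp_vol p (pbox \<phi> (\<lambda>i. \<mu> * s i)) = (\<mu> powr (real DIM('a) / enn2real p)) * Lp_vol p (pbox \<phi> s)"
  using assms by (simp add: Lp_vol_def measure_pbox_scale powr_mult powr_realpow[symmetric] powr_powr)

section \<open>Polynomials with a degree bound in each coordinate direction\<close>

definition mpolys :: "('i \<Rightarrow> 'a::euclidean_space) \<Rightarrow> ('i \<Rightarrow> nat) \<Rightarrow> ('a \<Rightarrow> real) set" where
  "mpolys e \<rho> = {Q. real_polynomial_function Q \<and> (\<forall>x i. poly_fun (\<rho> i) (\<lambda>t. Q (x + t *\<^sub>R e i)))}"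

lemma mpolys_poly_fun: "Q \<in> mpolys e \<rho> \<Longrightarrow> poly_fun (\<rho> i) (\<lambda>t. Q (x + t *\<^sub>R e i))"
  by (simp add: mpolys_def)

lemma mpolys_add: "P \<in> mpolys e \<rho> \<Longrightarrow> Q \<in> mpolys e \<rho> \<Longrightarrow> (\<lambda>x. P x + Q x) \<in> mpolys e \<rho>"
  by (auto simp: mpolys_def intro: poly_fun_add)

lemma mpolys_cmult: "P \<in> mpolys e \<rho> \<Longrightarrow> (\<lambda>x. c * P x) \<in> mpolys e \<rho>"
  by (auto simp: mpolys_def intro: poly_fun_cmult)

lemma mpolys_diff: "P \<in> mpolys e \<rho> \<Longrightarrow> Q \<in> mpolys e \<rho> \<Longrightarrow> (\<lambda>x. P x - Q x) \<in> mpolys e \<rho>"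
  using mpolys_add[of P e \<rho> "\<lambda>x. -1 * Q x"] mpolys_cmult[of Q e \<rho> "-1"] by simp

lemma mpolys_const: "(\<And>i. 0 < \<rho> i) \<Longrightarrow> (\<lambda>x. c) \<in> mpolys e \<rho>"
  by (auto simp: mpolys_def intro: poly_fun_const)

lemma real_polynomial_function_affine:
  fixes f :: "'a::euclidean_space \<Rightarrow> real" and L :: "'a \<Rightarrow> 'a"
  assumes "real_polynomial_function f" "linear L"
  shows "real_polynomial_function (\<lambda>x. f (L x + w))"
proof -
  have "bounded_linear L" using assms(2) by (rule linear_conv_bounded_linear[THEN iffD1])
  then have "polynomial_function (\<lambda>x. L x + w)"
    by (intro polynomial_function_add polynomial_function_bounded_linear polynomial_function_const)
  from real_polynomial_function_compose[OF this assms(1)] show ?thesis by (simp add: o_def)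
qed

lemma mpolys_shift:
  assumes "P \<in> mpolys e \<rho>"
  shows "(\<lambda>x. P (x + w)) \<in> mpolys e \<rho>"
proof -
  have "real_polynomial_function (\<lambda>x. P (x + w))"
    using assms by (intro real_polynomial_function_affine[of P "\<lambda>x. x"]) (auto simp: mpolys_def linear_ident)
  moreover have "poly_fun (\<rho> i) (\<lambda>t. P (x + t *\<^sub>R e i + w))" for x i
    using mpolys_poly_fun[OF assms, of i "x + w"] by (simp add: add_ac)
  ultimately show ?thesis by (simp add: mpolys_def)
qed

lemma mpolys_mono: "P \<in> mpolys e \<rho> \<Longrightarrow> (\<And>i. \<rho> i \<le> \<rho>' i) \<Longrightarrow> P \<in> mpolys e \<rho>'"
  by (auto simp: mpolys_def intro: poly_fun_mono)

lemma mpolys_scale: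
  fixes e :: "'i \<Rightarrow> 'a::euclidean_space"
  assumes "\<mu> \<noteq> 0"
  shows "mpolys (\<lambda>i. \<mu> *\<^sub>R e i) \<rho> = mpolys e \<rho>"
proof -
  have "poly_fun m (\<lambda>t. Q (x + t *\<^sub>R \<mu> *\<^sub>R v)) \<longleftrightarrow> poly_fun m (\<lambda>t. Q (x + t *\<^sub>R v))" for m Q x and v :: 'a
    using poly_fun_affine[of m "\<lambda>t. Q (x + t *\<^sub>R v)" 0 \<mu>] poly_fun_affine[of m "\<lambda>t. Q (x + t *\<^sub>R \<mu> *\<^sub>R v)" 0 "1 / \<mu>"]
      assms by (auto simp: mult.commute)
  then show ?thesis by (simp add: mpolys_def)
qed

lemma mpolys_fin_diff_eq_0: "Q \<in> mpolys e \<rho> \<Longrightarrow> fin_diff (\<rho> i) (u *\<^sub>R e i) Q x = 0"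
  by (intro fin_diff_poly_fun_eq_0 mpolys_poly_fun)

lemma mpolys_continuous: "Q \<in> mpolys e \<rho> \<Longrightarrow> continuous_on UNIV Q"
  by (simp add: mpolys_def continuous_on_polymonial_function real_polynomial_function_eq)

lemma mpolys_measurable: "Q \<in> mpolys e \<rho> \<Longrightarrow> Q \<in> borel_measurable lebesgue"
  by (intro measurable_completion) (use borel_measurable_continuous_onI[OF mpolys_continuous] in auto)

lemma mpolys_bounded_on_pbox:
  fixes e :: "'i::finite \<Rightarrow> 'a::euclidean_space"
  assumes "dual_basis e \<phi>" "Q \<in> mpolys e \<rho>"
  obtains M where "\<And>x. x \<in> pbox \<phi> s \<Longrightarrow> \<bar>Q x\<bar> \<le> M"
proof -
  have "compact (pbox \<phi> s)"
    by (simp add: compact_eq_bounded_closed bounded_pbox[OF assms(1)] closed_pbox[OF assms(1)])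
  then have "bounded (Q ` pbox \<phi> s)"
    by (intro compact_imp_bounded compact_continuous_image continuous_on_subset[OF mpolys_continuous[OF assms(2)]]) auto
  then show ?thesis using that by (auto simp: bounded_iff)
qed

text \<open>Extrapolation by \<open>newton_bound\<close>, one coordinate at a time: for each node k
  in the new direction j, the induction hypothesis with base point moved to that node handles the
  other coordinates. Each direction costs one factor \<open>newton_const m T\<close>.\<close>

lemma mpolys_grid_bound:
  fixes e :: "'i::finite \<Rightarrow> 'a::euclidean_space"
  assumes Q: "Q \<in> mpolys e \<rho>" and m: "\<And>i. \<rho> i \<le> m" and t: "\<And>i. \<bar>t i\<bar> \<le> T"
    and B: "\<And>\<beta> :: 'i \<Rightarrow> nat. (\<And>i. \<beta> i < m) \<Longrightarrow> \<bar>Q (x + (\<Sum>i\<in>J. real (\<beta> i) *\<^sub>R \<eta> *\<^sub>R e i))\<bar> \<le> B"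
  shows "\<bar>Q (x + (\<Sum>i\<in>J. t i *\<^sub>R \<eta> *\<^sub>R e i))\<bar> \<le> newton_const m T ^ card J * B"
  using finite[of J] B
proof (induction J arbitrary: x)
  case empty
  have "0 < m" using m poly_fun_pos[OF mpolys_poly_fun[OF Q]] by (meson less_le_trans)
  then show ?case using empty[of "\<lambda>_. 0"] by simp
next
  case (insert j J)
  have *: "\<bar>Q (x + real k *\<^sub>R \<eta> *\<^sub>R e j + (\<Sum>i\<in>J. t i *\<^sub>R \<eta> *\<^sub>R e i))\<bar> \<le> newton_const m T ^ card J * B"
    if "k < m" for k
  proof (rule insert.IH)
    fix \<beta> :: "'i \<Rightarrow> nat" assume \<beta>: "\<And>i. \<beta> i < m"
    have "(\<Sum>i\<in>J. real ((\<beta>(j := k)) i) *\<^sub>R \<eta> *\<^sub>R e i) = (\<Sum>i\<in>J. real (\<beta> i) *\<^sub>R \<eta> *\<^sub>R e i)"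
      using insert.hyps by (intro sum.cong) auto
    then show "\<bar>Q (x + real k *\<^sub>R \<eta> *\<^sub>R e j + (\<Sum>i\<in>J. real (\<beta> i) *\<^sub>R \<eta> *\<^sub>R e i))\<bar> \<le> B"
      using insert.prems[of "\<beta>(j := k)"] \<beta> that insert.hyps by (simp add: add.assoc)
  qed
  have "\<bar>Q (x + (\<Sum>i\<in>J. t i *\<^sub>R \<eta> *\<^sub>R e i) + t j *\<^sub>R \<eta> *\<^sub>R e j)\<bar>
      \<le> newton_const m T * (newton_const m T ^ card J * B)"
  proof (rule newton_bound[OF poly_fun_mono[OF mpolys_poly_fun[OF Q] m] _ t])
    fix k assume "k < m"
    from *[OF this] show "\<bar>Q (x + (\<Sum>i\<in>J. t i *\<^sub>R \<eta> *\<^sub>R e i) + real k *\<^sub>R \<eta> *\<^sub>R e j)\<bar> \<le> newton_const m T ^ card J * B"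
      by (simp add: add_ac)
  qed
  then show ?case using insert.hyps by (simp add: add_ac mult_ac)
qed

text \<open>Each point of a box of half the size is the corner of a grid in the given box, whose nodes determine the
  polynomial; taking \<open>L\<^sup>p\<close> norms over the corner turns values at nodes into \<open>L\<^sup>p\<close> norms.\<close>

lemma mpolys_sup_le_Lp:
  assumes p: "0 < p" and s: "0 < s" "s \<le> 1" and m: "0 < m"
  obtains C where "0 < C"
    "\<And>(e :: 'i::finite \<Rightarrow> 'a::euclidean_space) \<phi> \<rho> Q b x. \<lbrakk>dual_basis e \<phi>; \<And>i. \<rho> i \<le> m; Q \<in> mpolys e \<rho>;
      Lp_le p (cube \<phi> s) Q b; x \<in> cube \<phi> 1\<rbrakk> \<Longrightarrow> \<bar>Q x\<bar> * Lp_vol p (cube \<phi> 1) \<le> C * b"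
proof -
  \<comment> \<open>A grid of m nodes per direction with this spacing is shorter than s/2, so from a
    corner in \<open>cube \<phi> (s / 2)\<close> it stays in \<open>cube \<phi> s\<close>. In units
    of \<eta>, the corner and a point of \<open>cube \<phi> 1\<close> differ by at most 2 / \<eta>
    in each coordinate, the argument of \<open>newton_const\<close>. \<kappa> is the ratio of
    \<open>Lp_vol\<close> for the cubes of sizes s/2 and 1; for p = infinity its exponent is a
    division by zero, so it is 1.\<close>
  define \<eta> where "\<eta> = s / (2 * real m)"
  define \<B> where "\<B> = (PiE UNIV (\<lambda>_. {..<m}) :: ('i \<Rightarrow> nat) set)"
  have fin: "finite \<B>" unfolding \<B>_def by (intro finite_PiE) auto
  define N where "N = newton_const m (2 / \<eta>) ^ CARD('i)"
  define \<kappa> where "\<kappa> = (s / 2) powr (real DIM('a) / enn2real p)"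
  define C where "C = (N * Lp_sum_const p (card \<B>) + 1) / \<kappa>"
  have \<eta>: "0 < \<eta>" using s m by (simp add: \<eta>_def)
  have N: "0 \<le> N" using newton_const_ge_1[OF m, of "2 / \<eta>"] \<eta> by (simp add: N_def)
  have \<kappa>: "0 < \<kappa>" using s by (simp add: \<kappa>_def)
  have "0 < N * Lp_sum_const p (card \<B>) + 1"
    using N Lp_sum_const_nonneg[of p "card \<B>"] by (simp add: add_nonneg_pos)
  then have "0 < C" using \<kappa> by (simp add: C_def)
  moreover have "\<bar>Q x\<bar> * Lp_vol p (cube \<phi> 1) \<le> C * b"
    if db: "dual_basis e \<phi>" and \<rho>: "\<And>i. \<rho> i \<le> m" and Q: "Q \<in> mpolys e \<rho>"
      and b: "Lp_le p (cube \<phi> s) Q b" and x: "x \<in> cube \<phi> 1"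
    for e :: "'i \<Rightarrow> 'a" and \<phi> \<rho> Q b x
  proof -
    define v where "v \<beta> = (\<Sum>i\<in>UNIV. real (\<beta> i) *\<^sub>R \<eta> *\<^sub>R e i)" for \<beta> :: "'i \<Rightarrow> nat"
    have \<phi>v: "\<phi> i (v \<beta>) = real (\<beta> i) * \<eta>" for i \<beta>
      using dual_basis_combination[OF db, where i=i and J=UNIV and t="\<lambda>i. real (\<beta> i) * \<eta>"] by (simp add: v_def)
    let ?A = "cube \<phi> (s / 2)"
    have A: "?A \<in> lmeasurable" by (rule lmeasurable_pbox[OF db])
    have "Lp_le p ?A (\<lambda>z. \<bar>Q (z + v \<beta>)\<bar>) b" if "\<beta> \<in> \<B>" for \<beta>
    proof -
      have L: "Lp_le p ?A (\<lambda>z. Q (z + v \<beta>)) b"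
      proof (rule Lp_le_shift[OF p b fmeasurableD[OF A]])
        fix z assume z: "z \<in> ?A"
        have "\<bar>\<phi> i (z + v \<beta>)\<bar> \<le> s" for i
        proof -
          have "real (\<beta> i) * \<eta> \<le> real m * \<eta>"
            using that \<eta> by (intro mult_right_mono) (auto simp: \<B>_def PiE_def Pi_def less_imp_le)
          also have "\<dots> = s / 2" using m by (simp add: \<eta>_def)
          finally have "\<bar>real (\<beta> i) * \<eta>\<bar> \<le> s / 2" using \<eta> by simp
          moreover have "\<bar>\<phi> i z\<bar> \<le> s / 2" using z by (simp add: pbox_def)
          ultimately show ?thesis unfolding dual_basis_simps[OF db] \<phi>v by linarith
        qed
        then show "z + v \<beta> \<in> cube \<phi> s" by (simp add: pbox_def)
      qed
      show ?thesis by (rule Lp_le_mono[OF p L]) (use Lp_leD[OF L] in auto)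
    qed
    then have "Lp_le p ?A (\<lambda>z. \<Sum>\<beta>\<in>\<B>. \<bar>Q (z + v \<beta>)\<bar>) (Lp_sum_const p (card \<B>) * b)"
      by (rule Lp_le_sum[OF p fin fmeasurableD[OF A]])
    from Lp_le_cmult[OF p this, of N]
    have *: "Lp_le p ?A (\<lambda>z. N * (\<Sum>\<beta>\<in>\<B>. \<bar>Q (z + v \<beta>)\<bar>)) (N * (Lp_sum_const p (card \<B>) * b))"
      using N by simp
    have le: "\<bar>Q x\<bar> \<le> N * (\<Sum>\<beta>\<in>\<B>. \<bar>Q (z + v \<beta>)\<bar>)" if z: "z \<in> ?A" for z
    proof -
      define t where "t i = (\<phi> i x - \<phi> i z) / \<eta>" for i
      have "(\<Sum>i\<in>UNIV. t i *\<^sub>R \<eta> *\<^sub>R e i) = (\<Sum>i\<in>UNIV. \<phi> i (x - z) *\<^sub>R e i)"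
        using \<eta> by (intro sum.cong) (auto simp: t_def dual_basis_simps[OF db])
      then have xz: "x = z + (\<Sum>i\<in>UNIV. t i *\<^sub>R \<eta> *\<^sub>R e i)"
        by (simp add: dual_basis_sum[OF db])
      have t: "\<bar>t i\<bar> \<le> 2 / \<eta>" for i
      proof -
        have "\<bar>\<phi> i x\<bar> \<le> 1" "\<bar>\<phi> i z\<bar> \<le> 1" using x z s by (auto simp: pbox_def intro: order_trans[of _ "s/2"])
        then have "\<bar>\<phi> i x - \<phi> i z\<bar> \<le> 2" by linarith
        then show ?thesis using \<eta> by (simp add: t_def abs_divide divide_right_mono)
      qed
      have "\<bar>Q x\<bar> \<le> newton_const m (2 / \<eta>) ^ card (UNIV :: 'i set) * (\<Sum>\<beta>\<in>\<B>. \<bar>Q (z + v \<beta>)\<bar>)"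
        unfolding xz
      proof (rule mpolys_grid_bound[OF Q \<rho> t])
        fix \<beta> :: "'i \<Rightarrow> nat" assume "\<And>i. \<beta> i < m"
        then have "\<beta> \<in> \<B>" by (simp add: \<B>_def PiE_UNIV_domain Pi_def)
        then show "\<bar>Q (z + (\<Sum>i\<in>UNIV. real (\<beta> i) *\<^sub>R \<eta> *\<^sub>R e i))\<bar> \<le> (\<Sum>\<beta>\<in>\<B>. \<bar>Q (z + v \<beta>)\<bar>)"
          unfolding v_def[symmetric] using fin by (intro member_le_sum) auto
      qed
      then show ?thesis by (simp add: N_def)
    qed
    have pos: "0 < measure lebesgue ?A" using s by (intro measure_pbox_pos[OF db]) simp
    have "Lp_le p ?A (\<lambda>_. Q x) (N * (Lp_sum_const p (card \<B>) * b))"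
      by (rule Lp_le_mono[OF p *]) (use le A in \<open>auto intro: fmeasurableD order_trans[OF _ abs_ge_self]\<close>)
    then have "\<bar>Q x\<bar> * Lp_vol p ?A \<le> N * (Lp_sum_const p (card \<B>) * b)"
      by (rule Lp_le_constD[OF p A pos])
    also have "\<dots> \<le> (N * Lp_sum_const p (card \<B>) + 1) * b"
      using Lp_leD(3)[OF b] by (simp add: algebra_simps)
    also have "Lp_vol p ?A = \<kappa> * Lp_vol p (cube \<phi> 1)"
      using Lp_vol_pbox_scale[OF db, of "s / 2" p "\<lambda>_. 1"] s by (simp add: \<kappa>_def)
    finally show ?thesis using \<kappa> by (simp add: C_def field_simps)
  qed
  ultimately show ?thesis by (rule that)
qed

text \<open>In Newton's formula at x the term k = 0 is Q x, and every other coefficient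
  \<open>t gchoose k\<close> contains the factor t, which is proportional to h. The differences use
  nodes inside the cube even when the shifted point lies outside.\<close>

lemma mpolys_lipschitz:
  assumes m: "0 < m"
  obtains C where "0 < C"
    "\<And>(e :: 'i::finite \<Rightarrow> 'a::euclidean_space) \<phi> \<rho> Q M i x h. \<lbrakk>dual_basis e \<phi>; \<And>i. \<rho> i \<le> m; Q \<in> mpolys e \<rho>;
      \<And>y. y \<in> cube \<phi> 1 \<Longrightarrow> \<bar>Q y\<bar> \<le> M; x \<in> cube \<phi> 1; \<bar>h\<bar> \<le> 1\<rbrakk>
      \<Longrightarrow> \<bar>Q (x + h *\<^sub>R e i) - Q x\<bar> \<le> C * \<bar>h\<bar> * M"
proof -
  define c where "c = real m * (\<Sum>k<m. (real m + 1 + real m) ^ (k - 1) * 2 ^ k)"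
  have "0 < c" using m by (auto simp: c_def intro!: sum_pos mult_pos_pos)
  moreover have "\<bar>Q (x + h *\<^sub>R e i) - Q x\<bar> \<le> c * \<bar>h\<bar> * M"
    if db: "dual_basis e \<phi>" and \<rho>: "\<And>i. \<rho> i \<le> m" and Q: "Q \<in> mpolys e \<rho>"
      and M: "\<And>y. y \<in> cube \<phi> 1 \<Longrightarrow> \<bar>Q y\<bar> \<le> M" and x: "x \<in> cube \<phi> 1" and h: "\<bar>h\<bar> \<le> 1"
    for e :: "'i \<Rightarrow> 'a" and \<phi> \<rho> Q M i x h
  proof -
    \<comment> \<open>The nodes run from x towards the plane where \<phi> i vanishes, so that m
      steps of length 1/m do not leave the cube.\<close>
    define \<eta> where "\<eta> = (if \<phi> i x \<le> 0 then 1 / real m else - (1 / real m))"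
    define t where "t = h / \<eta>"
    have \<eta>: "\<eta> \<noteq> 0" "\<bar>\<eta>\<bar> = 1 / real m" using m by (auto simp: \<eta>_def)
    have t: "t * \<eta> = h" "\<bar>t\<bar> = \<bar>h\<bar> * real m" using \<eta> by (auto simp: t_def abs_divide)
    have node: "\<bar>Q (x + real j *\<^sub>R \<eta> *\<^sub>R e i)\<bar> \<le> M" if "j \<le> m" for j
    proof (rule M)
      have "\<bar>\<phi> l (x + real j *\<^sub>R \<eta> *\<^sub>R e i)\<bar> \<le> 1" for l
      proof (cases "l = i")
        case True
        define a where "a = real j / real m"
        have a: "0 \<le> a" "a \<le> 1" and \<phi>x: "\<bar>\<phi> i x\<bar> \<le> 1"
          using that m x by (auto simp: pbox_def a_def)
        have "\<phi> l (x + real j *\<^sub>R \<eta> *\<^sub>R e i) = (if \<phi> i x \<le> 0 then \<phi> i x + a else \<phi> i x - a)"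
          using True by (simp add: dual_basis_simps[OF db] dual_basis_apply[OF db] \<eta>_def a_def)
        then show ?thesis using a \<phi>x by (auto split: if_splits)
      next
        case False
        then show ?thesis using x by (auto simp: dual_basis_simps[OF db] dual_basis_apply[OF db] pbox_def)
      qed
      then show "x + real j *\<^sub>R \<eta> *\<^sub>R e i \<in> cube \<phi> 1" by (simp add: pbox_def)
    qed
    then have M0: "0 \<le> M" using abs_ge_zero order_trans by blast
    have term_le: "\<bar>(t gchoose k) * fin_diff k (\<eta> *\<^sub>R e i) Q x\<bar> \<le> \<bar>t\<bar> * ((real m + 1 + real m) ^ (k - 1) * 2 ^ k) * M"
      if k: "k \<in> {..<m} - {0}" for k
    proof -
      \<comment> \<open>Absorption extracts the factor t: \<open>t gchoose k\<close> is t / k times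
        \<open>(t - 1) gchoose (k - 1)\<close>.\<close>
      have "\<bar>t gchoose k\<bar> = \<bar>t\<bar> / real k * \<bar>(t - 1) gchoose (k - 1)\<bar>"
        using gbinomial_absorption'[of k t] k by (simp add: abs_mult)
      also have "\<dots> \<le> \<bar>t\<bar> * (real m + 1 + real m) ^ (k - 1)"
      proof (intro mult_mono)
        show "\<bar>t\<bar> / real k \<le> \<bar>t\<bar>" using k by (simp add: divide_le_eq mult_le_cancel_left1)
        have "\<bar>h\<bar> * real m \<le> 1 * real m" using h by (intro mult_right_mono) auto
        then have "\<bar>t - 1\<bar> \<le> real m + 1" using t(2) by linarith
        then show "\<bar>(t - 1) gchoose (k - 1)\<bar> \<le> (real m + 1 + real m) ^ (k - 1)"
          using k by (intro abs_gbinomial_le) auto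
      qed auto
      finally have 1: "\<bar>t gchoose k\<bar> \<le> \<bar>t\<bar> * (real m + 1 + real m) ^ (k - 1)" .
      have 2: "\<bar>fin_diff k (\<eta> *\<^sub>R e i) Q x\<bar> \<le> 2 ^ k * M"
        using k by (intro abs_fin_diff_le node) auto
      show ?thesis
        using mult_mono[OF 1 2] by (simp add: abs_mult mult_ac)
    qed
    have "Q (x + t *\<^sub>R \<eta> *\<^sub>R e i) = (\<Sum>k<m. (t gchoose k) * fin_diff k (\<eta> *\<^sub>R e i) Q x)"
      by (rule newton_forward[OF poly_fun_mono[OF mpolys_poly_fun[OF Q] \<rho>]])
    also have "\<dots> = Q x + (\<Sum>k\<in>{..<m} - {0}. (t gchoose k) * fin_diff k (\<eta> *\<^sub>R e i) Q x)"
      using m by (subst sum.remove[of _ 0]) (auto simp: fin_diff_0)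
    finally have "\<bar>Q (x + h *\<^sub>R e i) - Q x\<bar> = \<bar>\<Sum>k\<in>{..<m} - {0}. (t gchoose k) * fin_diff k (\<eta> *\<^sub>R e i) Q x\<bar>"
      using t(1) by simp
    also have "\<dots> \<le> (\<Sum>k\<in>{..<m} - {0}. \<bar>t\<bar> * ((real m + 1 + real m) ^ (k - 1) * 2 ^ k) * M)"
      by (rule order_trans[OF sum_abs sum_mono[OF term_le]])
    also have "\<dots> \<le> (\<Sum>k<m. \<bar>t\<bar> * ((real m + 1 + real m) ^ (k - 1) * 2 ^ k) * M)"
      using M0 by (intro sum_mono2) auto
    also have "\<dots> = c * \<bar>h\<bar> * M"
      by (simp add: c_def t(2) sum_distrib_left sum_distrib_right mult_ac)
    finally show ?thesis .
  qed
  ultimately show ?thesis by (rule that)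
qed

text \<open>Expand P along direction i by Newton's formula from the point where \<phi> i vanishes.
  Replacing each \<open>gchoose k\<close> by \<open>gchoose Suc k\<close> gives a primitive for the
  step h, by Pascal's rule, and raises the degree in direction i by one. The binomial factors depend
  on \<phi> i alone, so the other degrees are kept.\<close>

lemma mpolys_difference_primitive:
  fixes e :: "'i::finite \<Rightarrow> 'a::euclidean_space"
  assumes db: "dual_basis e \<phi>" and \<rho>: "\<And>i. 0 < \<rho> i" and P: "P \<in> mpolys e (\<rho>(i := \<rho> i - 1))" and h: "h \<noteq> 0"
  obtains q where "q \<in> mpolys e \<rho>" "\<And>x. q (x + h *\<^sub>R e i) - q x = P x"
proof -
  define n where "n = \<rho> i - 1"
  define c where "c k x = fin_diff k (h *\<^sub>R e i) P (x - \<phi> i x *\<^sub>R e i)" for k x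
  define q where "q x = (\<Sum>k<n. ((\<phi> i x / h) gchoose (Suc k)) * c k x)" for x
  have c_i: "c k (x + t *\<^sub>R e i) = c k x" for k x t
    by (simp add: c_def dual_basis_simps[OF db] dual_basis_apply[OF db] algebra_simps)
  have \<phi>_i: "\<phi> i (x + t *\<^sub>R e i) / h = \<phi> i x / h + 1 / h * t" for x t
    by (simp add: dual_basis_simps[OF db] dual_basis_apply[OF db] add_divide_distrib)
  have "q (x + h *\<^sub>R e i) - q x = P x" for x
  proof -
    have "q (x + h *\<^sub>R e i) - q x = (\<Sum>k<n. ((\<phi> i x / h + 1 gchoose Suc k) - (\<phi> i x / h gchoose Suc k)) * c k x)"
      using h unfolding q_def c_i \<phi>_i by (simp add: sum_subtractf algebra_simps)
    also have "\<dots> = (\<Sum>k<n. (\<phi> i x / h gchoose k) * c k x)"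
      by (simp add: gbinomial_Suc_Suc)
    also have "\<dots> = P (x - \<phi> i x *\<^sub>R e i + (\<phi> i x / h) *\<^sub>R h *\<^sub>R e i)"
      unfolding c_def
      by (rule newton_forward[symmetric]) (use mpolys_poly_fun[OF P, of i] in \<open>simp add: n_def\<close>)
    also have "\<dots> = P x" using h by simp
    finally show ?thesis .
  qed
  moreover have "q \<in> mpolys e \<rho>"
    unfolding mpolys_def
  proof (intro CollectI conjI allI)
    have lin: "linear (\<lambda>x. x - \<phi> i x *\<^sub>R e i)"
      by (rule linearI) (simp_all add: dual_basis_simps[OF db] algebra_simps)
    have "real_polynomial_function (\<lambda>x. P ((x - \<phi> i x *\<^sub>R e i) + w))" for w
      using P by (intro real_polynomial_function_affine[OF _ lin]) (simp add: mpolys_def)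
    then have c_poly: "real_polynomial_function (c k)" for k
      unfolding c_def[abs_def] fin_diff_def by (intro real_polynomial_function_sum real_polynomial_function.intros(4) real_polynomial_function.intros(2)) auto
    have "bounded_linear (\<phi> i)"
      by (rule linear_conv_bounded_linear[THEN iffD1, OF dual_basis_linear[OF db]])
    then have g_poly: "real_polynomial_function (\<lambda>x. (\<phi> i x / h) gchoose (Suc k))" for k
      unfolding gbinomial_prod_rev
      by (intro real_polynomial_function_divide real_polynomial_function_prod real_polynomial_function_diff
          real_polynomial_function.intros(1) real_polynomial_function.intros(2)) auto
    show "real_polynomial_function q"
      unfolding q_def[abs_def]
      by (intro real_polynomial_function_sum real_polynomial_function.intros(4) g_poly c_poly) auto
    fix x j
    show "poly_fun (\<rho> j) (\<lambda>t. q (x + t *\<^sub>R e j))"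
    proof (cases "j = i")
      case True
      have "poly_fun (\<rho> i) (\<lambda>t. c k x * (\<phi> i x / h + 1 / h * t gchoose Suc k))" if "k < n" for k
        by (intro poly_fun_cmult poly_fun_affine[of _ "\<lambda>t. t gchoose Suc k"] poly_fun_mono[OF poly_fun_gbinomial])
          (use that in \<open>simp add: n_def\<close>)
      then have "poly_fun (\<rho> i) (\<lambda>t. \<Sum>k<n. c k x * (\<phi> i x / h + 1 / h * t gchoose Suc k))"
        by (intro poly_fun_sum \<rho>) auto
      then show ?thesis unfolding True q_def c_i \<phi>_i by (simp add: mult.commute)
    next
      case False
      have eq: "x + t *\<^sub>R e j - \<phi> i (x + t *\<^sub>R e j) *\<^sub>R e i + w = (x - \<phi> i x *\<^sub>R e i + w) + t *\<^sub>R e j" for t w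
        using False by (simp add: dual_basis_simps[OF db] dual_basis_apply[OF db])
      have "poly_fun (\<rho> j) (\<lambda>t. P (y + t *\<^sub>R e j))" for y
        using mpolys_poly_fun[OF P, of j y] False by simp
      then have c_j: "poly_fun (\<rho> j) (\<lambda>t. c k (x + t *\<^sub>R e j))" for k
        unfolding c_def fin_diff_def eq by (intro poly_fun_sum \<rho> poly_fun_cmult)
      have "\<phi> i (x + t *\<^sub>R e j) = \<phi> i x" for t
        using False by (simp add: dual_basis_simps[OF db] dual_basis_apply[OF db])
      then show ?thesis
        unfolding q_def by (simp, intro poly_fun_sum \<rho> poly_fun_cmult c_j)
    qed
  qed
  ultimately show ?thesis using that by blast
qed

section \<open>Whitney's inequality on a small box\<close>

text \<open>6 \<kappa> is the fixed point of the map in the second assumption; the iterates of M0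
  converge to it geometrically with ratio 3/4.\<close>

lemma contraction_bound:
  fixes P :: "real \<Rightarrow> bool"
  assumes "P M0" "\<And>M. P M \<Longrightarrow> P (3 / 4 * M + 3 / 2 * \<kappa>)" "\<And>M. P M \<Longrightarrow> y \<le> M"
  shows "y \<le> 6 * \<kappa>"
proof -
  have "P (6 * \<kappa> + (3 / 4) ^ n * (M0 - 6 * \<kappa>))" for n
  proof (induction n)
    case (Suc n)
    have "3 / 4 * (6 * \<kappa> + (3 / 4) ^ n * (M0 - 6 * \<kappa>)) + 3 / 2 * \<kappa> = 6 * \<kappa> + (3 / 4) ^ Suc n * (M0 - 6 * \<kappa>)"
      by (simp add: field_simps)
    with assms(2)[OF Suc] show ?case by simp
  qed (use assms(1) in simp)
  then have "y \<le> 6 * \<kappa> + (3 / 4) ^ n * (M0 - 6 * \<kappa>)" for n by (rule assms(3))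
  moreover have "(\<lambda>n. 6 * \<kappa> + (3 / 4) ^ n * (M0 - 6 * \<kappa>)) \<longlonglongrightarrow> 6 * \<kappa> + 0 * (M0 - 6 * \<kappa>)"
    by (intro tendsto_intros LIMSEQ_realpow_zero) auto
  ultimately have "y \<le> 6 * \<kappa> + 0 * (M0 - 6 * \<kappa>)" by (intro LIMSEQ_le_const) auto
  then show ?thesis by simp
qed

text \<open>If the first differences of \<open>f\<close> with step \<open>h\<close> are close to polynomials \<open>P h\<close>, then \<open>P\<close> is an
  approximate cocycle, \<open>P (h + k) \<approx> P h + P k \<circ> shift h\<close>. Subtracting from \<open>f\<close> a primitive \<open>q\<close> of \<open>P h\<^sub>0\<close> makes
  \<open>P h\<^sub>0 = 0\<close>; then the cocycle relation for \<open>(h, h)\<close> when \<open>h \<le> h\<^sub>0 / 2\<close>, and for \<open>(h\<^sub>0 - h, h)\<close> otherwise,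
  improves every uniform bound on \<open>P\<close> by the factor \<open>3 / 4\<close>, as in Hyers' stability theorem.\<close>

lemma first_differences_small_after_subtracting_poly:
  assumes p: "0 < p" and m: "0 < m"
  obtains C h0 where "0 < C" "0 < h0" "h0 \<le> 1 / 2"
    "\<And>(e :: 'i::finite \<Rightarrow> 'a::euclidean_space) \<phi> \<rho> i f B \<omega>.
      \<lbrakk>dual_basis e \<phi>; \<And>j. 0 < \<rho> j; \<And>j. \<rho> j \<le> m; f \<in> borel_measurable lebesgue;
        Lp_le p (cube \<phi> 2) f B;
        \<And>h. 0 \<le> h \<Longrightarrow> h \<le> 1 \<Longrightarrow> \<exists>P\<in>mpolys e (\<rho>(i := \<rho> i - 1)).
          Lp_le p (cube \<phi> 1) (\<lambda>x. f (x + h *\<^sub>R e i) - f x - P x) \<omega>\<rbrakk>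
      \<Longrightarrow> \<exists>q\<in>mpolys e \<rho>. \<forall>h. 0 \<le> h \<longrightarrow> h \<le> h0 \<longrightarrow>
          Lp_le p (cube \<phi> 1) (\<lambda>x. (f (x + h *\<^sub>R e i) - q (x + h *\<^sub>R e i)) - (f x - q x)) (C * \<omega>)"
proof -
  obtain S where S: "0 < S"
    "\<And>(e :: 'i \<Rightarrow> 'a) \<phi> \<rho> Q b x. \<lbrakk>dual_basis e \<phi>; \<And>i. \<rho> i \<le> m; Q \<in> mpolys e \<rho>;
      Lp_le p (cube \<phi> (1 / 2)) Q b; x \<in> cube \<phi> 1\<rbrakk> \<Longrightarrow> \<bar>Q x\<bar> * Lp_vol p (cube \<phi> 1) \<le> S * b"
    using mpolys_sup_le_Lp[OF p, of "1 / 2" m, where 'i='i and 'a='a] m by (auto)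
  obtain L where L: "0 < L"
    "\<And>(e :: 'i \<Rightarrow> 'a) \<phi> \<rho> Q M i x h. \<lbrakk>dual_basis e \<phi>; \<And>i. \<rho> i \<le> m; Q \<in> mpolys e \<rho>;
      \<And>y. y \<in> cube \<phi> 1 \<Longrightarrow> \<bar>Q y\<bar> \<le> M; x \<in> cube \<phi> 1; \<bar>h\<bar> \<le> 1\<rbrakk>
      \<Longrightarrow> \<bar>Q (x + h *\<^sub>R e i) - Q x\<bar> \<le> L * \<bar>h\<bar> * M"
    using mpolys_lipschitz[OF m, where 'i='i and 'a='a] by blast
  define K where "K = Lp_triangle p"
  \<comment> \<open>Bounds the cocycle defect of P: f cancels from three estimates of size \<omega>,
    combined by two quasi-triangle inequalities on the half-size cube, and S converts the result
    into a supremum.\<close>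
  define c where "c = S * (K * (K * (1 + 1) + 1))"
  \<comment> \<open>With L h0 <= 1/4 a polynomial bounded by M varies by at most M/4 under shifts up
    to h0, and h0 <= 1/2 keeps shifts of the half-size cube inside
    \<open>cube \<phi> 1\<close>.\<close>
  define h0 where "h0 = min (1 / 2) (1 / (4 * L))"
  have K: "1 \<le> K" unfolding K_def by (rule Lp_triangle_ge_1)
  have c: "0 \<le> c" using S(1) K by (simp add: c_def)
  have h0: "0 < h0" "h0 \<le> 1 / 2" using L(1) by (auto simp: h0_def)
  have Lh0: "L * h0 \<le> 1 / 4"
  proof -
    have "L * h0 \<le> L * (1 / (4 * L))" using L(1) by (intro mult_left_mono) (auto simp: h0_def)
    then show ?thesis using L(1) by simp
  qed
  have main: "\<exists>q\<in>mpolys e \<rho>. \<forall>h. 0 \<le> h \<longrightarrow> h \<le> h0 \<longrightarrow>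
      Lp_le p (cube \<phi> 1) (\<lambda>x. (f (x + h *\<^sub>R e i) - q (x + h *\<^sub>R e i)) - (f x - q x)) (K * (1 + 6 * c) * \<omega>)"
    if db: "dual_basis e \<phi>" and \<rho>0: "\<And>j. 0 < \<rho> j" and \<rho>: "\<And>j. \<rho> j \<le> m" and f: "f \<in> borel_measurable lebesgue"
      and B: "Lp_le p (cube \<phi> 2) f B"
      and ex: "\<And>h. 0 \<le> h \<Longrightarrow> h \<le> 1 \<Longrightarrow> \<exists>P\<in>mpolys e (\<rho>(i := \<rho> i - 1)).
          Lp_le p (cube \<phi> 1) (\<lambda>x. f (x + h *\<^sub>R e i) - f x - P x) \<omega>"
    for e :: "'i \<Rightarrow> 'a" and \<phi> \<rho> i f B \<omega>
  proof -
    let ?B = "\<lambda>s. cube \<phi> s"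
    define V where "V = Lp_vol p (?B 1)"
    have V: "0 < V" unfolding V_def by (rule Lp_vol_pos[OF p measure_pbox_pos[OF db]]) simp
    have sets: "?B s \<in> sets lebesgue" for s by (rule sets_lebesgue_pbox[OF db])
    note shift = cube_shift[OF db]
    have "\<exists>P. \<forall>h. 0 \<le> h \<and> h \<le> 1 \<longrightarrow> P h \<in> mpolys e (\<rho>(i := \<rho> i - 1)) \<and>
        Lp_le p (?B 1) (\<lambda>x. f (x + h *\<^sub>R e i) - f x - P h x) \<omega>"
      by (intro choice allI) (use ex in blast)
    then obtain P where P: "\<And>h. 0 \<le> h \<Longrightarrow> h \<le> 1 \<Longrightarrow> P h \<in> mpolys e (\<rho>(i := \<rho> i - 1))"
      and P_le: "\<And>h. 0 \<le> h \<Longrightarrow> h \<le> 1 \<Longrightarrow> Lp_le p (?B 1) (\<lambda>x. f (x + h *\<^sub>R e i) - f x - P h x) \<omega>"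
      by blast
    have P\<rho>: "P h \<in> mpolys e \<rho>" if "0 \<le> h" "h \<le> 1" for h
      using P[OF that] by (rule mpolys_mono) simp
    have \<omega>: "0 \<le> \<omega>" using Lp_leD(3)[OF P_le[of 0]] by simp
    obtain q where q: "q \<in> mpolys e \<rho>" "\<And>x. q (x + h0 *\<^sub>R e i) - q x = P h0 x"
    proof (rule mpolys_difference_primitive[OF db \<rho>0 P[of h0]])
      show "0 \<le> h0" "h0 \<le> 1" "h0 \<noteq> 0" using h0 by auto
    qed (rule that)
    define R where "R h x = P h x - (q (x + h *\<^sub>R e i) - q x)" for h x
    have R: "R h \<in> mpolys e \<rho>" if "0 \<le> h" "h \<le> 1" for h
      unfolding R_def[abs_def] by (intro mpolys_diff mpolys_shift P\<rho> q that)
    have R_h0: "R h0 x = 0" for x by (simp add: R_def q(2))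
    define \<kappa> where "\<kappa> = c * \<omega> / V"
    have \<kappa>: "0 \<le> \<kappa>" using c \<omega> V by (simp add: \<kappa>_def)
    have cocycle: "\<bar>R (h + k) x - R h x - R k (x + h *\<^sub>R e i)\<bar> \<le> \<kappa>"
      if hk: "0 \<le> h" "0 \<le> k" "h + k \<le> h0" and x: "x \<in> ?B 1" for h k x
    proof -
      have le1: "h \<le> 1 / 2" "k \<le> 1" "h + k \<le> 1" "0 \<le> h + k" "h \<le> 1" using hk h0 by auto
      define Q where "Q y = P (h + k) y - P h y - P k (y + h *\<^sub>R e i)" for y
      have "Lp_le p (?B (1 / 2)) (\<lambda>y. f ((y + h *\<^sub>R e i) + k *\<^sub>R e i) - f (y + h *\<^sub>R e i) - P k (y + h *\<^sub>R e i)) \<omega>"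
        using le1 hk by (intro Lp_le_shift[OF p P_le sets] shift) auto
      moreover have "Lp_le p (?B (1 / 2)) (\<lambda>y. f (y + h' *\<^sub>R e i) - f y - P h' y) \<omega>" if "0 \<le> h'" "h' \<le> 1" for h'
        by (rule Lp_le_subset[OF p P_le[OF that] sets pbox_mono]) simp
      ultimately have "Lp_le p (?B (1 / 2)) (\<lambda>y. ((f ((y + h *\<^sub>R e i) + k *\<^sub>R e i) - f (y + h *\<^sub>R e i) - P k (y + h *\<^sub>R e i))
            + (f (y + h *\<^sub>R e i) - f y - P h y)) - (f (y + (h + k) *\<^sub>R e i) - f y - P (h + k) y))
          (K * (K * (\<omega> + \<omega>) + \<omega>))"
        unfolding K_def using le1 hk by (intro Lp_le_add[OF p] Lp_le_diff[OF p]) auto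
      also have "(\<lambda>y. ((f ((y + h *\<^sub>R e i) + k *\<^sub>R e i) - f (y + h *\<^sub>R e i) - P k (y + h *\<^sub>R e i))
            + (f (y + h *\<^sub>R e i) - f y - P h y)) - (f (y + (h + k) *\<^sub>R e i) - f y - P (h + k) y)) = Q"
        by (simp add: Q_def fun_eq_iff algebra_simps)
      finally have "Lp_le p (?B (1 / 2)) Q (K * (K * (\<omega> + \<omega>) + \<omega>))" .
      moreover have "Q \<in> mpolys e \<rho>"
        unfolding Q_def[abs_def] using le1 hk by (intro mpolys_diff mpolys_shift P\<rho>) auto
      ultimately have "\<bar>Q x\<bar> * V \<le> S * (K * (K * (\<omega> + \<omega>) + \<omega>))"
        unfolding V_def by (intro S(2)[where \<rho>=\<rho>, OF db \<rho>] x)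
      also have "\<dots> = \<kappa> * V" using V by (simp add: \<kappa>_def c_def field_simps)
      finally have "\<bar>Q x\<bar> \<le> \<kappa>" using V by simp
      moreover have "R (h + k) x - R h x - R k (x + h *\<^sub>R e i) = Q x"
        by (simp add: R_def Q_def algebra_simps)
      ultimately show ?thesis by simp
    qed
    define bnd where "bnd M \<longleftrightarrow> (\<forall>h x. 0 \<le> h \<longrightarrow> h \<le> h0 \<longrightarrow> x \<in> ?B 1 \<longrightarrow> \<bar>R h x\<bar> \<le> M)" for M
    \<comment> \<open>A finite starting value for the contraction. It may be arbitrarily large and
      depend on B and q, because the limit 6 \<kappa> does not.\<close>
    have ex_bnd: "\<exists>M. bnd M"
    proof -
      obtain Mq where Mq: "\<And>x. x \<in> ?B 2 \<Longrightarrow> \<bar>q x\<bar> \<le> Mq"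
        using mpolys_bounded_on_pbox[OF db q(1)] by blast
      have "\<bar>R h x\<bar> \<le> S * (K * (K * (B + B) + \<omega>)) / V + 2 * Mq" if h: "0 \<le> h" "h \<le> h0" and x: "x \<in> ?B 1" for h x
      proof -
        have "Lp_le p (?B (1 / 2)) (\<lambda>y. f (y + h *\<^sub>R e i)) B"
          using h h0 by (intro Lp_le_shift[OF p B sets] shift) auto
        moreover have "Lp_le p (?B (1 / 2)) f B"
          by (rule Lp_le_subset[OF p B sets pbox_mono]) simp
        moreover have "Lp_le p (?B (1 / 2)) (\<lambda>y. f (y + h *\<^sub>R e i) - f y - P h y) \<omega>"
          using h h0 by (intro Lp_le_subset[OF p P_le sets pbox_mono]) auto
        ultimately have "Lp_le p (?B (1 / 2)) (\<lambda>y. (f (y + h *\<^sub>R e i) - f y) - (f (y + h *\<^sub>R e i) - f y - P h y)) (K * (K * (B + B) + \<omega>))"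
          unfolding K_def by (intro Lp_le_diff[OF p])
        then have "Lp_le p (?B (1 / 2)) (P h) (K * (K * (B + B) + \<omega>))" by simp
        moreover have "P h \<in> mpolys e \<rho>" using h h0 by (intro P\<rho>) auto
        ultimately have "\<bar>P h x\<bar> * V \<le> S * (K * (K * (B + B) + \<omega>))"
          unfolding V_def by (intro S(2)[where \<rho>=\<rho>, OF db \<rho>] x)
        then have "\<bar>P h x\<bar> \<le> S * (K * (K * (B + B) + \<omega>)) / V" using V by (simp add: le_divide_eq)
        moreover have "\<bar>q x\<bar> \<le> Mq" "\<bar>q (x + h *\<^sub>R e i)\<bar> \<le> Mq"
          using x h h0 shift[OF x, of 0 2] shift[OF x, of h 2] by (auto intro!: Mq)
        ultimately show ?thesis by (simp add: R_def)
      qed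
      then show ?thesis unfolding bnd_def by blast
    qed
    have improve: "bnd (3 / 4 * M + 3 / 2 * \<kappa>)" if M: "bnd M" for M
    proof -
      have "0 \<in> ?B 1" by (simp add: pbox_def dual_basis_simps[OF db])
      then have "\<bar>R 0 0\<bar> \<le> M" using M h0 unfolding bnd_def by simp
      then have M0: "0 \<le> M" by linarith
      have lip: "\<bar>R h (x + k *\<^sub>R e i) - R h x\<bar> \<le> M / 4" "\<bar>R h (x + k *\<^sub>R e i) - R h x\<bar> \<le> L * k * M"
        if hk: "0 \<le> h" "h \<le> h0" "0 \<le> k" "k \<le> h0" and x: "x \<in> ?B 1" for h k x
      proof -
        have "\<bar>R h (x + k *\<^sub>R e i) - R h x\<bar> \<le> L * \<bar>k\<bar> * M"
          by (rule L(2)[where \<rho>=\<rho>, OF db \<rho> R]) (use hk h0 x M in \<open>auto simp: bnd_def\<close>)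
        then show 1: "\<bar>R h (x + k *\<^sub>R e i) - R h x\<bar> \<le> L * k * M" using hk by simp
        have "L * k \<le> L * h0" using L(1) hk by (intro mult_left_mono) auto
        then have "L * k * M \<le> 1 / 4 * M" using Lh0 M0 by (intro mult_right_mono) auto
        with 1 show "\<bar>R h (x + k *\<^sub>R e i) - R h x\<bar> \<le> M / 4" by simp
      qed
      \<comment> \<open>The pair (h, h) gives 2 R h = R (2 h) up to \<kappa> and the shift error
        M/4, so 2 |R h| <= M + M/4 + \<kappa>.\<close>
      have small: "\<bar>R h x\<bar> \<le> 5 / 8 * M + 1 / 2 * \<kappa>" if h: "0 \<le> h" "h \<le> h0 / 2" and x: "x \<in> ?B 1" for h x
      proof -
        have "\<bar>R (h + h) x - R h x - R h (x + h *\<^sub>R e i)\<bar> \<le> \<kappa>"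
          using h x by (intro cocycle) auto
        moreover have "\<bar>R h (x + h *\<^sub>R e i) - R h x\<bar> \<le> M / 4" using h h0 x by (intro lip) auto
        moreover have "\<bar>R (h + h) x\<bar> \<le> M" using M h x unfolding bnd_def by auto
        ultimately show ?thesis by linarith
      qed
      have "\<bar>R h x\<bar> \<le> 3 / 4 * M + 3 / 2 * \<kappa>" if h: "0 \<le> h" "h \<le> h0" and x: "x \<in> ?B 1" for h x
      proof (cases "h \<le> h0 / 2")
        case True
        then show ?thesis using small[OF h(1) True x] M0 \<kappa> by linarith
      next
        case False
        \<comment> \<open>Since R h0 = 0, the pair (h0 - h, h) expresses R h at a shifted point by R
          (h0 - h), and h0 - h < h0 / 2. The bound collects 5/8 M + \<kappa>/2 from
          \<open>small\<close>, \<kappa> from the cocycle relation and M/8 from the shift.\<close>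
        have "\<bar>R (h0 - h + h) x - R (h0 - h) x - R h (x + (h0 - h) *\<^sub>R e i)\<bar> \<le> \<kappa>"
          using h x by (intro cocycle) auto
        moreover have "\<bar>R (h0 - h) x\<bar> \<le> 5 / 8 * M + 1 / 2 * \<kappa>"
          using False h x by (intro small) auto
        moreover have "\<bar>R h (x + (h0 - h) *\<^sub>R e i) - R h x\<bar> \<le> M / 8"
        proof -
          have "\<bar>R h (x + (h0 - h) *\<^sub>R e i) - R h x\<bar> \<le> L * (h0 - h) * M"
            using h x by (intro lip(2)) auto
          also have "\<dots> \<le> 1 / 8 * M"
          proof (intro mult_right_mono M0)
            have "L * (h0 - h) \<le> L * (h0 / 2)" using L(1) False by (intro mult_left_mono) auto
            then show "L * (h0 - h) \<le> 1 / 8" using Lh0 by simp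
          qed
          finally show ?thesis by simp
        qed
        ultimately show ?thesis using R_h0[of x] unfolding abs_le_iff by simp
      qed
      then show ?thesis unfolding bnd_def by blast
    qed
    have R_le: "\<bar>R h x\<bar> \<le> 6 * \<kappa>" if "0 \<le> h" "h \<le> h0" "x \<in> ?B 1" for h x
    proof -
      obtain M where "bnd M" using ex_bnd by blast
      then show ?thesis
        by (rule contraction_bound[of bnd]) (use improve that in \<open>auto simp: bnd_def\<close>)
    qed
    have "Lp_le p (?B 1) (\<lambda>x. (f (x + h *\<^sub>R e i) - q (x + h *\<^sub>R e i)) - (f x - q x)) (K * (1 + 6 * c) * \<omega>)"
      if h: "0 \<le> h" "h \<le> h0" for h
    proof -
      have h1: "h \<le> 1" using h h0 by simp
      have "Lp_le p (?B 1) (R h) (\<bar>6 * \<kappa>\<bar> * V)"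
        unfolding V_def using R_le h
        by (intro Lp_le_bounded[OF p lmeasurable_pbox[OF db] mpolys_measurable[OF R[OF h(1) h1]]]) auto
      then have "Lp_le p (?B 1) (R h) (6 * c * \<omega>)"
        using V mult_nonneg_nonneg[OF c \<omega>] by (simp add: \<kappa>_def mult.assoc)
      from Lp_le_add[OF p P_le[OF h(1) h1] this]
      have "Lp_le p (?B 1) (\<lambda>x. (f (x + h *\<^sub>R e i) - f x - P h x) + R h x) (K * (\<omega> + 6 * c * \<omega>))"
        by (simp add: K_def)
      moreover have "(\<lambda>x. (f (x + h *\<^sub>R e i) - f x - P h x) + R h x) =
          (\<lambda>x. (f (x + h *\<^sub>R e i) - q (x + h *\<^sub>R e i)) - (f x - q x))"
        by (simp add: R_def fun_eq_iff)
      moreover have "K * (\<omega> + 6 * c * \<omega>) = K * (1 + 6 * c) * \<omega>" by (simp add: algebra_simps)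
      ultimately show ?thesis by metis
    qed
    then show ?thesis using q(1) by blast
  qed
  have "0 < K * (1 + 6 * c)" using K c by (intro mult_pos_pos) auto
  from this h0 main show ?thesis by (rule that)
qed

text \<open>The differences are bounded on the whole unit cube, so f also enters at points outside
  it; in return no condition on the position of nodes has to be carried through the induction. On an
  actual parallelepiped the cube is shrunk until all nodes lie inside. B is a qualitative bound: C
  is fixed before it.\<close>

definition whitney_small :: "ennreal \<Rightarrow> 'a::euclidean_space itself \<Rightarrow> ('i::finite \<Rightarrow> nat) \<Rightarrow> real \<Rightarrow> real \<Rightarrow> bool" where
  "whitney_small p T \<rho> C s \<longleftrightarrow> (\<forall>(e :: 'i \<Rightarrow> 'a) \<phi> f B \<omega>.
    dual_basis e \<phi> \<longrightarrow> f \<in> borel_measurable lebesgue \<longrightarrow> Lp_le p (cube \<phi> 1) f B \<longrightarrow>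
    (\<forall>i u. \<bar>u\<bar> \<le> 1 \<longrightarrow> Lp_le p (cube \<phi> 1) (fin_diff (\<rho> i) (u *\<^sub>R e i) f) \<omega>) \<longrightarrow>
    (\<exists>Q\<in>mpolys e \<rho>. Lp_le p (cube \<phi> s) (\<lambda>x. f x - Q x) (C * \<omega>)))"

lemmas whitney_smallD = whitney_small_def[THEN iffD1, rule_format]

text \<open>Induction on \<open>\<Sum>i. \<rho> i\<close>: the hypothesis for degree \<open>\<rho> i - 1\<close> applies to the first differences of \<open>f\<close>
  along \<open>e i\<close>, by Kemperman's identity, and then the one for degree \<open>1\<close> applies to \<open>f - q\<close>.\<close>

lemma whitney_small_box:
  fixes \<rho> :: "'i::finite \<Rightarrow> nat"
  assumes p: "0 < p" and "\<And>i. 0 < \<rho> i"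
  shows "\<exists>C s. 0 < C \<and> 0 < s \<and> s \<le> 1 \<and> whitney_small p TYPE('a::euclidean_space) \<rho> C s"
  using assms(2)
proof (induction \<rho> rule: measure_induct_rule[where f="\<lambda>\<rho>. \<Sum>i\<in>UNIV. \<rho> i"])
  case (less \<rho>)
  show ?case
  proof (cases "\<exists>i. 2 \<le> \<rho> i")
    case False
    then have \<rho>1: "\<rho> i = Suc 0" for i
      using less.prems[of i] by (metis One_nat_def Suc_leI le_antisym not_less_eq_eq numeral_2_eq_2)
    \<comment> \<open>The power of 2 is the ratio of the measures of \<open>?W\<close> and
      \<open>?A\<close> below, and \<open>CARD('i)\<close> is the number of edges in the telescoping
      path; the summand 1 keeps C positive.\<close>
    define C where "C = (2 ^ DIM('a)) powr (1 / enn2real p) * (Lp_sum_const p CARD('i) + 1)"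
    have "\<exists>Q\<in>mpolys e \<rho>. Lp_le p (cube \<phi> (1 / 3)) (\<lambda>x. f x - Q x) (C * \<omega>)"
      if db: "dual_basis e \<phi>" and f: "f \<in> borel_measurable lebesgue"
        and D: "\<And>i u. \<bar>u\<bar> \<le> 1 \<Longrightarrow> Lp_le p (cube \<phi> 1) (fin_diff (\<rho> i) (u *\<^sub>R e i) f) \<omega>"
      for e :: "'i \<Rightarrow> 'a" and \<phi> f \<omega>
    proof -
      \<comment> \<open>\<open>?W\<close> contains all differences of points of \<open>?A\<close>.
        As 1/3 + 2/3 = 1, adding partial sums of w to points of \<open>?A\<close> does not leave
        \<open>cube \<phi> 1\<close>, where the first differences are bounded.\<close>
      let ?A = "cube \<phi> (1 / 3)" and ?W = "cube \<phi> (2 / 3)"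
      have \<omega>: "0 \<le> \<omega>" using Lp_leD(3)[OF D[of 0]] by simp
      have sets: "pbox \<phi> s \<in> sets lebesgue" for s by (rule sets_lebesgue_pbox[OF db])
      have tele: "Lp_le p ?A (\<lambda>x. f (x + (\<Sum>j\<in>J. \<phi> j w *\<^sub>R e j)) - f x) (Lp_sum_const p (card J) * \<omega>)"
        if w: "w \<in> ?W" for w and J :: "'i set"
        using finite[of J]
      proof (induction J)
        case empty
        then show ?case using Lp_le_zero[OF p sets] by simp
      next
        case (insert j J)
        let ?v = "\<Sum>j\<in>J. \<phi> j w *\<^sub>R e j"
        have "Lp_le p ?A (\<lambda>x. fin_diff (\<rho> j) (\<phi> j w *\<^sub>R e j) f (x + ?v)) \<omega>"
        proof (rule Lp_le_shift[OF p D sets])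
          show "\<bar>\<phi> j w\<bar> \<le> 1" using w by (auto simp: pbox_def intro: order_trans[of _ "2 / 3"])
          fix x assume x: "x \<in> ?A"
          have "\<bar>\<phi> k (x + ?v)\<bar> \<le> 1" for k
          proof -
            have "\<bar>\<phi> k x\<bar> \<le> 1 / 3" "\<bar>\<phi> k w\<bar> \<le> 2 / 3" using x w by (auto simp: pbox_def)
            then show ?thesis
              unfolding dual_basis_simps(1)[OF db] dual_basis_combination[OF db] by auto
          qed
          then show "x + ?v \<in> cube \<phi> 1" by (simp add: pbox_def)
        qed
        from Lp_le_add[OF p insert.IH this] show ?case
          using insert.hyps by (simp add: \<rho>1 fin_diff_1 algebra_simps)
      qed
      have meas: "emeasure lborel (pbox \<phi> s) = ennreal (measure lebesgue (pbox \<phi> s))" for s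
        using emeasure_eq_measure2[OF lmeasurable_pbox[OF db, of s]] borel_pbox[OF db, of s]
        by simp
      have "measure lebesgue ?W = 2 ^ DIM('a) * measure lebesgue ?A"
        using measure_pbox_scale[OF db, of 2 "\<lambda>_. 1 / 3"] by simp
      then have mW: "emeasure lborel ?W \<le> ennreal (2 ^ DIM('a)) * emeasure lborel ?A"
        unfolding meas by (simp add: ennreal_mult')
      have pos: "0 < measure lebesgue ?A" by (rule measure_pbox_pos[OF db]) simp
      obtain c where c: "Lp_le p ?A (\<lambda>x. f x - c) ((2 ^ DIM('a)) powr (1 / enn2real p) * (Lp_sum_const p CARD('i) * \<omega>))"
      proof (rule Lp_le_minus_const_if_shifts[OF p f borel_pbox[OF db] borel_pbox[OF db] _ _ mW])
        show "emeasure lborel ?A \<noteq> \<infinity>" "0 < emeasure lborel ?A" "(0::real) < 2 ^ DIM('a)"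
          using pos by (simp_all add: meas)
        show "y - x \<in> ?W" if "x \<in> ?A" "y \<in> ?A" for x y
        proof -
          have "\<bar>\<phi> k y - \<phi> k x\<bar> \<le> 2 / 3" for k
          proof -
            have "\<bar>\<phi> k x\<bar> \<le> 1 / 3" "\<bar>\<phi> k y\<bar> \<le> 1 / 3" using that by (auto simp: pbox_def)
            then show ?thesis by linarith
          qed
          then show ?thesis by (simp add: pbox_def dual_basis_simps[OF db])
        qed
        show "Lp_le p ?A (\<lambda>x. f (x + w) - f x) (Lp_sum_const p CARD('i) * \<omega>)" if "w \<in> ?W" for w
          using tele[OF that, of UNIV] by (simp add: dual_basis_sum[OF db])
      qed (rule that)
      have "(\<lambda>x. c) \<in> mpolys e \<rho>" by (intro mpolys_const less.prems)
      moreover have "Lp_le p ?A (\<lambda>x. f x - c) (C * \<omega>)"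
        by (rule Lp_le_weaken[OF p c]) (use \<omega> in \<open>simp add: C_def algebra_simps\<close>)
      ultimately show ?thesis by (intro bexI[of _ "\<lambda>x. c"])
    qed
    moreover have "0 < C" using Lp_sum_const_nonneg[of p "CARD('i)"] by (simp add: C_def)
    ultimately show ?thesis by (intro exI[of _ C] exI[of _ "1 / 3"]) (auto simp: whitney_small_def)
  next
    case True
    then obtain i where i: "2 \<le> \<rho> i" by blast
    define \<rho>' where "\<rho>' = \<rho>(i := \<rho> i - 1)"
    define \<rho>'' where "\<rho>'' = \<rho>(i := 1)"
    have lt: "(\<Sum>j\<in>UNIV. (\<rho>(i := k)) j) < (\<Sum>j\<in>UNIV. \<rho> j)" if "k < \<rho> i" for k
      by (rule sum_strict_mono_ex1) (use that in auto)
    have pos: "0 < \<rho>' j" "0 < \<rho>'' j" for j using less.prems i by (auto simp: \<rho>'_def \<rho>''_def)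
    have lt': "(\<Sum>j\<in>UNIV. \<rho>' j) < (\<Sum>j\<in>UNIV. \<rho> j)" "(\<Sum>j\<in>UNIV. \<rho>'' j) < (\<Sum>j\<in>UNIV. \<rho> j)"
      unfolding \<rho>'_def \<rho>''_def by (rule lt, use i in simp)+
    note IH' = less.IH[OF lt'(1) pos(1)] and IH'' = less.IH[OF lt'(2) pos(2)]
    obtain C' s' where C': "0 < C'" "0 < s'" "s' \<le> 1" and W': "whitney_small p TYPE('a) \<rho>' C' s'"
      using IH' by blast
    obtain C'' s'' where C'': "0 < C''" "0 < s''" "s'' \<le> 1" and W'': "whitney_small p TYPE('a) \<rho>'' C'' s''"
      using IH'' by blast
    define m where "m = (\<Sum>j\<in>UNIV. \<rho> j)"
    have \<rho>m: "\<rho> j \<le> m" for j unfolding m_def by (rule member_le_sum) auto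
    have m: "0 < m" using \<rho>m[of i] i by simp
    obtain C1 h0 where C1: "0 < C1" and h0: "0 < h0" "h0 \<le> 1 / 2" and
      step: "\<And>(e :: 'i \<Rightarrow> 'a) \<phi> \<rho> i f B \<omega>.
      \<lbrakk>dual_basis e \<phi>; \<And>j. 0 < \<rho> j; \<And>j. \<rho> j \<le> m; f \<in> borel_measurable lebesgue;
        Lp_le p (cube \<phi> 2) f B;
        \<And>h. 0 \<le> h \<Longrightarrow> h \<le> 1 \<Longrightarrow> \<exists>P\<in>mpolys e (\<rho>(i := \<rho> i - 1)).
          Lp_le p (cube \<phi> 1) (\<lambda>x. f (x + h *\<^sub>R e i) - f x - P x) \<omega>\<rbrakk>
      \<Longrightarrow> \<exists>q\<in>mpolys e \<rho>. \<forall>h. 0 \<le> h \<longrightarrow> h \<le> h0 \<longrightarrow>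
          Lp_le p (cube \<phi> 1) (\<lambda>x. (f (x + h *\<^sub>R e i) - q (x + h *\<^sub>R e i)) - (f x - q x)) (C1 * \<omega>)"
      using first_differences_small_after_subtracting_poly[OF p m, where 'i='i and 'a='a] by blast
    define n where "n = \<rho> i"
    \<comment> \<open>Three nested cubes. \<mu> + n \<mu> = 1 keeps the base points of the
      differences in Kemperman's identity inside \<open>cube \<phi> 1\<close>. On the cube of size
      \<nu> the induction hypothesis supplies the polynomials P h. Steps |u| <= \<tau> are at most
      h0 in units of \<nu> and do not lead from the cube of size \<tau> out of that of size
      \<nu>.\<close>
    define \<mu> where "\<mu> = 1 / (real n + 1)"
    define \<nu> where "\<nu> = \<mu> * s'"
    define \<tau> where "\<tau> = \<nu> * h0 / 2"
    define K where "K = Lp_triangle p"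
    \<comment> \<open>The first summand is for differences along j \<noteq> i, taken at two base
      points; the second for the 2^n terms of Kemperman's identity when j = i.\<close>
    define c1 where "c1 = 2 * K + Lp_sum_const p (2 ^ n)"
    define c2 where "c2 = C1 * (C' * c1)"
    have n: "2 \<le> n" using i by (simp add: n_def)
    have \<mu>: "0 < \<mu>" "\<mu> \<le> 1 / 3" "\<mu> + real n * \<mu> = 1" using n by (auto simp: \<mu>_def field_simps)
    have \<nu>: "0 < \<nu>" "\<nu> \<le> \<mu>" using \<mu> C'(2,3) by (auto simp: \<nu>_def mult_le_cancel_left1)
    have "\<nu> * h0 \<le> \<nu> * (1 / 2)" using \<nu> h0 by (intro mult_left_mono) auto
    then have \<tau>: "\<tau> \<le> \<nu> / 4" "0 < \<tau>" using \<nu> h0 by (auto simp: \<tau>_def)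
    have \<tau>1: "\<tau> \<le> 1" using \<tau> \<nu> \<mu> by linarith
    have K: "1 \<le> K" unfolding K_def by (rule Lp_triangle_ge_1)
    have c1: "0 < c1" using K Lp_sum_const_nonneg[of p "2 ^ n"] by (simp add: c1_def)
    then have c2: "0 < c2" using C1 C'(1) by (simp add: c2_def)
    have "\<exists>Q\<in>mpolys e \<rho>. Lp_le p (cube \<phi> (\<tau> * s'')) (\<lambda>x. f x - Q x) (C'' * (c2 + 1) * \<omega>)"
      if db: "dual_basis e \<phi>" and f: "f \<in> borel_measurable lebesgue" and B: "Lp_le p (cube \<phi> 1) f B"
        and D: "\<And>i u. \<bar>u\<bar> \<le> 1 \<Longrightarrow> Lp_le p (cube \<phi> 1) (fin_diff (\<rho> i) (u *\<^sub>R e i) f) \<omega>"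
      for e :: "'i \<Rightarrow> 'a" and \<phi> f B \<omega>
    proof -
      let ?B = "\<lambda>s. cube \<phi> s"
      have \<omega>: "0 \<le> \<omega>" using Lp_leD(3)[OF D[of 0]] by simp
      have sets: "?B s \<in> sets lebesgue" for s by (rule sets_lebesgue_pbox[OF db])
      have sub: "?B s \<subseteq> ?B t" if "s \<le> t" for s t using that by (intro pbox_mono)
      note shift = cube_shift[OF db]
      have F_meas: "(\<lambda>x. f (x + h *\<^sub>R e i) - f x) \<in> borel_measurable lebesgue" for h
        by (intro borel_measurable_diff borel_measurable_shift f)
      have FB: "Lp_le p (?B \<mu>) (\<lambda>x. f (x + h *\<^sub>R e i) - f x) (K * (B + B))" if h: "\<bar>h\<bar> \<le> \<mu>" for h
        unfolding K_def using h \<mu> n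
        by (intro Lp_le_diff[OF p] Lp_le_shift[OF p B sets] Lp_le_subset[OF p B sets] shift[of _ \<mu>] sub) auto
      have F_diff: "Lp_le p (?B \<mu>) (fin_diff (\<rho>' j) (u *\<^sub>R e j) (\<lambda>x. f (x + h *\<^sub>R e i) - f x)) (c1 * \<omega>)"
        if h: "\<bar>h\<bar> \<le> \<mu>" and u: "\<bar>u\<bar> \<le> \<mu>" for h j u
      proof (cases "j = i")
        case False
        have "Lp_le p (?B \<mu>) (\<lambda>x. fin_diff (\<rho> j) (u *\<^sub>R e j) f (x + h *\<^sub>R e i) - fin_diff (\<rho> j) (u *\<^sub>R e j) f x) (K * (\<omega> + \<omega>))"
          unfolding K_def using h u \<mu>
          by (intro Lp_le_diff[OF p] Lp_le_shift[OF p D sets] Lp_le_subset[OF p D sets] shift[of _ \<mu>] sub) auto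
        moreover have "(\<lambda>x. fin_diff (\<rho> j) (u *\<^sub>R e j) f (x + h *\<^sub>R e i) - fin_diff (\<rho> j) (u *\<^sub>R e j) f x)
            = fin_diff (\<rho>' j) (u *\<^sub>R e j) (\<lambda>x. f (x + h *\<^sub>R e i) - f x)"
          using False by (simp add: fun_eq_iff fin_diff_diff fin_diff_add_shift \<rho>'_def)
        moreover have "K * (\<omega> + \<omega>) \<le> c1 * \<omega>"
          using \<omega> Lp_sum_const_nonneg[of p "2 ^ n"] by (simp add: c1_def algebra_simps)
        ultimately show ?thesis using Lp_le_weaken[OF p] by metis
      next
        case True
        obtain k where k: "n = Suc k" using n by (cases n) auto
        \<comment> \<open>n - 1 steps u and one step h, as in
          \<open>fin_diff_of_difference\<close>.\<close>
        define w where "w l = (if l = n then h else u)" for l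
        have w: "\<bar>w l\<bar> \<le> \<mu>" for l using h u by (simp add: w_def)
        have "Lp_le p (?B \<mu>) (\<lambda>x. (-1) ^ card J * fin_diff n ((- (\<Sum>l\<in>J. (1 / real l) * w l)) *\<^sub>R e i) f (x + (\<Sum>l\<in>J. w l) *\<^sub>R e i)) \<omega>"
          if J: "J \<in> Pow {1..n}" for J
        proof -
          have "card J \<le> n" using J card_mono[of "{1..n}" J] by auto
          then have cJ: "real (card J) * \<mu> \<le> real n * \<mu>" using \<mu> by (intro mult_right_mono) auto
          have "\<bar>\<Sum>l\<in>J. w l\<bar> \<le> (\<Sum>l\<in>J. \<mu>)"
            by (rule order_trans[OF sum_abs]) (intro sum_mono w)
          then have sw: "\<bar>\<Sum>l\<in>J. w l\<bar> \<le> real n * \<mu>" using cJ by simp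
          \<comment> \<open>The weights 1 / l do not enlarge the steps, so each combined step is at
            most n \<mu>, which is below 1.\<close>
          have "\<bar>\<Sum>l\<in>J. (1 / real l) * w l\<bar> \<le> (\<Sum>l\<in>J. \<mu>)"
          proof (rule order_trans[OF sum_abs], intro sum_mono)
            fix l assume "l \<in> J"
            then have "1 \<le> l" using J by auto
            then have "\<mu> * 1 \<le> \<mu> * real l" using \<mu> by (intro mult_left_mono) auto
            then have "\<bar>w l\<bar> \<le> \<mu> * real l" using w[of l] by simp
            then show "\<bar>1 / real l * w l\<bar> \<le> \<mu>" using \<open>1 \<le> l\<close> by (simp add: abs_mult divide_le_eq)
          qed
          then have "\<bar>\<Sum>l\<in>J. (1 / real l) * w l\<bar> \<le> real (card J) * \<mu>" by simp
          then have "\<bar>- (\<Sum>l\<in>J. (1 / real l) * w l)\<bar> \<le> 1"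
            unfolding abs_minus_cancel using cJ \<mu> by linarith
          note D_J = D[OF this, of i, folded n_def]
          have "Lp_le p (?B \<mu>) (\<lambda>x. fin_diff n ((- (\<Sum>l\<in>J. (1 / real l) * w l)) *\<^sub>R e i) f (x + (\<Sum>l\<in>J. w l) *\<^sub>R e i)) \<omega>"
          proof (rule Lp_le_shift[OF p D_J sets])
            show "x + (\<Sum>l\<in>J. w l) *\<^sub>R e i \<in> ?B 1" if "x \<in> ?B \<mu>" for x
              by (rule shift[OF that]) (use sw \<mu>(3) in linarith)
          qed
          from Lp_le_cmult[OF p this, of "(-1) ^ card J"] show ?thesis by simp
        qed
        then have sum_le: "Lp_le p (?B \<mu>) (\<lambda>x. \<Sum>J\<in>Pow {1..n}. (-1) ^ card J * fin_diff n ((- (\<Sum>l\<in>J. (1 / real l) * w l)) *\<^sub>R e i) f (x + (\<Sum>l\<in>J. w l) *\<^sub>R e i))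
            (Lp_sum_const p (card (Pow {1..n})) * \<omega>)"
          by (intro Lp_le_sum[OF p _ sets]) auto
        have sum_eq: "(\<lambda>x. \<Sum>J\<in>Pow {1..n}. (-1) ^ card J * fin_diff n ((- (\<Sum>l\<in>J. (1 / real l) * w l)) *\<^sub>R e i) f (x + (\<Sum>l\<in>J. w l) *\<^sub>R e i))
            = fin_diff (\<rho>' j) (u *\<^sub>R e j) (\<lambda>x. f (x + h *\<^sub>R e i) - f x)"
        proof
          fix x
          have w_e: "(if l = Suc k then h *\<^sub>R e i else u *\<^sub>R e i) = w l *\<^sub>R e i" for l
            by (simp add: w_def k)
          have "\<rho>' j = k" using True k by (simp add: \<rho>'_def n_def)
          then have "fin_diff (\<rho>' j) (u *\<^sub>R e j) (\<lambda>x. f (x + h *\<^sub>R e i) - f x) x =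
            (\<Sum>J\<in>Pow {1..Suc k}. (-1) ^ card J * fin_diff (Suc k) (- (\<Sum>l\<in>J. (1 / real l) *\<^sub>R w l *\<^sub>R e i)) f (x + (\<Sum>l\<in>J. w l *\<^sub>R e i)))"
            using fin_diff_of_difference[of k "u *\<^sub>R e i" f "h *\<^sub>R e i" x] True unfolding w_e by simp
          then show "(\<Sum>J\<in>Pow {1..n}. (-1) ^ card J * fin_diff n ((- (\<Sum>l\<in>J. (1 / real l) * w l)) *\<^sub>R e i) f (x + (\<Sum>l\<in>J. w l) *\<^sub>R e i))
            = fin_diff (\<rho>' j) (u *\<^sub>R e j) (\<lambda>x. f (x + h *\<^sub>R e i) - f x) x"
            by (simp only: k scaleR_scaleR scaleR_minus_left scaleR_sum_left)
        qed
        have "Lp_sum_const p (card (Pow {1..n})) * \<omega> \<le> c1 * \<omega>"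
          using \<omega> K by (simp add: c1_def card_Pow mult_right_mono)
        from Lp_le_weaken[OF p sum_le this] show ?thesis unfolding sum_eq .
      qed
      have e\<mu>: "dual_basis (\<lambda>i. \<mu> *\<^sub>R e i) (\<lambda>i x. \<phi> i x / \<mu>)" by (rule dual_basis_scale[OF db \<mu>(1)])
      have b\<mu>: "cube (\<lambda>i x. \<phi> i x / \<mu>) s = ?B (\<mu> * s)" for s by (rule pbox_scale[OF \<mu>(1)])
      have F_poly: "\<exists>P\<in>mpolys e \<rho>'. Lp_le p (?B \<nu>) (\<lambda>x. f (x + h *\<^sub>R e i) - f x - P x) (C' * (c1 * \<omega>))"
        if h: "\<bar>h\<bar> \<le> \<mu>" for h
      proof -
        have "\<exists>P\<in>mpolys (\<lambda>i. \<mu> *\<^sub>R e i) \<rho>'. Lp_le p (cube (\<lambda>i x. \<phi> i x / \<mu>) s')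
            (\<lambda>x. f (x + h *\<^sub>R e i) - f x - P x) (C' * (c1 * \<omega>))"
        proof (rule whitney_smallD[OF W' e\<mu> F_meas])
          show "Lp_le p (cube (\<lambda>i x. \<phi> i x / \<mu>) 1) (\<lambda>x. f (x + h *\<^sub>R e i) - f x) (K * (B + B))"
            unfolding b\<mu> using FB[OF h] by simp
          fix j and u :: real assume "\<bar>u\<bar> \<le> 1"
          then have "\<bar>u * \<mu>\<bar> \<le> \<mu>" using \<mu>(1) by (simp add: abs_mult mult_le_cancel_right1)
          from F_diff[OF h this, of j]
          show "Lp_le p (cube (\<lambda>i x. \<phi> i x / \<mu>) 1) (fin_diff (\<rho>' j) (u *\<^sub>R \<mu> *\<^sub>R e j) (\<lambda>x. f (x + h *\<^sub>R e i) - f x)) (c1 * \<omega>)"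
            unfolding b\<mu> by simp
        qed
        then show ?thesis using \<mu>(1) by (simp add: b\<mu> mpolys_scale \<nu>_def)
      qed
      have e\<nu>: "dual_basis (\<lambda>i. \<nu> *\<^sub>R e i) (\<lambda>i x. \<phi> i x / \<nu>)" by (rule dual_basis_scale[OF db \<nu>(1)])
      have b\<nu>: "cube (\<lambda>i x. \<phi> i x / \<nu>) s = ?B (\<nu> * s)" for s by (rule pbox_scale[OF \<nu>(1)])
      have "\<exists>q\<in>mpolys (\<lambda>i. \<nu> *\<^sub>R e i) \<rho>. \<forall>h. 0 \<le> h \<longrightarrow> h \<le> h0 \<longrightarrow>
          Lp_le p (cube (\<lambda>i x. \<phi> i x / \<nu>) 1)
            (\<lambda>x. (f (x + h *\<^sub>R \<nu> *\<^sub>R e i) - q (x + h *\<^sub>R \<nu> *\<^sub>R e i)) - (f x - q x)) (C1 * (C' * (c1 * \<omega>)))"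
      proof (rule step[where \<rho>=\<rho>, OF e\<nu> less.prems \<rho>m f])
        show "Lp_le p (cube (\<lambda>i x. \<phi> i x / \<nu>) 2) f B"
          unfolding b\<nu> using \<nu> \<mu> by (intro Lp_le_subset[OF p B sets sub]) auto
        fix h :: real assume h: "0 \<le> h" "h \<le> 1"
        have "h * \<nu> \<le> 1 * \<nu>" using h \<nu> by (intro mult_right_mono) auto
        then have "h * \<nu> \<le> \<mu>" using \<nu>(2) by linarith
        then have "\<bar>h * \<nu>\<bar> \<le> \<mu>" using h \<nu> by simp
        from F_poly[OF this] show "\<exists>P\<in>mpolys (\<lambda>i. \<nu> *\<^sub>R e i) (\<rho>(i := \<rho> i - 1)).
          Lp_le p (cube (\<lambda>i x. \<phi> i x / \<nu>) 1) (\<lambda>x. f (x + h *\<^sub>R \<nu> *\<^sub>R e i) - f x - P x) (C' * (c1 * \<omega>))"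
          using \<nu>(1) by (simp add: b\<nu> mpolys_scale \<rho>'_def)
      qed
      then obtain q where q: "q \<in> mpolys e \<rho>" and q_le: "\<And>h. 0 \<le> h \<Longrightarrow> h \<le> h0 \<Longrightarrow>
          Lp_le p (?B \<nu>) (\<lambda>x. (f (x + (h * \<nu>) *\<^sub>R e i) - q (x + (h * \<nu>) *\<^sub>R e i)) - (f x - q x)) (c2 * \<omega>)"
        using \<nu>(1) by (auto simp: b\<nu> mpolys_scale c2_def mult.assoc)
      define g where "g x = f x - q x" for x
      have g_meas: "g \<in> borel_measurable lebesgue"
        unfolding g_def[abs_def] by (intro borel_measurable_diff f mpolys_measurable[OF q])
      \<comment> \<open>The induction hypothesis needs some finite bound for g; its size does not
        enter the constant.\<close>
      obtain Mq where Mq: "\<And>x. x \<in> ?B 1 \<Longrightarrow> \<bar>q x\<bar> \<le> Mq" using mpolys_bounded_on_pbox[OF db q] by blast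
      have gB: "Lp_le p (?B \<tau>) g (K * (B + \<bar>Mq\<bar> * Lp_vol p (?B \<tau>)))"
        unfolding g_def[abs_def] K_def
        by (intro Lp_le_diff[OF p] Lp_le_bounded[OF p] lmeasurable_pbox[OF db] mpolys_measurable[OF q]
            Lp_le_subset[OF p B sets sub] Mq) (use \<tau>1 sub[of \<tau> 1] in auto)
      \<comment> \<open>For j \<noteq> i the polynomial q has vanishing differences of order \<rho>
        j, so g inherits the bound for f. For j = i the order is one, and the choice of q applies.
        The factor c2 + 1 dominates both bounds.\<close>
      have g_diff: "Lp_le p (?B \<tau>) (fin_diff (\<rho>'' j) (u *\<^sub>R e j) g) ((c2 + 1) * \<omega>)" if u: "\<bar>u\<bar> \<le> \<tau>" for j u
      proof (cases "j = i")
        case False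
        have "fin_diff (\<rho>'' j) (u *\<^sub>R e j) g = fin_diff (\<rho> j) (u *\<^sub>R e j) f"
          using False by (simp add: fun_eq_iff g_def[abs_def] fin_diff_diff mpolys_fin_diff_eq_0[OF q] \<rho>''_def)
        moreover have "Lp_le p (?B \<tau>) (fin_diff (\<rho> j) (u *\<^sub>R e j) f) ((c2 + 1) * \<omega>)"
          by (rule Lp_le_weaken[OF p Lp_le_subset[OF p D sets sub]]) (use u \<tau> \<tau>1 c2 \<omega> in \<open>auto simp: algebra_simps\<close>)
        ultimately show ?thesis by simp
      next
        case True
        define h where "h = \<bar>u\<bar> / \<nu>"
        have h: "0 \<le> h" "h * \<nu> = \<bar>u\<bar>" using \<nu> by (auto simp: h_def)
        have "h \<le> h0" using u \<nu> h0 by (simp add: h_def \<tau>_def divide_le_eq mult.commute)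
        from q_le[OF h(1) this] have g_le: "Lp_le p (?B \<nu>) (\<lambda>x. g (x + \<bar>u\<bar> *\<^sub>R e i) - g x) (c2 * \<omega>)"
          unfolding h(2) g_def .
        have eq: "fin_diff (\<rho>'' j) (u *\<^sub>R e j) g = (\<lambda>x. g (x + u *\<^sub>R e i) - g x)"
          using True by (simp add: fun_eq_iff \<rho>''_def fin_diff_1)
        have "Lp_le p (?B \<tau>) (\<lambda>x. g (x + u *\<^sub>R e i) - g x) (c2 * \<omega>)"
        proof (cases "0 \<le> u")
          case True
          then show ?thesis using Lp_le_subset[OF p g_le sets sub[of \<tau> \<nu>]] \<tau> \<nu> by simp
        next
          case False
          \<comment> \<open>A negative step is, up to sign, a positive step from the shifted base
            point.\<close>
          have "Lp_le p (?B \<tau>) (\<lambda>x. g ((x + u *\<^sub>R e i) + \<bar>u\<bar> *\<^sub>R e i) - g (x + u *\<^sub>R e i)) (c2 * \<omega>)"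
            by (rule Lp_le_shift[OF p g_le sets]) (rule shift[of _ \<tau>], use u \<tau> \<nu> in auto)
          from Lp_le_cmult[OF p this, of "-1"] show ?thesis using False by simp
        qed
        then show ?thesis unfolding eq
          by (rule Lp_le_weaken[OF p]) (use \<omega> in \<open>simp add: algebra_simps\<close>)
      qed
      have e\<tau>: "dual_basis (\<lambda>i. \<tau> *\<^sub>R e i) (\<lambda>i x. \<phi> i x / \<tau>)" by (rule dual_basis_scale[OF db \<tau>(2)])
      have b\<tau>: "cube (\<lambda>i x. \<phi> i x / \<tau>) s = ?B (\<tau> * s)" for s by (rule pbox_scale[OF \<tau>(2)])
      have "\<exists>Q\<in>mpolys (\<lambda>i. \<tau> *\<^sub>R e i) \<rho>''. Lp_le p (cube (\<lambda>i x. \<phi> i x / \<tau>) s'') (\<lambda>x. g x - Q x) (C'' * ((c2 + 1) * \<omega>))"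
      proof (rule whitney_smallD[OF W'' e\<tau> g_meas])
        show "Lp_le p (cube (\<lambda>i x. \<phi> i x / \<tau>) 1) g (K * (B + \<bar>Mq\<bar> * Lp_vol p (?B \<tau>)))"
          unfolding b\<tau> using gB by simp
        fix j and u :: real assume "\<bar>u\<bar> \<le> 1"
        then have "\<bar>u * \<tau>\<bar> \<le> \<tau>" using \<tau>(2) by (simp add: abs_mult mult_le_cancel_right1)
        from g_diff[OF this, of j]
        show "Lp_le p (cube (\<lambda>i x. \<phi> i x / \<tau>) 1) (fin_diff (\<rho>'' j) (u *\<^sub>R \<tau> *\<^sub>R e j) g) ((c2 + 1) * \<omega>)"
          unfolding b\<tau> by simp
      qed
      then obtain Q where Q: "Q \<in> mpolys e \<rho>''" "Lp_le p (?B (\<tau> * s'')) (\<lambda>x. g x - Q x) (C'' * ((c2 + 1) * \<omega>))"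
        using \<tau>(2) by (auto simp: b\<tau> mpolys_scale)
      have "Q \<in> mpolys e \<rho>" using Q(1) by (rule mpolys_mono) (use i in \<open>simp add: \<rho>''_def\<close>)
      then have "(\<lambda>x. q x + Q x) \<in> mpolys e \<rho>" by (intro mpolys_add q)
      moreover have "Lp_le p (?B (\<tau> * s'')) (\<lambda>x. f x - (q x + Q x)) (C'' * (c2 + 1) * \<omega>)"
        using Q(2) by (simp add: g_def algebra_simps)
      ultimately show ?thesis by (intro bexI[of _ "\<lambda>x. q x + Q x"])
    qed
    moreover have "0 < C'' * (c2 + 1)" using C''(1) c2 by simp
    moreover have "0 < \<tau> * s''" "\<tau> * s'' \<le> 1" using \<tau> \<tau>1 C''(2,3) by (auto intro: mult_le_one)
    ultimately show ?thesis by (intro exI[of _ "C'' * (c2 + 1)"] exI[of _ "\<tau> * s''"]) (auto simp: whitney_small_def)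
  qed
qed

section \<open>Extension to the whole region\<close>

text \<open>In the difference F x has coefficient 1 up to sign, and all other nodes lie in
  \<open>A\<close>, where F is already bounded.\<close>

lemma Lp_le_extend_step:
  fixes F :: "'a::euclidean_space \<Rightarrow> real"
  assumes p: "0 < p" and r: "1 \<le> r" and A: "Lp_le p A F b" and B: "Lp_le p B (fin_diff r \<xi> F) \<omega>"
    and nodes: "\<And>x j. x \<in> B \<Longrightarrow> 1 \<le> j \<Longrightarrow> j \<le> r \<Longrightarrow> x + real j *\<^sub>R \<xi> \<in> A"
  shows "Lp_le p B F (Lp_triangle p * (\<omega> + Lp_sum_const p r * (2 ^ r * b)))"
proof -
  have B_sets: "B \<in> sets lebesgue" using Lp_leD[OF B] by simp
  have b: "0 \<le> b" using Lp_leD[OF A] by simp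
  have terms: "Lp_le p B (\<lambda>x. (-1) ^ (r + j) * real (r choose j) * F (x + real j *\<^sub>R \<xi>)) (2 ^ r * b)"
    if j: "j \<in> {1..r}" for j
  proof -
    have "Lp_le p B (\<lambda>x. F (x + real j *\<^sub>R \<xi>)) b"
      by (rule Lp_le_shift[OF p A B_sets nodes]) (use j in auto)
    from Lp_le_cmult[OF p this, of "(-1) ^ (r + j) * real (r choose j)"]
    have *: "Lp_le p B (\<lambda>x. (-1) ^ (r + j) * real (r choose j) * F (x + real j *\<^sub>R \<xi>)) (real (r choose j) * b)"
      by (simp add: abs_mult)
    have "r choose j \<le> (\<Sum>j\<le>r. r choose j)" using j by (intro member_le_sum) auto
    then have "real (r choose j) \<le> 2 ^ r"
      unfolding choose_row_sum by (metis of_nat_le_iff of_nat_numeral of_nat_power)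
    then show ?thesis by (intro Lp_le_weaken[OF p *] mult_right_mono b)
  qed
  have "Lp_le p B (\<lambda>x. \<Sum>j\<in>{1..r}. (-1) ^ (r + j) * real (r choose j) * F (x + real j *\<^sub>R \<xi>))
      (Lp_sum_const p (card {1..r}) * (2 ^ r * b))"
    by (intro Lp_le_sum[OF p _ B_sets] terms) auto
  then have "Lp_le p B (\<lambda>x. \<Sum>j\<in>{1..r}. (-1) ^ (r + j) * real (r choose j) * F (x + real j *\<^sub>R \<xi>))
      (Lp_sum_const p r * (2 ^ r * b))"
    by simp
  from Lp_le_diff[OF p B this] show ?thesis
  proof (rule Lp_le_mono[OF p])
    fix x
    have "fin_diff r \<xi> F x = (-1) ^ r * F x + (\<Sum>j\<in>{1..r}. (-1) ^ (r + j) * real (r choose j) * F (x + real j *\<^sub>R \<xi>))"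
      unfolding fin_diff_def atMost_atLeast0 by (subst sum.atLeast_Suc_atMost) auto
    then have "\<bar>fin_diff r \<xi> F x - (\<Sum>j\<in>{1..r}. (-1) ^ (r + j) * real (r choose j) * F (x + real j *\<^sub>R \<xi>))\<bar> = \<bar>F x\<bar>"
      by (simp add: abs_mult)
    then show "\<bar>F x\<bar> \<le> \<bar>fin_diff r \<xi> F x - (\<Sum>j\<in>{1..r}. (-1) ^ (r + j) * real (r choose j) * F (x + real j *\<^sub>R \<xi>))\<bar>"
      by simp
  qed (use Lp_leD[OF A] B_sets in auto)
qed

text \<open>The part of convexity that the extension needs: from outside the slab one can move along
  \<open>e\<close> across its full width without leaving \<open>Y\<close>. Boxes have this property,
  and so does a region between two graphs that enclose the slab.\<close>

definition segments_to_slab :: "'a::real_vector set \<Rightarrow> 'a \<Rightarrow> ('a \<Rightarrow> real) \<Rightarrow> real \<Rightarrow> bool" where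
  "segments_to_slab Y e \<phi> \<sigma> \<longleftrightarrow>
     (\<forall>x\<in>Y. \<phi> x < - \<sigma> \<longrightarrow> (\<forall>t\<ge>0. \<phi> x + t \<le> \<sigma> \<longrightarrow> x + t *\<^sub>R e \<in> Y)) \<and>
     (\<forall>x\<in>Y. \<sigma> < \<phi> x \<longrightarrow> (\<forall>t\<ge>0. - \<sigma> \<le> \<phi> x - t \<longrightarrow> x - t *\<^sub>R e \<in> Y))"

text \<open>C belongs to the part already treated and c to each of two new layers, by
  \<open>Lp_le_extend_step\<close>; the outer expression comes from two unions.\<close>

primrec extend_const :: "ennreal \<Rightarrow> nat \<Rightarrow> nat \<Rightarrow> real" where
  "extend_const p r 0 = 1"
| "extend_const p r (Suc k) =
    (let K = Lp_triangle p; C = extend_const p r k; c = K * (1 + Lp_sum_const p r * (2 ^ r * C))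
     in K * (K * (C + c) + c))"

lemma extend_const_pos: "0 < extend_const p r k"
proof (induction k)
  case (Suc k)
  define c where "c = Lp_triangle p * (1 + Lp_sum_const p r * (2 ^ r * extend_const p r k))"
  have K: "0 < Lp_triangle p" using Lp_triangle_ge_1[of p] by simp
  then have "0 < c"
    unfolding c_def using Lp_sum_const_nonneg[of p r] Suc by (intro mult_pos_pos add_pos_nonneg) auto
  then show ?case using K Suc by (simp add: Let_def c_def[symmetric] add_pos_pos)
qed simp

text \<open>Each round adds a layer of thickness \<eta> = 2 \<sigma> / r on either side. From a
  layer, nodes 1, ..., r towards the slab travel at least \<eta> and at most r \<eta> = 2 \<sigma>,
  so they land in the part already treated and do not overshoot it.\<close>

lemma extend_along_direction_steps:
  fixes e :: "'a::euclidean_space"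
  assumes p: "0 < p" and r: "1 \<le> r" and \<sigma>: "0 < \<sigma>"
    and \<phi>e: "\<And>x t. \<phi> (x + t *\<^sub>R e) = \<phi> x + t" and \<phi>_meas[measurable]: "\<phi> \<in> borel_measurable lebesgue"
    and Y[measurable]: "Y \<in> sets lebesgue"
    and seg: "segments_to_slab Y e \<phi> \<sigma>" and a: "Lp_le p (Y \<inter> {x. \<bar>\<phi> x\<bar> \<le> \<sigma>}) F a"
    and D: "Lp_le p {x\<in>Y. x + (2 * \<sigma>) *\<^sub>R e \<in> Y} (fin_diff r ((2 * \<sigma> / real r) *\<^sub>R e) F) \<omega>"
  shows "Lp_le p (Y \<inter> {x. \<bar>\<phi> x\<bar> \<le> \<sigma> + real k * (2 * \<sigma> / real r)}) F (extend_const p r k * (a + \<omega>))"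
proof (induction k)
  case 0
  show ?case using Lp_le_weaken[OF p a, of "a + \<omega>"] Lp_leD(3)[OF D] by simp
next
  case (Suc k)
  define \<eta> where "\<eta> = 2 * \<sigma> / real r"
  define K where "K = Lp_triangle p"
  define C where "C = extend_const p r k"
  define c where "c = K * (1 + Lp_sum_const p r * (2 ^ r * C))"
  note D = D[folded \<eta>_def] and IH = Suc.IH[folded \<eta>_def]
  have \<eta>: "0 < \<eta>" "real r * \<eta> = 2 * \<sigma>" using r \<sigma> by (auto simp: \<eta>_def)
  have K: "1 \<le> K" unfolding K_def by (rule Lp_triangle_ge_1)
  define A where "A = Y \<inter> {x. \<bar>\<phi> x\<bar> \<le> \<sigma> + real k * \<eta>}"
  define B1 where "B1 = Y \<inter> {x. - (\<sigma> + real (Suc k) * \<eta>) \<le> \<phi> x \<and> \<phi> x < - (\<sigma> + real k * \<eta>)}"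
  define B2 where "B2 = Y \<inter> {x. \<sigma> + real k * \<eta> < \<phi> x \<and> \<phi> x \<le> \<sigma> + real (Suc k) * \<eta>}"
  have a0: "0 \<le> a" "0 \<le> \<omega>" using Lp_leD(3)[OF a] Lp_leD(3)[OF D] by auto
  have \<phi>e': "\<phi> (x - t *\<^sub>R e) = \<phi> x - t" for x t using \<phi>e[of x "- t"] by simp
  have AF: "Lp_le p A F (C * (a + \<omega>))"
    unfolding A_def C_def by (rule IH)
  have kn: "0 \<le> real k * \<eta>" "real (Suc k) * \<eta> = real k * \<eta> + \<eta>" using \<eta> by (simp_all add: algebra_simps)
  have cle: "K * (\<omega> + Lp_sum_const p r * (2 ^ r * (C * (a + \<omega>)))) \<le> c * (a + \<omega>)"
    using a0 K by (simp add: c_def algebra_simps)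
  have [measurable]: "{x. - (\<sigma> + real (Suc k) * \<eta>) \<le> \<phi> x \<and> \<phi> x < - (\<sigma> + real k * \<eta>)} \<in> sets lebesgue"
    "{x. \<sigma> + real k * \<eta> < \<phi> x \<and> \<phi> x \<le> \<sigma> + real (Suc k) * \<eta>} \<in> sets lebesgue"
    using measurable_sets[OF \<phi>_meas, of "{- (\<sigma> + real (Suc k) * \<eta>)..<- (\<sigma> + real k * \<eta>)}"]
      measurable_sets[OF \<phi>_meas, of "{\<sigma> + real k * \<eta><..\<sigma> + real (Suc k) * \<eta>}"]
    by (simp_all add: vimage_def)
  have B_sets: "B1 \<in> sets lebesgue" "B2 \<in> sets lebesgue"
    unfolding B1_def B2_def by (intro sets.Int; measurable)+
  have j\<eta>: "\<eta> \<le> real j * \<eta>" "real j * \<eta> \<le> 2 * \<sigma>" if "1 \<le> j" "j \<le> r" for j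
  proof -
    show "\<eta> \<le> real j * \<eta>" using that \<eta> by (simp add: mult_le_cancel_right1)
    have "real j * \<eta> \<le> real r * \<eta>" using that \<eta> by (intro mult_right_mono) auto
    then show "real j * \<eta> \<le> 2 * \<sigma>" using \<eta>(2) by simp
  qed
  have B1F: "Lp_le p B1 F (c * (a + \<omega>))"
  proof -
    have mem: "x + t *\<^sub>R e \<in> Y" if "x \<in> B1" "0 \<le> t" "t \<le> 2 * \<sigma>" for x t
    proof -
      have x: "x \<in> Y" "\<phi> x < - (\<sigma> + real k * \<eta>)" using that(1) by (auto simp: B1_def)
      then have "\<phi> x < - \<sigma>" "\<phi> x + t \<le> \<sigma>" using kn(1) that(3) by linarith+
      then show ?thesis using seg x(1) that(2) unfolding segments_to_slab_def by blast
    qed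
    have node: "x + real j *\<^sub>R \<eta> *\<^sub>R e \<in> A" if "x \<in> B1" "1 \<le> j" "j \<le> r" for x j
    proof -
      have "\<bar>\<phi> x + real j * \<eta>\<bar> \<le> \<sigma> + real k * \<eta>"
      proof -
        have "- (\<sigma> + real (Suc k) * \<eta>) \<le> \<phi> x" "\<phi> x < - (\<sigma> + real k * \<eta>)"
          using that(1) unfolding B1_def by blast+
        then show ?thesis using j\<eta>[OF that(2,3)] kn by linarith
      qed
      then show ?thesis
        using mem[of x "real j * \<eta>"] \<phi>e[of x "real j * \<eta>"] that(1) j\<eta>[OF that(2,3)] \<eta>(1) by (simp add: A_def)
    qed
    have "Lp_le p B1 (fin_diff r (\<eta> *\<^sub>R e) F) \<omega>"
      by (rule Lp_le_subset[OF p D B_sets(1)]) (use mem \<sigma> in \<open>auto simp: B1_def\<close>)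
    from Lp_le_extend_step[OF p r AF this node] show ?thesis
      unfolding K_def[symmetric] using cle by (rule Lp_le_weaken[OF p])
  qed
  have B2F: "Lp_le p B2 F (c * (a + \<omega>))"
  proof -
    have mem: "x - t *\<^sub>R e \<in> Y" if "x \<in> B2" "0 \<le> t" "t \<le> 2 * \<sigma>" for x t
    proof -
      have x: "x \<in> Y" "\<sigma> + real k * \<eta> < \<phi> x" using that(1) by (auto simp: B2_def)
      then have "\<sigma> < \<phi> x" "- \<sigma> \<le> \<phi> x - t" using kn(1) that(3) by linarith+
      then show ?thesis using seg x(1) that(2) unfolding segments_to_slab_def by blast
    qed
    have node: "x + real j *\<^sub>R - (\<eta> *\<^sub>R e) \<in> A" if "x \<in> B2" "1 \<le> j" "j \<le> r" for x j
    proof -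
      have "\<bar>\<phi> x - real j * \<eta>\<bar> \<le> \<sigma> + real k * \<eta>"
      proof -
        have "\<sigma> + real k * \<eta> < \<phi> x" "\<phi> x \<le> \<sigma> + real (Suc k) * \<eta>"
          using that(1) unfolding B2_def by blast+
        then show ?thesis using j\<eta>[OF that(2,3)] kn by linarith
      qed
      then show ?thesis
        using mem[of x "real j * \<eta>"] \<phi>e'[of x "real j * \<eta>"] that(1) j\<eta>[OF that(2,3)] \<eta>(1) by (simp add: A_def)
    qed
    \<comment> \<open>From the upper layer the steps go downwards; the reflected difference is based
      at the lower end of the segment, where D applies.\<close>
    have "Lp_le p B2 (\<lambda>x. fin_diff r (\<eta> *\<^sub>R e) F (x + - ((2 * \<sigma>) *\<^sub>R e))) \<omega>"
      by (rule Lp_le_shift[OF p D B_sets(2)]) (use mem \<sigma> in \<open>auto simp: B2_def\<close>)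
    from Lp_le_cmult[OF p this, of "(-1) ^ r"]
    have "Lp_le p B2 (fin_diff r (- (\<eta> *\<^sub>R e)) F) \<omega>"
      unfolding fin_diff_uminus_direction[abs_def] by (simp add: \<eta>(2))
    from Lp_le_extend_step[OF p r AF this node] show ?thesis
      unfolding K_def[symmetric] using cle by (rule Lp_le_weaken[OF p])
  qed
  have "Lp_le p (A \<union> B1 \<union> B2) F (K * (K * (C * (a + \<omega>) + c * (a + \<omega>)) + c * (a + \<omega>)))"
    unfolding K_def by (intro Lp_le_Un[OF p] AF B1F B2F)
  moreover have "A \<union> B1 \<union> B2 = Y \<inter> {x. \<bar>\<phi> x\<bar> \<le> \<sigma> + real (Suc k) * \<eta>}"
  proof -
    have "(Y \<inter> {x. \<bar>\<phi> x\<bar> \<le> \<sigma> + z}) \<union> (Y \<inter> {x. - (\<sigma> + z') \<le> \<phi> x \<and> \<phi> x < - (\<sigma> + z)})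
        \<union> (Y \<inter> {x. \<sigma> + z < \<phi> x \<and> \<phi> x \<le> \<sigma> + z'}) = Y \<inter> {x. \<bar>\<phi> x\<bar> \<le> \<sigma> + z'}"
      if "0 \<le> z" "z \<le> z'" for z z'
      using that \<sigma> by (auto simp: abs_le_iff)
    moreover have "real k * \<eta> \<le> real (Suc k) * \<eta>" using kn(2) \<eta>(1) by linarith
    ultimately show ?thesis unfolding A_def B1_def B2_def using kn(1) by blast
  qed
  moreover have "K * (K * (C * (a + \<omega>) + c * (a + \<omega>)) + c * (a + \<omega>)) = K * (K * (C + c) + c) * (a + \<omega>)"
    by (simp add: algebra_simps)
  moreover have "extend_const p r (Suc k) = K * (K * (C + c) + c)"
    by (simp add: K_def C_def c_def Let_def)
  ultimately show ?case by (simp add: \<eta>_def)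
qed

lemma extend_along_direction:
  fixes e :: "'a::euclidean_space"
  assumes p: "0 < p" and "1 \<le> r" and \<sigma>: "0 < \<sigma>" and k: "\<Lambda> < real k * (2 * \<sigma> / real r)"
    and "\<And>x t. \<phi> (x + t *\<^sub>R e) = \<phi> x + t" and "\<phi> \<in> borel_measurable lebesgue" and "Y \<in> sets lebesgue"
    and \<Lambda>: "\<And>x. x \<in> Y \<Longrightarrow> \<bar>\<phi> x\<bar> \<le> \<Lambda>"
    and "segments_to_slab Y e \<phi> \<sigma>" and "Lp_le p (Y \<inter> {x. \<bar>\<phi> x\<bar> \<le> \<sigma>}) F a"
    and "Lp_le p {x\<in>Y. x + (2 * \<sigma>) *\<^sub>R e \<in> Y} (fin_diff r ((2 * \<sigma> / real r) *\<^sub>R e) F) \<omega>"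
  shows "Lp_le p Y F (extend_const p r k * (a + \<omega>))"
proof -
  have "\<bar>\<phi> x\<bar> \<le> \<sigma> + real k * (2 * \<sigma> / real r)" if "x \<in> Y" for x
    using \<Lambda>[OF that] k \<sigma> by linarith
  then have "Y \<inter> {x. \<bar>\<phi> x\<bar> \<le> \<sigma> + real k * (2 * \<sigma> / real r)} = Y" by blast
  with extend_along_direction_steps[OF assms(1-3,5-7,9-11), of k] show ?thesis by simp
qed

section \<open>Whitney's inequality on the unit box and on the region\<close>

lemma dual_basis_measurable: "dual_basis e \<phi> \<Longrightarrow> \<phi> i \<in> borel_measurable lebesgue"
  by (intro measurable_completion) (use borel_measurable_continuous_onI[OF dual_basis_continuous] in auto)

lemma fin_diff_zero_direction: "1 \<le> r \<Longrightarrow> fin_diff r 0 f x = 0"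
  by (cases r) (simp_all add: fin_diff_Suc)

text \<open>Each of n coordinate extensions turns a bound C \<omega> into
  \<open>extend_const p r k * (C * \<omega> + \<omega>)\<close>.\<close>

definition whitney_const :: "ennreal \<Rightarrow> nat \<Rightarrow> nat \<Rightarrow> nat \<Rightarrow> real \<Rightarrow> real" where
  "whitney_const p r n k C = ((\<lambda>c. extend_const p r k * (c + 1)) ^^ n) C"

lemma whitney_const_pos: "0 < C \<Longrightarrow> 0 < whitney_const p r n k C"
  using extend_const_pos[of p r k] by (induction n) (auto simp: whitney_const_def intro: add_pos_pos)

text \<open>D bounds only differences whose end points lie in the unit box, whereas
  \<open>whitney_small\<close> wants them on a full cube. On the cube of size \<mu> with \<mu> + r
  \<mu> = 1 all steps up to \<mu> qualify; this gives Q on the cube of size \<sigma> = \<mu> s, and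
  k rounds per coordinate suffice to reach half-width 1.\<close>

lemma whitney_pbox:
  fixes e :: "'i::finite \<Rightarrow> 'a::euclidean_space"
  assumes p: "0 < p" and r: "1 \<le> r"
    and small: "whitney_small p TYPE('a) (\<lambda>_::'i. r) C0 s" and s: "0 < s" "s \<le> 1"
    and k: "1 < real k * (2 * (s / (real r + 1)) / real r)"
    and db: "dual_basis e \<phi>" and f: "f \<in> borel_measurable lebesgue" and B: "Lp_le p (cube \<phi> 1) f B"
    and D: "\<And>i u. 0 < u \<Longrightarrow> real r * u \<le> 2 \<Longrightarrow>
      Lp_le p {x \<in> cube \<phi> 1. x + (real r * u) *\<^sub>R e i \<in> cube \<phi> 1} (fin_diff r (u *\<^sub>R e i) f) \<omega>"
  shows "\<exists>Q\<in>mpolys e (\<lambda>_. r). Lp_le p (cube \<phi> 1) (\<lambda>x. f x - Q x) (whitney_const p r CARD('i) k C0 * \<omega>)"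
proof -
  define \<mu> where "\<mu> = 1 / (real r + 1)"
  define \<sigma> where "\<sigma> = s / (real r + 1)"
  note k = k[folded \<sigma>_def]
  have \<mu>: "0 < \<mu>" "\<mu> \<le> 1" "\<mu> + real r * \<mu> = 1" by (auto simp: \<mu>_def field_simps)
  have \<sigma>: "0 < \<sigma>" "\<sigma> \<le> 1" using s by (auto simp: \<sigma>_def)
  have \<sigma>_eq: "\<sigma> = \<mu> * s" by (simp add: \<sigma>_def \<mu>_def)
  let ?B = "\<lambda>s. cube \<phi> s"
  have sets: "pbox \<phi> s \<in> sets lebesgue" for s by (rule sets_lebesgue_pbox[OF db])
  have \<phi>e: "\<phi> j (x + t *\<^sub>R e i) = (if j = i then \<phi> j x + t else \<phi> j x)" for i j x t
    by (simp add: dual_basis_simps[OF db] dual_basis_apply[OF db])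
  have \<phi>e': "\<phi> j (x - t *\<^sub>R e i) = (if j = i then \<phi> j x - t else \<phi> j x)" for i j x t
    by (simp add: dual_basis_simps[OF db] dual_basis_apply[OF db])
  have shift: "x + t *\<^sub>R e i \<in> ?B 1" if "x \<in> ?B \<mu>" "\<bar>t\<bar> \<le> real r * \<mu>" for x t i
    using that(2) \<mu> by (intro cube_shift[OF db that(1)]) simp
  have \<omega>: "0 \<le> \<omega>" using Lp_leD(3)[OF D[of "1 / real r"]] r by simp
  have D_pos: "Lp_le p (?B \<mu>) (fin_diff r (u *\<^sub>R e i) f) \<omega>" if u: "0 < u" "u \<le> \<mu>" for u i
  proof -
    have "real r * u \<le> real r * \<mu>" using u by (intro mult_left_mono) auto
    then have ru: "\<bar>real r * u\<bar> \<le> real r * \<mu>" "real r * u \<le> 2" using u \<mu> by auto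
    show ?thesis
      by (rule Lp_le_subset[OF p D[OF u(1) ru(2)] sets])
        (use shift[OF _ ru(1)] shift[of _ 0] \<mu> in auto)
  qed
  \<comment> \<open>The small-box inequality ranges over all |u| <= \<mu>, the modulus over u > 0.
    At u = 0 the difference vanishes; for u < 0 it is reflected to the other end point.\<close>
  have D\<mu>: "Lp_le p (?B \<mu>) (fin_diff r (u *\<^sub>R e i) f) \<omega>" if u: "\<bar>u\<bar> \<le> \<mu>" for u i
  proof (cases u "0 :: real" rule: linorder_cases)
    case greater
    then show ?thesis using D_pos[of u i] u by simp
  next
    case equal
    have "Lp_le p (?B \<mu>) (\<lambda>x. 0) \<omega>" by (rule Lp_le_weaken[OF p Lp_le_zero[OF p sets] \<omega>])
    moreover have "fin_diff r 0 f = (\<lambda>x. 0)" using r by (simp add: fun_eq_iff fin_diff_zero_direction)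
    ultimately show ?thesis using equal by simp
  next
    case less
    have "real r * - u \<le> real r * \<mu>" using u by (intro mult_left_mono) auto
    then have ru: "\<bar>real r * u\<bar> \<le> real r * \<mu>" "real r * - u \<le> 2"
      using less \<mu> r by (auto simp: abs_mult)
    have "Lp_le p (?B \<mu>) (\<lambda>x. fin_diff r (- u *\<^sub>R e i) f (x + (real r * u) *\<^sub>R e i)) \<omega>"
    proof (rule Lp_le_shift[OF p D[of "- u" i] sets])
      show "0 < - u" "real r * - u \<le> 2" using less ru by auto
      fix x assume x: "x \<in> ?B \<mu>"
      then show "x + (real r * u) *\<^sub>R e i \<in> {x \<in> ?B 1. x + (real r * - u) *\<^sub>R e i \<in> ?B 1}"
        using shift[OF x ru(1)] shift[OF x, of 0] \<mu> by simp
    qed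
    from Lp_le_cmult[OF p this, of "(-1) ^ r"] show ?thesis
      using fin_diff_uminus_direction[of r "- u *\<^sub>R e i" f, abs_def] by (simp add: fun_eq_iff)
  qed
  have e\<mu>: "dual_basis (\<lambda>i. \<mu> *\<^sub>R e i) (\<lambda>i x. \<phi> i x / \<mu>)" by (rule dual_basis_scale[OF db \<mu>(1)])
  have b\<mu>: "cube (\<lambda>i x. \<phi> i x / \<mu>) s = ?B (\<mu> * s)" for s by (rule pbox_scale[OF \<mu>(1)])
  have "\<exists>Q\<in>mpolys (\<lambda>i. \<mu> *\<^sub>R e i) (\<lambda>_. r). Lp_le p (cube (\<lambda>i x. \<phi> i x / \<mu>) s) (\<lambda>x. f x - Q x) (C0 * \<omega>)"
  proof (rule whitney_smallD[OF small e\<mu> f])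
    show "Lp_le p (cube (\<lambda>i x. \<phi> i x / \<mu>) 1) f B"
      unfolding b\<mu> by (rule Lp_le_subset[OF p B sets pbox_mono]) (use \<mu> in simp)
    fix i and u :: real assume "\<bar>u\<bar> \<le> 1"
    then have "\<bar>u * \<mu>\<bar> \<le> \<mu>" using \<mu>(1) by (simp add: abs_mult mult_le_cancel_right1)
    from D\<mu>[OF this, of i]
    show "Lp_le p (cube (\<lambda>i x. \<phi> i x / \<mu>) 1) (fin_diff r (u *\<^sub>R \<mu> *\<^sub>R e i) f) \<omega>"
      unfolding b\<mu> by simp
  qed
  then obtain Q where Q: "Q \<in> mpolys e (\<lambda>_. r)" and Q_le: "Lp_le p (?B \<sigma>) (\<lambda>x. f x - Q x) (C0 * \<omega>)"
    using \<mu>(1) by (auto simp: b\<mu> mpolys_scale \<sigma>_eq)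
  define g where "g x = f x - Q x" for x
  have g_diff: "fin_diff r (u *\<^sub>R e i) g = fin_diff r (u *\<^sub>R e i) f" for u i
    using mpolys_fin_diff_eq_0[OF Q, where i=i and u=u] by (simp add: fun_eq_iff g_def[abs_def] fin_diff_diff)
  \<comment> \<open>Interpolates between \<open>cube \<phi> \<sigma>\<close> for empty J and
    \<open>cube \<phi> 1\<close> for J = \<open>UNIV\<close>.\<close>
  define Y where "Y J = pbox \<phi> (\<lambda>i. if i \<in> J then 1 else \<sigma>)" for J
  have Y1: "Y J \<subseteq> ?B 1" for J unfolding Y_def using \<sigma> by (intro pbox_mono) auto
  have g_le: "Lp_le p (Y J) g (whitney_const p r (card J) k C0 * \<omega>)" for J
    using finite[of J]
  proof (induction J)
    case empty
    then show ?case using Q_le by (simp add: Y_def whitney_const_def g_def[abs_def])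
  next
    case (insert j J)
    have "Lp_le p (Y (insert j J)) g (extend_const p r k * (whitney_const p r (card J) k C0 * \<omega> + \<omega>))"
    proof (rule extend_along_direction[OF p r \<sigma>(1) k, where \<phi>="\<phi> j" and e="e j"])
      show "\<phi> j (x + t *\<^sub>R e j) = \<phi> j x + t" for x t by (simp add: \<phi>e)
      show "\<phi> j \<in> borel_measurable lebesgue" by (rule dual_basis_measurable[OF db])
      show "Y (insert j J) \<in> sets lebesgue" unfolding Y_def by (rule sets)
      show "\<bar>\<phi> j x\<bar> \<le> 1" if "x \<in> Y (insert j J)" for x using that Y1 by (auto simp: pbox_def)
      show "segments_to_slab (Y (insert j J)) (e j) (\<phi> j) \<sigma>"
        unfolding segments_to_slab_def
      proof (intro conjI ballI impI allI)
        fix x t assume x: "x \<in> Y (insert j J)" "\<phi> j x < - \<sigma>" "0 \<le> t" "\<phi> j x + t \<le> \<sigma>"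
        have "\<bar>\<phi> i (x + t *\<^sub>R e j)\<bar> \<le> (if i \<in> insert j J then 1 else \<sigma>)" for i
        proof -
          have "\<bar>\<phi> i x\<bar> \<le> (if i \<in> insert j J then 1 else \<sigma>)" using x(1) by (simp add: Y_def pbox_def)
          then show ?thesis using x(2-4) \<sigma> by (auto simp: \<phi>e)
        qed
        then show "x + t *\<^sub>R e j \<in> Y (insert j J)" by (simp add: Y_def pbox_def)
      next
        fix x t assume x: "x \<in> Y (insert j J)" "\<sigma> < \<phi> j x" "0 \<le> t" "- \<sigma> \<le> \<phi> j x - t"
        have "\<bar>\<phi> i (x - t *\<^sub>R e j)\<bar> \<le> (if i \<in> insert j J then 1 else \<sigma>)" for i
        proof -
          have "\<bar>\<phi> i x\<bar> \<le> (if i \<in> insert j J then 1 else \<sigma>)" using x(1) by (simp add: Y_def pbox_def)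
          then show ?thesis using x(2-4) \<sigma> by (auto simp: \<phi>e')
        qed
        then show "x - t *\<^sub>R e j \<in> Y (insert j J)" by (simp add: Y_def pbox_def)
      qed
      \<comment> \<open>Cutting the widened box back to |\<phi> j| <= \<sigma> returns the box of
        the previous stage.\<close>
      have "Y (insert j J) \<inter> {x. \<bar>\<phi> j x\<bar> \<le> \<sigma>} \<subseteq> Y J"
        using insert.hyps by (auto simp: Y_def pbox_def split: if_splits)
      moreover have "Y (insert j J) \<inter> {x. \<bar>\<phi> j x\<bar> \<le> \<sigma>} = pbox \<phi> (\<lambda>i. if i \<in> J then 1 else \<sigma>)"
        using insert.hyps \<sigma> by (fastforce simp: Y_def pbox_def split: if_splits)
      ultimately show "Lp_le p (Y (insert j J) \<inter> {x. \<bar>\<phi> j x\<bar> \<le> \<sigma>}) g (whitney_const p r (card J) k C0 * \<omega>)"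
        using Lp_le_subset[OF p insert.IH] by (simp add: sets)
      have "Lp_le p {x \<in> ?B 1. x + (real r * (2 * \<sigma> / real r)) *\<^sub>R e j \<in> ?B 1} (fin_diff r ((2 * \<sigma> / real r) *\<^sub>R e j) f) \<omega>"
        using \<sigma> r by (intro D) auto
      then have *: "Lp_le p {x \<in> ?B 1. x + (2 * \<sigma>) *\<^sub>R e j \<in> ?B 1} (fin_diff r ((2 * \<sigma> / real r) *\<^sub>R e j) g) \<omega>"
        using r by (simp add: g_diff)
      have "{x \<in> Y (insert j J). x + (2 * \<sigma>) *\<^sub>R e j \<in> Y (insert j J)} = Y (insert j J) \<inter> {x. x + (2 * \<sigma>) *\<^sub>R e j \<in> Y (insert j J)}"
        by blast
      also have "\<dots> \<in> sets lebesgue" unfolding Y_def by (intro sets.Int lebesgue_sets_shift sets)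
      finally show "Lp_le p {x \<in> Y (insert j J). x + (2 * \<sigma>) *\<^sub>R e j \<in> Y (insert j J)}
          (fin_diff r ((2 * \<sigma> / real r) *\<^sub>R e j) g) \<omega>"
        by (rule Lp_le_subset[OF p *]) (use Y1 in auto)
    qed
    then show ?case using insert.hyps by (simp add: whitney_const_def algebra_simps)
  qed
  have "Lp_le p (?B 1) (\<lambda>x. f x - Q x) (whitney_const p r CARD('i) k C0 * \<omega>)"
    using g_le[of UNIV] by (simp add: Y_def g_def[abs_def])
  then show ?thesis using Q by blast
qed

text \<open>The coordinate \<open>j\<close> plays the role of the vertical one: \<open>Y\<close> is the region between the two graphs, and
  the unit box is the parallelepiped inside it.\<close>

lemma whitney_region:
  fixes e :: "'i::finite \<Rightarrow> 'a::euclidean_space"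
  assumes p: "0 < p" and r: "1 \<le> r"
    and small: "whitney_small p TYPE('a) (\<lambda>_::'i. r) C0 s" "0 < s" "s \<le> 1"
    and k: "1 < real k * (2 * (s / (real r + 1)) / real r)" and l: "\<Lambda> < real l * (2 * 1 / real r)"
    and db: "dual_basis e \<phi>" and f: "f \<in> borel_measurable lebesgue" and Y: "Y \<in> sets lebesgue"
    and B: "Lp_le p Y f B" and sub: "cube \<phi> 1 \<subseteq> Y" "Y \<subseteq> pbox \<phi> (\<lambda>i. if i = j then \<Lambda> else 1)"
    and seg: "segments_to_slab Y (e j) (\<phi> j) 1"
    and D: "\<And>i u. i \<noteq> j \<Longrightarrow> 0 < u \<Longrightarrow> real r * u \<le> 2 \<Longrightarrow>
      Lp_le p {x \<in> cube \<phi> 1. x + (real r * u) *\<^sub>R e i \<in> cube \<phi> 1} (fin_diff r (u *\<^sub>R e i) f) \<omega>"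
    and Dj: "\<And>u. 0 < u \<Longrightarrow> real r * u \<le> 2 \<Longrightarrow>
      Lp_le p {x \<in> Y. x + (real r * u) *\<^sub>R e j \<in> Y} (fin_diff r (u *\<^sub>R e j) f) \<omega>"
  shows "\<exists>Q\<in>mpolys e (\<lambda>_. r). Lp_le p Y (\<lambda>x. f x - Q x)
    (extend_const p r l * (whitney_const p r CARD('i) k C0 + 1) * \<omega>)"
proof -
  define C where "C = whitney_const p r CARD('i) k C0"
  let ?S = "cube \<phi> 1"
  have S: "?S \<in> sets lebesgue" by (rule sets_lebesgue_pbox[OF db])
  have "\<exists>Q\<in>mpolys e (\<lambda>_. r). Lp_le p ?S (\<lambda>x. f x - Q x) (C * \<omega>)"
    unfolding C_def
  proof (rule whitney_pbox[OF p r small k db f Lp_le_subset[OF p B S sub(1)]])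
    fix i and u :: real assume u: "0 < u" "real r * u \<le> 2"
    show "Lp_le p {x \<in> ?S. x + (real r * u) *\<^sub>R e i \<in> ?S} (fin_diff r (u *\<^sub>R e i) f) \<omega>"
    proof (cases "i = j")
      case False
      then show ?thesis by (rule D[OF _ u])
    next
      case True
      \<comment> \<open>Vertical differences inside the unit box are among those of
        \<open>Y\<close>, so the vertical modulus over the region serves both the box and the
        extension.\<close>
      have "{x \<in> ?S. x + (real r * u) *\<^sub>R e i \<in> ?S} = ?S \<inter> {x. x + (real r * u) *\<^sub>R e i \<in> ?S}" by blast
      also have "\<dots> \<in> sets lebesgue" by (intro sets.Int lebesgue_sets_shift S)
      finally show ?thesis unfolding True
        by (rule Lp_le_subset[OF p Dj[OF u]]) (use sub in auto)
    qed
  qed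
  then obtain Q where Q: "Q \<in> mpolys e (\<lambda>_. r)" and Q_le: "Lp_le p ?S (\<lambda>x. f x - Q x) (C * \<omega>)"
    by blast
  have g_diff: "fin_diff r (u *\<^sub>R e j) (\<lambda>x. f x - Q x) = fin_diff r (u *\<^sub>R e j) f" for u
    using mpolys_fin_diff_eq_0[OF Q, where i=j and u=u] by (simp add: fun_eq_iff fin_diff_diff)
  \<comment> \<open>Here \<sigma> = 1: the part of \<open>Y\<close> with |\<phi> j| <= 1 is exactly
    the unit box.\<close>
  have "Lp_le p Y (\<lambda>x. f x - Q x) (extend_const p r l * (C * \<omega> + \<omega>))"
  proof (rule extend_along_direction[OF p r zero_less_one l, where \<phi>="\<phi> j" and e="e j"])
    show "\<phi> j (x + t *\<^sub>R e j) = \<phi> j x + t" for x t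
      by (simp add: dual_basis_simps[OF db] dual_basis_apply[OF db])
    show "\<phi> j \<in> borel_measurable lebesgue" by (rule dual_basis_measurable[OF db])
    show "\<bar>\<phi> j x\<bar> \<le> \<Lambda>" if "x \<in> Y" for x
    proof -
      have "\<bar>\<phi> j x\<bar> \<le> (if j = j then \<Lambda> else 1)" using subsetD[OF sub(2) that] unfolding pbox_def by blast
      then show ?thesis by simp
    qed
    have "Y \<inter> {x. \<bar>\<phi> j x\<bar> \<le> 1} = ?S"
      using sub by (fastforce simp: pbox_def split: if_splits)
    then show "Lp_le p (Y \<inter> {x. \<bar>\<phi> j x\<bar> \<le> 1}) (\<lambda>x. f x - Q x) (C * \<omega>)" using Q_le by simp
    show "Lp_le p {x \<in> Y. x + (2 * 1) *\<^sub>R e j \<in> Y} (fin_diff r ((2 * 1 / real r) *\<^sub>R e j) (\<lambda>x. f x - Q x)) \<omega>"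
      using Dj[of "2 / real r"] r by (simp add: g_diff)
  qed (fact Y seg)+
  then have "Lp_le p Y (\<lambda>x. f x - Q x) (extend_const p r l * (C + 1) * \<omega>)" by (simp add: algebra_simps)
  then show ?thesis using Q unfolding C_def by blast
qed

lemma Lp_norm_cong:
  assumes "\<And>x. x \<in> A \<Longrightarrow> f x = g x"
  shows "Lp_norm p A f = Lp_norm p A g"
proof -
  \<comment> \<open>\<open>esssup\<close> is defined by cases on measurability, so measurability has
    to be transferred along with the limit superior.\<close>
  have "(\<lambda>x. ennreal \<bar>f x\<bar>) \<in> borel_measurable (lebesgue_on A) \<longleftrightarrow> (\<lambda>x. ennreal \<bar>g x\<bar>) \<in> borel_measurable (lebesgue_on A)"
    by (rule measurable_cong) (simp add: assms)
  moreover have "Limsup (ae_filter (lebesgue_on A)) (\<lambda>x. ennreal \<bar>f x\<bar>) = Limsup (ae_filter (lebesgue_on A)) (\<lambda>x. ennreal \<bar>g x\<bar>)"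
    by (rule Limsup_eq) (use AE_space[of "lebesgue_on A"] assms in \<open>auto elim!: eventually_mono\<close>)
  ultimately have "esssup (lebesgue_on A) (\<lambda>x. ennreal \<bar>f x\<bar>) = esssup (lebesgue_on A) (\<lambda>x. ennreal \<bar>g x\<bar>)"
    unfolding esssup_def by simp
  moreover have "(\<integral>\<^sup>+ x. ennreal (\<bar>f x\<bar> powr enn2real p) \<partial>lebesgue_on A) = (\<integral>\<^sup>+ x. ennreal (\<bar>g x\<bar> powr enn2real p) \<partial>lebesgue_on A)"
    by (rule nn_integral_cong) (simp add: assms)
  ultimately show ?thesis by (simp add: Lp_norm_def)
qed

section \<open>Coordinates adapted to the parallelepiped\<close>

lemma exists_dual_basis:
  fixes v :: "'d::finite \<Rightarrow> real ^ 'd"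
  assumes "inj v" "independent (range v)"
  obtains \<psi> where "dual_basis v \<psi>"
proof -
  have "dim (UNIV :: (real ^ 'd) set) = card (range v)"
    using assms(1) by (simp add: card_image)
  then have span: "span (range v) = UNIV"
    using card_eq_dim[of "range v" UNIV] assms(2) by auto
  define \<psi> where "\<psi> i x = representation (range v) x (v i)" for i x
  have "dual_basis v \<psi>"
    unfolding dual_basis_def
  proof (intro conjI allI)
    show "linear (\<psi> i)" for i
      by (rule linearI) (simp_all add: \<psi>_def span representation_add[OF assms(2)] representation_scale[OF assms(2)])
    show "\<psi> i (v j) = (if i = j then 1 else 0)" for i j
      using assms(1) by (auto simp: \<psi>_def representation_basis[OF assms(2)] inj_eq)
    show "(\<Sum>i\<in>UNIV. \<psi> i x *\<^sub>R v i) = x" for x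
    proof -
      have "(\<Sum>b\<in>range v. representation (range v) x b *\<^sub>R b) = x"
        by (rule sum_representation_eq) (use assms span in auto)
      then show ?thesis using assms(1) by (simp add: sum.reindex \<psi>_def)
    qed
  qed
  then show ?thesis by (rule that)
qed

lemma mem_parallelepiped_iff:
  fixes v :: "'d::finite \<Rightarrow> 'a::euclidean_space"
  assumes "dual_basis v \<psi>"
  shows "x \<in> parallelepiped a v \<longleftrightarrow> (\<forall>i. 0 \<le> \<psi> i (x - a) \<and> \<psi> i (x - a) \<le> 1)"
proof
  assume "x \<in> parallelepiped a v"
  then obtain t where t: "x = a + (\<Sum>i\<in>UNIV. t i *\<^sub>R v i)" "\<forall>i. 0 \<le> t i \<and> t i \<le> 1"
    by (auto simp: parallelepiped_def)
  then have "\<psi> i (x - a) = t i" for i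
    using dual_basis_combination[OF assms, where i=i and J=UNIV and t=t] by simp
  with t(2) show "\<forall>i. 0 \<le> \<psi> i (x - a) \<and> \<psi> i (x - a) \<le> 1" by simp
next
  assume "\<forall>i. 0 \<le> \<psi> i (x - a) \<and> \<psi> i (x - a) \<le> 1"
  moreover have "x = a + (\<Sum>i\<in>UNIV. \<psi> i (x - a) *\<^sub>R v i)" by (simp add: dual_basis_sum[OF assms])
  ultimately show "x \<in> parallelepiped a v"
    unfolding parallelepiped_def by (intro CollectI exI[of _ "\<lambda>i. \<psi> i (x - a)"] conjI)
qed

lemma sum_option_UNIV: "(\<Sum>i\<in>UNIV. F i) = F None + (\<Sum>i\<in>UNIV. F (Some i))"
  for F :: "'d::finite option \<Rightarrow> 'b::comm_monoid_add"
  by (simp add: UNIV_option_conv sum.reindex)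

text \<open>Half the edge vectors of the parallelepiped \<open>S\<close>, \<open>None\<close> standing for the vertical one.\<close>

definition half_edges :: "('d \<Rightarrow> real ^ 'd) \<Rightarrow> real ^ 'd \<Rightarrow> real \<Rightarrow> 'd::finite option \<Rightarrow> (real ^ 'd) \<times> real" where
  "half_edges v h \<delta> k = (case k of None \<Rightarrow> (0, \<delta>) | Some i \<Rightarrow> (1 / 2) *\<^sub>R (v i, h \<bullet> v i))"

text \<open>Dual to \<open>half_edges\<close>: the vertical coordinate is the height above the graph
  of the linear part of H in units of \<delta>, and the factor 2 compensates for halving the
  edges.\<close>

definition half_edge_coords :: "('d \<Rightarrow> real ^ 'd \<Rightarrow> real) \<Rightarrow> real ^ 'd \<Rightarrow> real \<Rightarrow> 'd::finite option \<Rightarrow> (real ^ 'd) \<times> real \<Rightarrow> real" where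
  "half_edge_coords \<psi> h \<delta> k z = (case k of None \<Rightarrow> (snd z - h \<bullet> fst z) / \<delta> | Some i \<Rightarrow> 2 * \<psi> i (fst z))"

lemma dual_basis_half_edges:
  assumes db: "dual_basis v \<psi>" and \<delta>: "0 < \<delta>"
  shows "dual_basis (half_edges v h \<delta>) (half_edge_coords \<psi> h \<delta>)"
  unfolding dual_basis_def
proof (intro conjI allI)
  fix k
  show "linear (half_edge_coords \<psi> h \<delta> k)"
    by (rule linearI) (auto simp: half_edge_coords_def dual_basis_simps[OF db] inner_add_right algebra_simps
        add_divide_distrib diff_divide_distrib split: option.splits)
next
  fix k l
  show "half_edge_coords \<psi> h \<delta> k (half_edges v h \<delta> l) = (if k = l then 1 else 0)"
    using \<delta> by (auto simp: half_edge_coords_def half_edges_def dual_basis_simps[OF db] dual_basis_apply[OF db] split: option.splits)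
next
  fix z :: "(real ^ 'a) \<times> real"
  have x: "(\<Sum>i\<in>UNIV. \<psi> i (fst z) *\<^sub>R v i) = fst z" by (rule dual_basis_sum[OF db])
  have "(\<Sum>i\<in>UNIV. half_edge_coords \<psi> h \<delta> (Some i) z *\<^sub>R half_edges v h \<delta> (Some i))
      = (\<Sum>i\<in>UNIV. (\<psi> i (fst z) *\<^sub>R v i, h \<bullet> (\<psi> i (fst z) *\<^sub>R v i)))"
    by (simp add: half_edge_coords_def half_edges_def)
  also have "\<dots> = (fst z, h \<bullet> fst z)"
  proof (rule prod_eqI)
    show "fst (\<Sum>i\<in>UNIV. (\<psi> i (fst z) *\<^sub>R v i, h \<bullet> (\<psi> i (fst z) *\<^sub>R v i))) = fst (fst z, h \<bullet> fst z)"
      by (simp only: fst_sum fst_conv x)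
    show "snd (\<Sum>i\<in>UNIV. (\<psi> i (fst z) *\<^sub>R v i, h \<bullet> (\<psi> i (fst z) *\<^sub>R v i))) = snd (fst z, h \<bullet> fst z)"
      by (simp only: snd_sum snd_conv inner_sum_right[symmetric] x)
  qed
  finally show "(\<Sum>k\<in>UNIV. half_edge_coords \<psi> h \<delta> k z *\<^sub>R half_edges v h \<delta> k) = z"
    using \<delta> unfolding sum_option_UNIV
    by (simp add: half_edge_coords_def half_edges_def prod_eq_iff)
qed

lemma lift_direction_sgn: "lift_direction h (sgn w) = sgn (w, h \<bullet> w)"
proof (cases "w = 0")
  case True
  then show ?thesis by (simp add: lift_direction_def sgn_zero zero_prod_def[symmetric])
next
  case False
  have "(sgn w, h \<bullet> sgn w) = (1 / norm w) *\<^sub>R (w, h \<bullet> w)"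
    by (simp add: sgn_div_norm divide_inverse_commute)
  then have "sgn (sgn w, h \<bullet> sgn w) = sgn ((1 / norm w) *\<^sub>R (w, h \<bullet> w))" by (simp only:)
  also have "\<dots> = sgn (w, h \<bullet> w)" using False by (subst sgn_scaleR) simp
  finally show ?thesis by (simp only: lift_direction_def)
qed

lemma half_edges_eq_scaleR_direction:
  "half_edges v h \<delta> (Some i) = norm (half_edges v h \<delta> (Some i)) *\<^sub>R lift_direction h (sgn (v i))"
proof -
  have "lift_direction h (sgn (v i)) = sgn (half_edges v h \<delta> (Some i))"
    unfolding lift_direction_sgn half_edges_def by (simp only: option.case sgn_scaleR) simp
  then show ?thesis by (metis norm_scaleR scaleR_zero_left sgn_div_norm divideR_right norm_eq_zero)
qed

text \<open>Passes from the directions and closed segments of \<open>dir_modulus\<close> to basis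
  vectors and end points. By \<open>seg\<close> the two domains coincide, and the step u along e is
  u \<kappa> along d, which has to stay below the diameter. F may differ from f outside Y, since
  every node lies on the segment.\<close>

lemma dir_modulus_step:
  fixes e :: "'a::euclidean_space"
  assumes p: "0 < p" and le: "dir_modulus r f Y E p \<le> ennreal \<omega>" and \<omega>: "0 \<le> \<omega>"
    and d: "d \<in> E" "e = \<kappa> *\<^sub>R d" "0 < \<kappa>" and u: "0 < u" "u * \<kappa> \<le> diameter Y"
    and Y: "Y \<in> sets lebesgue"
    and seg: "\<And>x. x \<in> Y \<Longrightarrow> x + (real r * u) *\<^sub>R e \<in> Y \<Longrightarrow> closed_segment x (x + (real r * u) *\<^sub>R e) \<subseteq> Y"
    and F: "F \<in> borel_measurable lebesgue" "\<And>x. x \<in> Y \<Longrightarrow> F x = f x"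
  shows "Lp_le p {x \<in> Y. x + (real r * u) *\<^sub>R e \<in> Y} (fin_diff r (u *\<^sub>R e) F) \<omega>"
proof -
  let ?Z = "{x \<in> Y. x + (real r * u) *\<^sub>R e \<in> Y}"
  have Z: "?Z = {\<xi>\<in>Y. closed_segment \<xi> (\<xi> + (real r * (u * \<kappa>)) *\<^sub>R d) \<subseteq> Y}"
    using seg d(2) by (auto simp: mult.assoc)
  have "Lp_norm p ?Z (fin_diff r ((u * \<kappa>) *\<^sub>R d) f) \<le> dir_modulus r f Y E p"
    unfolding dir_modulus_def Z
    by (rule SUP_upper2[OF d(1)], rule SUP_upper) (use u d(3) in auto)
  also have "\<dots> \<le> ennreal \<omega>" by (rule le)
  finally have "Lp_norm p ?Z (fin_diff r (u *\<^sub>R e) f) \<le> ennreal \<omega>" using d(2) by simp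
  moreover have "Lp_norm p ?Z (fin_diff r (u *\<^sub>R e) F) = Lp_norm p ?Z (fin_diff r (u *\<^sub>R e) f)"
  proof (rule Lp_norm_cong)
    fix x assume x: "x \<in> ?Z"
    have "F (x + real j *\<^sub>R u *\<^sub>R e) = f (x + real j *\<^sub>R u *\<^sub>R e)" if "j \<le> r" for j
    proof (rule F(2))
      show "x + real j *\<^sub>R u *\<^sub>R e \<in> Y"
      proof (cases "r = 0")
        case True
        then show ?thesis using x that by simp
      next
        case False
        have "x + real j *\<^sub>R u *\<^sub>R e = (1 - real j / real r) *\<^sub>R x + (real j / real r) *\<^sub>R (x + (real r * u) *\<^sub>R e)"
          using False by (simp add: algebra_simps)
        then have "x + real j *\<^sub>R u *\<^sub>R e \<in> closed_segment x (x + (real r * u) *\<^sub>R e)"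
          unfolding closed_segment_def using that False by (auto intro!: exI[of _ "real j / real r"])
        then show ?thesis using seg x by blast
      qed
    qed
    then show "fin_diff r (u *\<^sub>R e) F x = fin_diff r (u *\<^sub>R e) f x"
      unfolding fin_diff_def by (intro sum.cong) auto
  qed
  moreover have "?Z = Y \<inter> {x. x + (real r * u) *\<^sub>R e \<in> Y}" by blast
  then have "?Z \<in> sets lebesgue" using lebesgue_sets_shift[OF Y] Y by simp
  ultimately show ?thesis
    by (intro Lp_norm_leD[OF p _ \<omega>] borel_measurable_fin_diff F) auto
qed

lemma convex_pbox:
  assumes db: "dual_basis e \<phi>"
  shows "convex (pbox \<phi> s)"
  unfolding convex_alt
proof (intro ballI allI impI)
  fix x y and t :: real assume xy: "x \<in> pbox \<phi> s" "y \<in> pbox \<phi> s" and t: "0 \<le> t \<and> t \<le> 1"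
  have "\<bar>(1 - t) * \<phi> i x + t * \<phi> i y\<bar> \<le> s i" for i
  proof -
    have "\<bar>(1 - t) * \<phi> i x\<bar> \<le> (1 - t) * s i" "\<bar>t * \<phi> i y\<bar> \<le> t * s i"
      using xy t by (auto simp: pbox_def abs_mult intro!: mult_left_mono)
    moreover have "(1 - t) * s i + t * s i = s i" by (simp add: algebra_simps)
    ultimately show ?thesis by linarith
  qed
  then show "(1 - t) *\<^sub>R x + t *\<^sub>R y \<in> pbox \<phi> s"
    by (simp add: pbox_def dual_basis_simps[OF db])
qed

theorem theorem5p5:
  fixes p :: ennreal and r :: nat and L :: real
  assumes "0 < p" and "1 \<le> r" and "1 < L"
  shows "\<exists>C::real. 0 < C \<and>
    (\<forall>(a :: real ^ 'd) (v :: 'd \<Rightarrow> real ^ 'd) (g1 :: real ^ 'd \<Rightarrow> real) (g2 :: real ^ 'd \<Rightarrow> real)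
      (h :: real ^ 'd) (c :: real) (\<delta> :: real) D H G S E.
       inj v \<longrightarrow> independent (range v) \<longrightarrow>
       D = parallelepiped a v \<longrightarrow>
       G = region_between D g1 g2 \<longrightarrow>
       G \<in> sets lebesgue \<longrightarrow>
       H = (\<lambda>x. h \<bullet> x + c) \<longrightarrow>
       0 < \<delta> \<longrightarrow>
       (\<forall>x\<in>D. \<delta> \<le> (- 1) ^ 1 * (g1 x - H x) \<and> (- 1) ^ 1 * (g1 x - H x) \<le> L * \<delta>) \<longrightarrow>
       (\<forall>x\<in>D. \<delta> \<le> (- 1) ^ 2 * (g2 x - H x) \<and> (- 1) ^ 2 * (g2 x - H x) \<le> L * \<delta>) \<longrightarrow>
       S = region_between D (\<lambda>x. H x - \<delta>) (\<lambda>x. H x + \<delta>) \<longrightarrow>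
       E = lift_direction h ` edge_directions v \<longrightarrow>
       S \<subseteq> G \<and>
       (\<forall>f :: (real ^ 'd) \<times> real \<Rightarrow> real. in_Lp p G f \<longrightarrow>
          best_approx r f (E \<union> {(0, 1)}) p G
            \<le> ennreal C * (dir_modulus r f S E p + dir_modulus r f G {(0, 1)} p)))"
proof -
  have r: "0 < r" using assms(2) by simp
  obtain C0 s where C0: "0 < C0" and s: "0 < s" "s \<le> 1"
    and small: "whitney_small p TYPE((real ^ 'd) \<times> real) (\<lambda>_::'d option. r) C0 s"
    using whitney_small_box[OF assms(1) r, where 'i="'d option" and 'a="(real ^ 'd) \<times> real"] by blast
  have "0 < 2 * (s / (real r + 1)) / real r" "0 < 2 * 1 / real r" using r s by simp_all
  \<comment> \<open>Numbers of extension rounds, to half-width 1 inside the box and to height L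
    vertically. They depend on s, r and L, and s was obtained from p, r and the dimension, so C is
    the same for all parallelepipeds.\<close>
  then obtain k l where k: "1 < real k * (2 * (s / (real r + 1)) / real r)" and l: "L < real l * (2 * 1 / real r)"
    using reals_Archimedean3 by metis
  define C where "C = extend_const p r l * (whitney_const p r CARD('d option) k C0 + 1)"
  have C: "0 < C"
    unfolding C_def using whitney_const_pos[OF C0] by (intro mult_pos_pos extend_const_pos add_pos_pos) auto
  note region = whitney_region[OF assms(1,2) small s k l, folded C_def]
  have main: "S \<subseteq> G \<and> (\<forall>f :: (real ^ 'd) \<times> real \<Rightarrow> real. in_Lp p G f \<longrightarrow>
      best_approx r f (E \<union> {(0, 1)}) p G \<le> ennreal C * (dir_modulus r f S E p + dir_modulus r f G {(0, 1)} p))"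
    if v: "inj v" "independent (range v)" and D: "D = parallelepiped a v" and G: "G = region_between D g1 g2"
      and G_leb: "G \<in> sets lebesgue" and H: "H = (\<lambda>x. h \<bullet> x + c)" and \<delta>: "0 < \<delta>"
      and g1: "\<forall>x\<in>D. \<delta> \<le> (- 1) ^ 1 * (g1 x - H x) \<and> (- 1) ^ 1 * (g1 x - H x) \<le> L * \<delta>"
      and g2: "\<forall>x\<in>D. \<delta> \<le> (- 1) ^ 2 * (g2 x - H x) \<and> (- 1) ^ 2 * (g2 x - H x) \<le> L * \<delta>"
      and S: "S = region_between D (\<lambda>x. H x - \<delta>) (\<lambda>x. H x + \<delta>)"
      and E: "E = lift_direction h ` edge_directions v"
    for a :: "real ^ 'd" and v :: "'d \<Rightarrow> real ^ 'd" and g1 g2 :: "real ^ 'd \<Rightarrow> real" and h c \<delta> D H G S E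
  proof -
    obtain \<psi> where \<psi>: "dual_basis v \<psi>" using exists_dual_basis[OF v] .
    define e where "e = half_edges v h \<delta>"
    define \<phi> where "\<phi> = half_edge_coords \<psi> h \<delta>"
    have db: "dual_basis e \<phi>" unfolding e_def \<phi>_def by (rule dual_basis_half_edges[OF \<psi> \<delta>])
    note \<phi>_simps = dual_basis_simps[OF db] dual_basis_apply[OF db]
    \<comment> \<open>The centre of D, and below it that of S. Subtracting z0 turns S into
      \<open>cube \<phi> 1\<close> and bounds the vertical coordinate on G by L.\<close>
    define x0 where "x0 = a + (1 / 2) *\<^sub>R (\<Sum>i\<in>UNIV. v i)"
    define z0 where "z0 = (x0, H x0)"
    have \<psi>0: "\<psi> i (x - x0) = \<psi> i (x - a) - 1 / 2" for i x
      using dual_basis_combination[OF \<psi>, where i=i and J=UNIV and t="\<lambda>_. 1"]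
      by (simp add: x0_def dual_basis_simps[OF \<psi>])
    have \<phi>_Some: "\<phi> (Some i) (z - z0) = 2 * \<psi> i (fst z - a) - 1" for i z
      by (simp add: \<phi>_def half_edge_coords_def z0_def \<psi>0)
    have \<phi>_None: "\<phi> None (z - z0) = (snd z - H (fst z)) / \<delta>" for z
      by (simp add: \<phi>_def half_edge_coords_def z0_def H inner_diff_right algebra_simps)
    have mem_D: "x \<in> D \<longleftrightarrow> (\<forall>i. \<bar>\<phi> (Some i) ((x, y) - z0)\<bar> \<le> 1)" for x y
      unfolding D mem_parallelepiped_iff[OF \<psi>] \<phi>_Some by (auto simp: abs_le_iff)
    have mem_pbox: "z - z0 \<in> pbox \<phi> s \<longleftrightarrow> \<bar>\<phi> None (z - z0)\<bar> \<le> s None \<and> (\<forall>i. \<bar>\<phi> (Some i) (z - z0)\<bar> \<le> s (Some i))" for z s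
      unfolding pbox_def by (auto simp: split_option_all)
    have mem_S: "z \<in> S \<longleftrightarrow> z - z0 \<in> cube \<phi> 1" for z
    proof -
      have "z \<in> S \<longleftrightarrow> fst z \<in> D \<and> \<bar>snd z - H (fst z)\<bar> \<le> \<delta>"
        by (cases z) (auto simp: S region_between_def abs_le_iff)
      also have "\<bar>snd z - H (fst z)\<bar> \<le> \<delta> \<longleftrightarrow> \<bar>\<phi> None (z - z0)\<bar> \<le> 1"
        using \<delta> by (simp add: \<phi>_None abs_divide divide_le_eq)
      finally show ?thesis using mem_D[of "fst z" "snd z"] by (auto simp: mem_pbox)
    qed
    have gH: "g1 x \<le> H x - \<delta>" "H x - L * \<delta> \<le> g1 x" "H x + \<delta> \<le> g2 x" "g2 x \<le> H x + L * \<delta>" if "x \<in> D" for x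
      using g1 g2 that by (auto simp: algebra_simps)
    have SG: "S \<subseteq> G"
      unfolding S G region_between_def using gH by (auto intro: order_trans)
    have G_pbox: "z - z0 \<in> pbox \<phi> (\<lambda>i. if i = None then L else 1)" if "z \<in> G" for z
    proof -
      have z: "fst z \<in> D" "g1 (fst z) \<le> snd z" "snd z \<le> g2 (fst z)"
        using that by (auto simp: G region_between_def)
      then have "\<bar>snd z - H (fst z)\<bar> \<le> L * \<delta>" using gH[OF z(1)] by (auto simp: abs_le_iff)
      then have "\<bar>\<phi> None (z - z0)\<bar> \<le> L" using \<delta> by (simp add: \<phi>_None abs_divide divide_le_eq)
      then show ?thesis using z(1) mem_D[of "fst z" "snd z"] by (auto simp: mem_pbox)
    qed
    have G_seg: "z + t *\<^sub>R e None \<in> G" if "z \<in> G" "z + u *\<^sub>R e None \<in> G" "0 \<le> t" "t \<le> u" for z t u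
    proof -
      have "0 \<le> t * \<delta>" "t * \<delta> \<le> u * \<delta>" using that \<delta> by (auto intro: mult_right_mono)
      then show ?thesis using that(1,2) by (cases z) (auto simp: G region_between_def e_def half_edges_def)
    qed
    \<comment> \<open>On the vertical line through a point of G, all levels between -1 and 1 belong
      to S. Together with \<open>G_seg\<close> this yields the segments towards the slab.\<close>
    have G_level: "z + s *\<^sub>R e None \<in> G" if z: "z \<in> G" and s: "\<bar>\<phi> None (z - z0) + s\<bar> \<le> 1" for z s
    proof -
      have "\<phi> k (z + s *\<^sub>R e None - z0) = \<phi> k (z - z0) + (if k = None then s else 0)" for k
        by (simp add: \<phi>_simps)
      then have "z + s *\<^sub>R e None \<in> S"
        using G_pbox[OF z] s unfolding mem_S mem_pbox by simp
      then show ?thesis using SG by blast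
    qed
    have S_leb: "S \<in> sets lebesgue"
    proof -
      have "S = {z. z + - z0 \<in> cube \<phi> 1}" using mem_S by auto
      also have "\<dots> \<in> sets lebesgue" by (rule lebesgue_sets_shift[OF sets_lebesgue_pbox[OF db]])
      finally show ?thesis .
    qed
    have bounded: "bounded S" "bounded G"
    proof -
      have "G \<subseteq> (+) z0 ` pbox \<phi> (\<lambda>i. if i = None then L else 1)"
      proof
        fix z assume "z \<in> G"
        then show "z \<in> (+) z0 ` pbox \<phi> (\<lambda>i. if i = None then L else 1)"
          by (intro image_eqI[of _ _ "z - z0"] G_pbox) auto
      qed
      then show "bounded G" by (rule bounded_subset[OF bounded_translation[OF bounded_pbox[OF db]]])
      then show "bounded S" using SG by (rule bounded_subset)
    qed
    \<comment> \<open>S contains z0 + e i and z0 - e i. As r u <= 2 implies u <= 2, the steps used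
      below are within the range allowed in the modulus.\<close>
    have diam: "2 * norm (e i) \<le> diameter S" for i
    proof -
      have "z0 + e i \<in> S" "z0 - e i \<in> S"
        by (simp_all add: mem_S pbox_def \<phi>_simps)
      from diameter_bounded_bound[OF bounded(1) this] show ?thesis
        by (simp add: dist_norm flip: scaleR_2)
    qed
    have diam_G: "2 * norm (e i) \<le> diameter G" for i
      using diam[of i] diameter_subset[OF SG bounded(2)] by linarith
    have e_None: "e None = \<delta> *\<^sub>R (0, 1)" "norm (e None) = \<delta>"
      using \<delta> by (auto simp: e_def half_edges_def norm_Pair)
    have "best_approx r f (E \<union> {(0, 1)}) p G \<le> ennreal C * (dir_modulus r f S E p + dir_modulus r f G {(0, 1)} p)"
      if f: "in_Lp p G f" for f
    proof (cases "dir_modulus r f S E p + dir_modulus r f G {(0, 1)} p = \<infinity>")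
      case True
      show ?thesis unfolding True using C by (simp add: ennreal_mult_top)
    next
      case False
      then obtain \<omega> where \<omega>: "0 \<le> \<omega>" "dir_modulus r f S E p + dir_modulus r f G {(0, 1)} p = ennreal \<omega>"
        by (metis ennreal_cases infinity_ennreal_def)
      have \<omega>_S: "dir_modulus r f S E p \<le> ennreal \<omega>" and \<omega>_G: "dir_modulus r f G {(0, 1)} p \<le> ennreal \<omega>"
        unfolding \<omega>(2)[symmetric] by auto
      \<comment> \<open>Extension by zero makes translates and differences measurable on the whole
        space; they agree with those of f when all nodes lie in G.\<close>
      define F where "F z = indicator G z *\<^sub>R f z" for z
      have F: "F \<in> borel_measurable lebesgue" "\<And>z. z \<in> G \<Longrightarrow> F z = f z"
        using f G_leb unfolding F_def in_Lp_def by (auto simp: borel_measurable_restrict_space_iff)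
      have "Lp_norm p G F < \<infinity>"
        using f Lp_norm_cong[of G F f p] F(2) by (simp add: in_Lp_def)
      then obtain B where B: "0 \<le> B" "Lp_norm p G F = ennreal B"
        by (metis ennreal_cases infinity_ennreal_def less_irrefl)
      then have FB: "Lp_le p G F B" by (intro Lp_norm_leD[OF assms(1) _ _ G_leb F(1)]) auto
      define F0 where "F0 z = F (z + z0)" for z
      define Y where "Y = {z. z + z0 \<in> G}"
      have Y: "Y \<in> sets lebesgue" unfolding Y_def by (rule lebesgue_sets_shift[OF G_leb])
      have S_seg: "closed_segment z (z + (real r * u) *\<^sub>R e i) \<subseteq> S"
        if "z \<in> S" "z + (real r * u) *\<^sub>R e i \<in> S" for z u i
      proof -
        have "S = (+) z0 ` cube \<phi> 1"
        proof (intro equalityI subsetI)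
          fix z assume "z \<in> S"
          then show "z \<in> (+) z0 ` cube \<phi> 1" by (intro image_eqI[of _ _ "z - z0"]) (auto simp: mem_S)
        qed (auto simp: mem_S)
        then have "convex S" using convex_translation[OF convex_pbox[OF db]] by simp
        then show ?thesis using that closed_segment_subset by blast
      qed
      have "\<exists>Q\<in>mpolys e (\<lambda>_. r). Lp_le p Y (\<lambda>z. F0 z - Q z) (C * \<omega>)"
      proof (rule region[OF db _ Y, where j=None])
        show "F0 \<in> borel_measurable lebesgue" unfolding F0_def[abs_def] by (rule borel_measurable_shift[OF F(1)])
        show "Lp_le p Y F0 B"
          unfolding F0_def[abs_def] by (rule Lp_le_shift[OF assms(1) FB Y]) (simp add: Y_def)
        show "cube \<phi> 1 \<subseteq> Y"
        proof
          fix z assume "z \<in> cube \<phi> 1"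
          then have "z + z0 \<in> S" by (simp add: mem_S)
          then show "z \<in> Y" using SG by (auto simp: Y_def)
        qed
        show "Y \<subseteq> pbox \<phi> (\<lambda>i. if i = None then L else 1)"
          using G_pbox[of "_ + z0"] by (auto simp: Y_def)
        show "segments_to_slab Y (e None) (\<phi> None) 1"
          unfolding segments_to_slab_def
        proof (intro conjI ballI impI allI)
          fix x t assume x: "x \<in> Y" "\<phi> None x < - 1" "0 \<le> t" "\<phi> None x + t \<le> 1"
          then have z: "x + z0 \<in> G" by (simp add: Y_def)
          \<comment> \<open>The vertical segment from the point up to level 1 has both ends in G,
            hence lies in G.\<close>
          have "x + z0 + (1 - \<phi> None x) *\<^sub>R e None \<in> G"
            using G_level[OF z, of "1 - \<phi> None x"] by simp
          from G_seg[OF z this, of t] show "x + t *\<^sub>R e None \<in> Y"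
            using x by (simp add: Y_def algebra_simps)
        next
          fix x t assume x: "x \<in> Y" "1 < \<phi> None x" "0 \<le> t" "- 1 \<le> \<phi> None x - t"
          then have z: "x + z0 \<in> G" by (simp add: Y_def)
          \<comment> \<open>Downwards, the segment is parametrized from its lower end at level -1,
            because \<open>G_seg\<close> only moves up.\<close>
          have bot: "x + z0 + (- 1 - \<phi> None x) *\<^sub>R e None \<in> G"
            using G_level[OF z, of "- 1 - \<phi> None x"] by simp
          have top: "x + z0 + (- 1 - \<phi> None x) *\<^sub>R e None + (\<phi> None x + 1) *\<^sub>R e None \<in> G"
            using z by (simp add: algebra_simps)
          have "x + z0 + (- 1 - \<phi> None x) *\<^sub>R e None + (\<phi> None x + 1 - t) *\<^sub>R e None \<in> G"
            by (rule G_seg[OF bot top]) (use x in auto)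
          then show "x - t *\<^sub>R e None \<in> Y" by (simp add: Y_def algebra_simps)
        qed
        fix u :: real assume u: "0 < u" "real r * u \<le> 2"
        have "1 * u \<le> real r * u" using assms(2) u(1) by (intro mult_right_mono) auto
        then have u2: "u \<le> 2" using u(2) by simp
        show "Lp_le p {z \<in> cube \<phi> 1. z + (real r * u) *\<^sub>R e i \<in> cube \<phi> 1} (fin_diff r (u *\<^sub>R e i) F0) \<omega>"
          if i: "i \<noteq> None" for i
        proof -
          obtain k where k: "i = Some k" using i by blast
          have ne: "e i \<noteq> 0" using dual_basis_apply[OF db, of i i] \<phi>_simps(5)[of i] by auto
          have "Lp_le p {z \<in> S. z + (real r * u) *\<^sub>R e i \<in> S} (fin_diff r (u *\<^sub>R e i) F) \<omega>"
          proof (rule dir_modulus_step[OF assms(1) \<omega>_S \<omega>(1), where d="lift_direction h (sgn (v k))" and \<kappa>="norm (e i)"])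
            show "lift_direction h (sgn (v k)) \<in> E" by (auto simp: E edge_directions_def)
            show "e i = norm (e i) *\<^sub>R lift_direction h (sgn (v k))"
              unfolding k e_def by (rule half_edges_eq_scaleR_direction)
            show "u * norm (e i) \<le> diameter S"
              using mult_right_mono[OF u2, of "norm (e i)"] diam[of i] by simp
          qed (use ne u S_leb S_seg F SG in auto)
          moreover have "{z \<in> cube \<phi> 1. z + (real r * u) *\<^sub>R e i \<in> cube \<phi> 1}
              = cube \<phi> 1 \<inter> {z. z + (real r * u) *\<^sub>R e i \<in> cube \<phi> 1}" by blast
          then have "{z \<in> cube \<phi> 1. z + (real r * u) *\<^sub>R e i \<in> cube \<phi> 1} \<in> sets lebesgue"
            using lebesgue_sets_shift[OF sets_lebesgue_pbox[OF db]] sets_lebesgue_pbox[OF db] by simp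
          ultimately have "Lp_le p {z \<in> cube \<phi> 1. z + (real r * u) *\<^sub>R e i \<in> cube \<phi> 1}
              (\<lambda>z. fin_diff r (u *\<^sub>R e i) F (z + z0)) \<omega>"
            by (rule Lp_le_shift[OF assms(1)]) (auto simp: mem_S algebra_simps)
          then show ?thesis by (simp add: F0_def[abs_def] fin_diff_add_shift[abs_def])
        qed
        have "Lp_le p {z \<in> G. z + (real r * u) *\<^sub>R e None \<in> G} (fin_diff r (u *\<^sub>R e None) F) \<omega>"
        proof (rule dir_modulus_step[OF assms(1) \<omega>_G \<omega>(1), where d="(0, 1)" and \<kappa>=\<delta>])
          have "u * \<delta> \<le> 2 * \<delta>" using u2 \<delta> by (intro mult_right_mono) auto
          also have "\<dots> \<le> diameter G" using diam_G[of None] e_None(2) by simp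
          finally show "u * \<delta> \<le> diameter G" .
          fix z assume z: "z \<in> G" "z + (real r * u) *\<^sub>R e None \<in> G"
          show "closed_segment z (z + (real r * u) *\<^sub>R e None) \<subseteq> G"
          proof
            fix y assume "y \<in> closed_segment z (z + (real r * u) *\<^sub>R e None)"
            then obtain t where t: "0 \<le> t" "t \<le> 1" "y = (1 - t) *\<^sub>R z + t *\<^sub>R (z + (real r * u) *\<^sub>R e None)"
              by (auto simp: closed_segment_def)
            have "y = z + (t * (real r * u)) *\<^sub>R e None" unfolding t(3) by (simp add: algebra_simps)
            moreover have "t * (real r * u) \<le> 1 * (real r * u)" using t u by (intro mult_right_mono) auto
            ultimately show "y \<in> G" using G_seg[OF z, of "t * (real r * u)"] t u by simp
          qed
        qed (use e_None \<delta> u G_leb F in auto)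
        moreover have "{z \<in> Y. z + (real r * u) *\<^sub>R e None \<in> Y} = Y \<inter> {z. z + (real r * u) *\<^sub>R e None \<in> Y}" by blast
        then have "{z \<in> Y. z + (real r * u) *\<^sub>R e None \<in> Y} \<in> sets lebesgue"
          using lebesgue_sets_shift[OF Y] Y by simp
        ultimately have "Lp_le p {z \<in> Y. z + (real r * u) *\<^sub>R e None \<in> Y} (\<lambda>z. fin_diff r (u *\<^sub>R e None) F (z + z0)) \<omega>"
          by (rule Lp_le_shift[OF assms(1)]) (auto simp: Y_def algebra_simps)
        then show "Lp_le p {z \<in> Y. z + (real r * u) *\<^sub>R e None \<in> Y} (fin_diff r (u *\<^sub>R e None) F0) \<omega>"
          by (simp add: F0_def[abs_def] fin_diff_add_shift[abs_def])
      qed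
      then obtain Q where Q: "Q \<in> mpolys e (\<lambda>_. r)" and Q_le: "Lp_le p Y (\<lambda>z. F0 z - Q z) (C * \<omega>)" by blast
      \<comment> \<open>Undoes the recentring; the polynomial space is translation
        invariant.\<close>
      define P where "P z = Q (z + - z0)" for z
      have P: "P \<in> mpolys e (\<lambda>_. r)" unfolding P_def[abs_def] by (rule mpolys_shift[OF Q])
      have "Lp_le p G (\<lambda>z. F0 (z + - z0) - Q (z + - z0)) (C * \<omega>)"
        by (rule Lp_le_shift[OF assms(1) Q_le G_leb]) (simp add: Y_def)
      then have "Lp_norm p G (\<lambda>z. F z - P z) \<le> ennreal (C * \<omega>)"
        by (intro Lp_norm_leI[OF assms(1)]) (simp add: F0_def P_def)
      moreover have "Lp_norm p G (\<lambda>z. F z - P z) = Lp_norm p G (\<lambda>z. f z - P z)"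
        by (rule Lp_norm_cong) (simp add: F)
      ultimately have P_le: "Lp_norm p G (\<lambda>z. f z - P z) \<le> ennreal (C * \<omega>)" by simp
      have P_mem: "P \<in> directional_polys r (E \<union> {(0, 1)})"
        unfolding directional_polys_def
      proof (intro CollectI conjI allI ballI)
        show "real_polynomial_function P" using P by (simp add: mpolys_def)
        fix x d assume "d \<in> E \<union> {(0, 1)}"
        then consider i where "d = lift_direction h (sgn (v i))" | "d = (0, 1)"
          by (auto simp: E edge_directions_def)
        \<comment> \<open>A degree bound along \<open>e k\<close> passes to every multiple of it, by
          an affine substitution in t.\<close>
        then have "\<exists>k \<kappa>. d = \<kappa> *\<^sub>R e k"
        proof cases
          case (1 i)
          have "e (Some i) = norm (e (Some i)) *\<^sub>R d"
            unfolding 1 e_def by (rule half_edges_eq_scaleR_direction)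
          moreover have "norm (e (Some i)) \<noteq> 0"
            using dual_basis_apply[OF db, of "Some i" "Some i"] \<phi>_simps(5)[of "Some i"] by auto
          ultimately have "d = (1 / norm (e (Some i))) *\<^sub>R e (Some i)"
            by (metis divide_inverse_commute inverse_eq_divide mult_1 real_vector_eq_affinity scaleR_one scaleR_scaleR left_inverse)
          then show ?thesis by blast
        next
          case 2
          then have "d = (1 / \<delta>) *\<^sub>R e None" using \<delta> e_None(1) by simp
          then show ?thesis by blast
        qed
        then obtain k \<kappa> where d: "d = \<kappa> *\<^sub>R e k" by blast
        show "\<exists>q. degree q < r \<and> (\<forall>t. P (x + t *\<^sub>R d) = poly q t)"
          using poly_fun_affine[OF mpolys_poly_fun[OF P, where i=k and x=x], of 0 \<kappa>]
          unfolding poly_fun_def d by (simp add: mult.commute)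
      qed
      have "best_approx r f (E \<union> {(0, 1)}) p G \<le> ennreal (C * \<omega>)"
        unfolding best_approx_def by (rule INF_lower2[OF P_mem]) (rule P_le)
      also have "\<dots> = ennreal C * ennreal \<omega>" using C \<omega>(1) by (simp add: ennreal_mult')
      finally show ?thesis unfolding \<omega>(2) .
    qed
    with SG show ?thesis by blast
  qed
  show ?thesis
  proof (rule exI[of _ C], rule conjI[OF C], intro allI impI, goal_cases)
    case 1
    then show ?case by (rule main)
  qed
qed

end
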